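(* Let $\lambda,\mu$ be integer partitions with at most $\ell$ parts such that $\lambda/\mu$ is a skew shape, let $\nu,\rho,\beta,\eta\in\mathbb{Z}^\ell$, and let $\mathbf{a},\mathbf{b}\in\mathbb{N}^\ell$ be flags. (1) The map $k\mapsto K_{(k\lambda+\nu)/(k\mu+\rho),\,k\beta+\eta}(\mathbf{a},\mathbf{b})$ is polynomial in $k$ for $k$ sufficiently large; that is, there are a polynomial $p\in\mathbb{Q}[t]$ and an integer $k_0$ such that the value equals $p(k)$ for all integers $k\ge k_0$. (2) Furthermore, the map $k\mapsto K_{k\lambda/k\mu,\,k\beta}(\mathbf{a},\mathbf{b})$ is a polynomial in $k$ whenever $k\geq 0$; that is, there is a polynomial $q\in\mathbb{Q}[t]$ such that $K_{k\lambda/k\mu,k\beta}(\mathbf{a},\mathbf{b})=q(k)$ for all integers $k\ge 0$.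
   Context: A flag is a weakly increasing list of non-negative integers. For a skew shape $\lambda/\mu$ with $\ell$ rows (rows may be empty; partitions are padded with zeros to length $\ell$) and flags $\mathbf{a}=(a_1,\dots,a_\ell)$, $\mathbf{b}=(b_1,\dots,b_\ell)$, let $\mathrm{SSYT}(\lambda/\mu,\mathbf{a},\mathbf{b})$ be the set of semistandard Young tableaux of shape $\lambda/\mu$ (positive integer entries, weakly increasing along rows, strictly increasing along columns as the row index increases) such that all entries in row $j$ belong to $\{a_j,a_j+1,\dots,b_j\}$. The flagged skew Kostka coefficient $K_{\lambda/\mu,\beta}(\mathbf{a},\mathbf{b})$ is the number of elements of $\mathrm{SSYT}(\lambda/\mu,\mathbf{a},\mathbf{b})$ with exactly $\beta_i$ entries equal to $i$ for $1\le i\le\ell$ and no other entries. Convention: this number is $0$ if the indexing pair is not a skew shape (i.e. one of the two sequences is not a partition, or the second is not contained in the first) or if the weight has a negative entry. For a sequence $\lambda$, $k\lambda=(k\lambda_1,\dots,k\lambda_\ell)$ and addition is componentwise.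
   Formalization: In (2), q(k) equals the coefficient for all k ≥ 1, and at k = 0 only if the coefficient is nonzero for some k ≥ 1; otherwise it is 1 at k = 0 and 0 for all k ≥ 1, so no polynomial fits (e.g. ℓ=2, λ=β=(1,0), μ=0, a=b=(2,2)). *)

theory Defs
  imports "HOL-Library.FuncSet" "HOL-Computational_Algebra.Polynomial"
begin

text \<open>Sequences of length \<open>l\<close> are functions on \<open>nat\<close> of which only the values at
  \<open>1, \<dots>, l\<close> matter.\<close>

definition is_partition :: "nat \<Rightarrow> (nat \<Rightarrow> int) \<Rightarrow> bool" where
  "is_partition l lam \<longleftrightarrow> antimono_on {1..l} lam \<and> (\<forall>j\<in>{1..l}. 0 \<le> lam j)"

definition is_skew_shape :: "nat \<Rightarrow> (nat \<Rightarrow> int) \<Rightarrow> (nat \<Rightarrow> int) \<Rightarrow> bool" where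
  "is_skew_shape l lam \<mu> \<longleftrightarrow>
     is_partition l lam \<and> is_partition l \<mu> \<and> (\<forall>j\<in>{1..l}. \<mu> j \<le> lam j)"

definition is_flag :: "nat \<Rightarrow> (nat \<Rightarrow> nat) \<Rightarrow> bool" where
  "is_flag l a \<longleftrightarrow> mono_on {1..l} a"

text \<open>A cell is a pair (row, column), both counted from 1.\<close>

definition skew_cells :: "nat \<Rightarrow> (nat \<Rightarrow> int) \<Rightarrow> (nat \<Rightarrow> int) \<Rightarrow> (nat \<times> int) set" where
  "skew_cells l lam \<mu> = {(j, c). j \<in> {1..l} \<and> \<mu> j < c \<and> c \<le> lam j}"

text \<open>Extensionality makes a tableau determined by its entries, so that tableaux can be counted.
  Flags may be 0, hence the separate positivity requirement on the entries.\<close>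

definition flagged_ssyt ::
  "nat \<Rightarrow> (nat \<Rightarrow> int) \<Rightarrow> (nat \<Rightarrow> int) \<Rightarrow> (nat \<Rightarrow> nat) \<Rightarrow> (nat \<Rightarrow> nat) \<Rightarrow> (nat \<times> int \<Rightarrow> nat) set"
where
  "flagged_ssyt l lam \<mu> a b =
     {T \<in> extensional (skew_cells l lam \<mu>).
        (\<forall>(j, c) \<in> skew_cells l lam \<mu>. 0 < T (j, c) \<and> T (j, c) \<in> {a j..b j}) \<and>
        (\<forall>j c c'. (j, c) \<in> skew_cells l lam \<mu> \<longrightarrow> (j, c') \<in> skew_cells l lam \<mu> \<longrightarrow>
           c \<le> c' \<longrightarrow> T (j, c) \<le> T (j, c')) \<and>
        (\<forall>i j c. (i, c) \<in> skew_cells l lam \<mu> \<longrightarrow> (j, c) \<in> skew_cells l lam \<mu> \<longrightarrow>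
           i < j \<longrightarrow> T (i, c) < T (j, c))}"

definition flagged_skew_kostka ::
  "nat \<Rightarrow> (nat \<Rightarrow> int) \<Rightarrow> (nat \<Rightarrow> int) \<Rightarrow> (nat \<Rightarrow> int) \<Rightarrow> (nat \<Rightarrow> nat) \<Rightarrow> (nat \<Rightarrow> nat) \<Rightarrow> nat"
where
  "flagged_skew_kostka l lam \<mu> \<beta> a b =
     (if is_skew_shape l lam \<mu> \<and> (\<forall>i\<in>{1..l}. 0 \<le> \<beta> i)
      then card {T \<in> flagged_ssyt l lam \<mu> a b.
             (\<forall>i\<in>{1..l}. int (card {x \<in> skew_cells l lam \<mu>. T x = i}) = \<beta> i) \<and>
             T ` skew_cells l lam \<mu> \<subseteq> {1..l}}
      else 0)"

text \<open>The empty tableau is counted at dilation factor 0, even if there is no tableau at any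
  positive dilation factor. In that case the dilated coefficient is 1 at 0 and 0 at all positive
  integers, and so it agrees with a polynomial on the positive integers only.\<close>

lemma flagged_skew_kostka_zero: "flagged_skew_kostka l (\<lambda>_. 0) (\<lambda>_. 0) (\<lambda>_. 0) a b = 1"
proof -
  have cells: "skew_cells l (\<lambda>_. 0) (\<lambda>_. 0) = {}"
    by (auto simp: skew_cells_def)
  have "flagged_ssyt l (\<lambda>_. 0) (\<lambda>_. 0) a b = {\<lambda>_. undefined}"
    by (auto simp: flagged_ssyt_def cells)
  then show ?thesis
    by (auto simp: flagged_skew_kostka_def is_skew_shape_def is_partition_def cells
        monotone_on_def)
qed

lemma dilated_kostka_not_polynomial_at_zero:
  defines "lam \<equiv> \<lambda>j::nat. if j = 1 then 1 else 0 :: int"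
  shows "\<nexists>q :: rat poly. \<forall>k::int. 0 \<le> k \<longrightarrow>
           of_nat (flagged_skew_kostka 2 (\<lambda>j. k * lam j) (\<lambda>j. k * 0) (\<lambda>j. k * lam j)
             (\<lambda>_. 2) (\<lambda>_. 2)) = poly q (of_int k)"
proof
  assume "\<exists>q :: rat poly. \<forall>k::int. 0 \<le> k \<longrightarrow>
           of_nat (flagged_skew_kostka 2 (\<lambda>j. k * lam j) (\<lambda>j. k * 0) (\<lambda>j. k * lam j)
             (\<lambda>_. 2) (\<lambda>_. 2)) = poly q (of_int k)"
  then obtain q :: "rat poly" where q: "\<And>k::int. 0 \<le> k \<Longrightarrow>
           of_nat (flagged_skew_kostka 2 (\<lambda>j. k * lam j) (\<lambda>j. k * 0) (\<lambda>j. k * lam j)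
             (\<lambda>_. 2) (\<lambda>_. 2)) = poly q (of_int k)"
    by blast
  have zero: "flagged_skew_kostka 2 (\<lambda>j. k * lam j) (\<lambda>j. k * 0) (\<lambda>j. k * lam j)
      (\<lambda>_. 2) (\<lambda>_. 2) = 0" if k: "1 \<le> k" for k :: int
  proof -
    let ?C = "skew_cells 2 (\<lambda>j. k * lam j) (\<lambda>j. k * 0)"
    have "int (card {x \<in> ?C. T x = 1}) \<noteq> k * lam 1"
      if "T \<in> flagged_ssyt 2 (\<lambda>j. k * lam j) (\<lambda>j. k * 0) (\<lambda>_. 2) (\<lambda>_. 2)" for T
    proof -
      have "{x \<in> ?C. T x = 1} = {}"
        using that by (force simp: flagged_ssyt_def)
      then have "card {x \<in> ?C. T x = 1} = 0"
        by (simp only: card.empty)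
      then show ?thesis
        using k by (simp add: lam_def)
    qed
    then have "{T \<in> flagged_ssyt 2 (\<lambda>j. k * lam j) (\<lambda>j. k * 0) (\<lambda>_. 2) (\<lambda>_. 2).
        (\<forall>i\<in>{1..2}. int (card {x \<in> ?C. T x = i}) = k * lam i) \<and> T ` ?C \<subseteq> {1..2}} = {}"
      by fastforce
    then show ?thesis
      unfolding flagged_skew_kostka_def by (simp only: card.empty if_cancel)
  qed
  have "poly q (of_nat (Suc n)) = 0" for n
    using q[of "int (Suc n)"] zero[of "int (Suc n)"] by simp
  then have "range (\<lambda>n. of_nat (Suc n) :: rat) \<subseteq> {x. poly q x = 0}"
    by blast
  moreover have "infinite (range (\<lambda>n. of_nat (Suc n) :: rat))"
    by (rule range_inj_infinite) (simp add: inj_on_def)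
  ultimately have "q = 0"
    using poly_roots_finite finite_subset by blast
  moreover have "poly q 0 = 1"
    using q[of 0] by (simp add: flagged_skew_kostka_zero)
  ultimately show False by simp
qed

end

theory Submission
  imports Defs "HOL-Combinatorics.Permutations"
begin

text \<open>A tableau is determined by the positions \<open>n\<^sub>j(i)\<close> of the last column of row \<open>j\<close> that holds an
  entry at most \<open>i\<close>. For fixed \<open>j\<close> they describe a walk on the integers from \<open>\<mu>\<^sub>j\<close> to \<open>\<lambda>\<^sub>j\<close> that moves,
  to the right only, at the times \<open>i\<close> with \<open>a\<^sub>j \<le> i \<le> b\<^sub>j\<close>; the walks together cover the distance
  \<open>\<beta>\<^sub>i\<close> at time \<open>i\<close>, and the columns are strict if and only if the walks interlace
  (\<open>kostka_eq_card_patterns\<close>).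

  \<^bold>\<open>Large \<open>k\<close>.\<close> After \<open>n\<^sub>j\<close> is replaced by \<open>n\<^sub>j - j\<close>, interlacing means that no walk jumps onto or over
  the previous position of its neighbour. Exchanging the tails of two walks after a collision is a
  sign-reversing involution, so the coefficient is the sum over all permutations \<open>p\<close>, with signs, of
  the number of families of \<open>l\<close> independent walks from \<open>\<mu>\<^sub>j - j\<close> to \<open>\<lambda>\<^bsub>p(j)\<^esub> - p(j)\<close>
  (\<open>card_noncolliding_walks\<close>); the flags survive the exchange because they increase. Independent
  walks are non-negative integer matrices with a prescribed support \<open>E\<close> and prescribed margins that
  are affine in \<open>k\<close>. The number \<open>f(k)\<close> of such matrices is polynomial for large \<open>k\<close>
  (\<open>eventually_poly_flows\<close>). Suppose that there is a matrix \<open>q\<close> whose margins are the coefficients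
  of \<open>k\<close>. Subtracting \<open>q\<close> unit by unit turns matrices counted by \<open>f(k)\<close> into matrices counted by
  \<open>f(k - 1)\<close>, and each unit loses the matrices that vanish at one position. So \<open>f(k) - f(k - 1)\<close> is a
  sum of counts for smaller supports, and \<open>f\<close> is polynomial for large \<open>k\<close> by induction on \<open>E\<close>. If
  there is no such \<open>q\<close>, then \<open>f(k) = 0\<close> for large \<open>k\<close>, because transportation polytopes are integral.

  \<^bold>\<open>All \<open>k \<ge> 0\<close>.\<close> Without the shifts by \<open>\<nu>, \<rho>, \<eta>\<close> the interlacing families are the lattice points
  at level \<open>k\<close> of a pointed rational cone. By Ehrhart's theory the number of these points satisfies a
  linear recurrence \<open>\<Prod>\<^sub>m (1 - S\<^sup>m) f = 0\<close>, where \<open>(S f)(k) = f(k - 1)\<close>, and it does so as soon as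
  all arguments in it are non-negative, unless the cone is the origin alone
  (\<open>bdiffs_num_points_cone\<close>). The exception is the reason for the proviso at \<open>k = 0\<close>. The
  recurrence can be run backwards, and a polynomial satisfies one of the same kind; so a function
  that satisfies the recurrence and agrees with a polynomial for large \<open>k\<close> agrees with it for all
  \<open>k \<ge> 0\<close> (\<open>eq_poly_of_bdiffs_zero\<close>).\<close>

section \<open>Functions that are polynomial for large arguments\<close>

definition eventually_poly :: "(int \<Rightarrow> rat) \<Rightarrow> bool" where
  "eventually_poly f \<longleftrightarrow> (\<exists>p. \<forall>\<^sub>F k in at_top. f k = poly p (of_int k))"

lemma eventually_poly_cong:
  assumes "eventually_poly f" "\<forall>\<^sub>F k in at_top. g k = f k"
  shows "eventually_poly g"
proof -
  obtain p where "\<forall>\<^sub>F k in at_top. f k = poly p (of_int k)"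
    using assms(1) by (auto simp: eventually_poly_def)
  with assms(2) have "\<forall>\<^sub>F k in at_top. g k = poly p (of_int k)"
    by eventually_elim simp
  then show ?thesis by (auto simp: eventually_poly_def)
qed

lemma eventually_poly_const: "eventually_poly (\<lambda>_. c)"
  unfolding eventually_poly_def by (rule exI[of _ "[:c:]"]) simp

lemma eventually_poly_add:
  assumes "eventually_poly f" "eventually_poly g"
  shows "eventually_poly (\<lambda>k. f k + g k)"
proof -
  obtain p q where "\<forall>\<^sub>F k in at_top. f k = poly p (of_int k)"
      "\<forall>\<^sub>F k in at_top. g k = poly q (of_int k)"
    using assms by (auto simp: eventually_poly_def)
  then have "\<forall>\<^sub>F k in at_top. f k + g k = poly (p + q) (of_int k)"
    by eventually_elim simp
  then show ?thesis unfolding eventually_poly_def by blast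
qed

lemma eventually_poly_cmult:
  assumes "eventually_poly f"
  shows "eventually_poly (\<lambda>k. c * f k)"
proof -
  obtain p where "\<forall>\<^sub>F k in at_top. f k = poly p (of_int k)"
    using assms by (auto simp: eventually_poly_def)
  then have "\<forall>\<^sub>F k in at_top. c * f k = poly (smult c p) (of_int k)"
    by eventually_elim simp
  then show ?thesis unfolding eventually_poly_def by blast
qed

lemma eventually_poly_sum:
  assumes "finite A" "\<And>i. i \<in> A \<Longrightarrow> eventually_poly (f i)"
  shows "eventually_poly (\<lambda>k. \<Sum>i\<in>A. f i k)"
  using assms by (induction A) (auto intro: eventually_poly_const eventually_poly_add)

text \<open>Subtracting \<open>(x - 1) ^ (n + 1)\<close> from \<open>x ^ (n + 1)\<close> leaves \<open>(n + 1) x ^ n\<close> and lower powers,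
  so the powers are backward differences of polynomials by induction on the exponent.\<close>

lemma poly_antidifference_power:
  "\<exists>P :: rat poly. \<forall>x. poly P x - poly P (x - 1) = x ^ n"
proof (induction n rule: less_induct)
  case (less n)
  then obtain Q :: "nat \<Rightarrow> rat poly"
    where Q: "\<And>i x. i < n \<Longrightarrow> poly (Q i) x - poly (Q i) (x - 1) = x ^ i"
    by metis
  define c :: "nat \<Rightarrow> rat" where "c i = of_nat (Suc n choose i) * (- 1) ^ (Suc n - i)" for i
  have expand: "(x - 1) ^ Suc n = x ^ Suc n - of_nat (Suc n) * x ^ n + (\<Sum>i<n. c i * x ^ i)" for x
  proof -
    have "(x - 1) ^ Suc n = (\<Sum>i\<le>Suc n. c i * x ^ i)"
      using binomial_ring[of x "-1" "Suc n"] by (simp add: c_def mult_ac)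
    also have "\<dots> = c (Suc n) * x ^ Suc n + c n * x ^ n + (\<Sum>i<n. c i * x ^ i)"
      by (simp add: lessThan_Suc_atMost[symmetric])
    finally show ?thesis by (simp add: c_def left_diff_distrib right_diff_distrib ring_distribs)
  qed
  let ?P = "smult (1 / of_nat (Suc n)) (monom 1 (Suc n) + (\<Sum>i<n. smult (c i) (Q i)))"
  have "poly ?P x - poly ?P (x - 1) = x ^ n" for x
  proof -
    have "of_nat (Suc n) * (poly ?P x - poly ?P (x - 1)) =
        x ^ Suc n - (x - 1) ^ Suc n + (\<Sum>i<n. c i * (poly (Q i) x - poly (Q i) (x - 1)))"
      by (simp only: poly_smult poly_add poly_monom poly_sum)
        (simp add: field_simps sum_subtractf del: of_nat_Suc power_Suc)
    also have "(\<Sum>i<n. c i * (poly (Q i) x - poly (Q i) (x - 1))) = (\<Sum>i<n. c i * x ^ i)"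
      using Q by (intro sum.cong) auto
    also have "x ^ Suc n - (x - 1) ^ Suc n + (\<Sum>i<n. c i * x ^ i) = of_nat (Suc n) * x ^ n"
      unfolding expand by simp
    finally show ?thesis
      using mult_left_cancel[OF of_nat_neq_0] by blast
  qed
  then show ?case by blast
qed

lemma poly_antidifference:
  fixes p :: "rat poly"
  shows "\<exists>P. \<forall>x. poly P x - poly P (x - 1) = poly p x"
proof -
  obtain Q :: "nat \<Rightarrow> rat poly" where Q: "\<And>i x. poly (Q i) x - poly (Q i) (x - 1) = x ^ i"
    using poly_antidifference_power by metis
  have "poly (\<Sum>i\<le>degree p. smult (coeff p i) (Q i)) x
      - poly (\<Sum>i\<le>degree p. smult (coeff p i) (Q i)) (x - 1) = poly p x" for x
  proof -
    have "poly (\<Sum>i\<le>degree p. smult (coeff p i) (Q i)) x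
        - poly (\<Sum>i\<le>degree p. smult (coeff p i) (Q i)) (x - 1)
        = (\<Sum>i\<le>degree p. coeff p i * (poly (Q i) x - poly (Q i) (x - 1)))"
      by (simp add: poly_sum sum_subtractf right_diff_distrib)
    also have "\<dots> = (\<Sum>i\<le>degree p. coeff p i * x ^ i)" by (simp only: Q)
    also have "\<dots> = poly p x" by (rule poly_altdef[symmetric])
    finally show ?thesis .
  qed
  then show ?thesis by blast
qed

text \<open>Summation of the polynomial that the differences agree with, from the point on where they do.\<close>

lemma eventually_poly_of_difference:
  assumes "eventually_poly (\<lambda>k. f k - f (k - 1))"
  shows "eventually_poly f"
proof -
  obtain p where "\<forall>\<^sub>F k in at_top. f k - f (k - 1) = poly p (of_int k)"
    using assms by (auto simp: eventually_poly_def)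
  then obtain k0 where k0: "\<And>k. k \<ge> k0 \<Longrightarrow> f k - f (k - 1) = poly p (of_int k)"
    by (auto simp: eventually_at_top_linorder)
  obtain P where P: "\<And>x. poly P x - poly P (x - 1) = poly p x"
    using poly_antidifference by metis
  define c where "c = f k0 - poly P (of_int k0)"
  have "f k = poly (P + [:c:]) (of_int k)" if "k \<ge> k0" for k
    using that
  proof (induction k rule: int_ge_induct)
    case base
    show ?case by (simp add: c_def)
  next
    case (step k)
    show ?case using step k0[of "k + 1"] P[of "of_int (k + 1)"] by simp
  qed
  then show ?thesis
    unfolding eventually_poly_def eventually_at_top_linorder by blast
qed

section \<open>Recurrences that are products of difference operators\<close>

text \<open>The product of the operators \<open>1 - S\<^sup>m\<close> over the entries \<open>m\<close> of the list, where
  \<open>(S f)(k) = f(k - 1)\<close>. Its value at \<open>k\<close> depends on the arguments from \<open>k - sum_list ms\<close> to \<open>k\<close>.\<close>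

fun bdiffs :: "int list \<Rightarrow> (int \<Rightarrow> rat) \<Rightarrow> int \<Rightarrow> rat" where
  "bdiffs [] f = f"
| "bdiffs (m # ms) f = bdiffs ms (\<lambda>k. f k - f (k - m))"

lemma bdiffs_append: "bdiffs (ms @ ns) f = bdiffs ns (bdiffs ms f)"
  by (induction ms arbitrary: f) auto

lemma bdiffs_diff: "bdiffs ms (\<lambda>k. f k - g k) = (\<lambda>k. bdiffs ms f k - bdiffs ms g k)"
proof (induction ms arbitrary: f g)
  case (Cons m ms)
  have "(\<lambda>k. (f k - g k) - (f (k - m) - g (k - m))) = (\<lambda>k. (f k - f (k - m)) - (g k - g (k - m)))"
    by auto
  then show ?case by (simp only: bdiffs.simps Cons)
qed simp

lemma bdiffs_shift: "bdiffs ms (\<lambda>k. f (k + c)) = (\<lambda>k. bdiffs ms f (k + c))"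
proof (induction ms arbitrary: f)
  case (Cons m ms)
  have "bdiffs (m # ms) (\<lambda>k. f (k + c)) = bdiffs ms (\<lambda>k. (\<lambda>k. f k - f (k - m)) (k + c))"
    by (simp add: algebra_simps)
  also have "\<dots> = (\<lambda>k. bdiffs (m # ms) f (k + c))" using Cons[of "\<lambda>k. f k - f (k - m)"] by simp
  finally show ?case .
qed simp

lemma bdiffs_commute: "bdiffs ms (bdiffs ns f) = bdiffs ns (bdiffs ms f)"
proof (induction ns arbitrary: f)
  case (Cons n ns)
  have "bdiffs ms (\<lambda>k. f k - f (k - n)) = (\<lambda>k. bdiffs ms f k - bdiffs ms f (k - n))"
    using bdiffs_shift[of ms f "-n"] by (simp add: bdiffs_diff)
  then show ?case using Cons by simp
qed simp

lemma bdiffs_zero: "bdiffs ms (\<lambda>_. 0) = (\<lambda>_. 0)"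
  by (induction ms) auto

lemma bdiffs_sum: "bdiffs ms (\<lambda>k. \<Sum>i\<in>A. f i k) = (\<lambda>k. \<Sum>i\<in>A. bdiffs ms (f i) k)"
proof (induction ms arbitrary: f)
  case (Cons m ms)
  show ?case by (simp add: sum_subtractf[symmetric] Cons)
qed simp

lemma bdiffs_eq_0:
  assumes "\<forall>m\<in>set ms. 0 < m" "\<And>k'. k' \<ge> k - sum_list ms \<Longrightarrow> f k' = 0"
  shows "bdiffs ms f k = 0"
  using assms
proof (induction ms arbitrary: f)
  case (Cons m ms)
  have "0 < m" using Cons.prems(1) by simp
  have "f k' - f (k' - m) = 0" if "k' \<ge> k - sum_list ms" for k'
    using Cons.prems(2)[of k'] Cons.prems(2)[of "k' - m"] that \<open>0 < m\<close> by simp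
  then show ?case using Cons.IH Cons.prems(1) by auto
qed auto

text \<open>The recurrence can be run backwards. The factors are removed one at a time: a function that is
  killed by a single factor is periodic, and a periodic function that vanishes eventually is zero.\<close>

lemma zero_of_bdiffs_zero:
  assumes "\<forall>m\<in>set ms. 0 < m"
    and "\<And>k. k \<ge> sum_list ms \<Longrightarrow> bdiffs ms h k = 0"
    and "\<forall>\<^sub>F k in at_top. h k = 0"
    and "k \<ge> 0"
  shows "h k = 0"
  using assms
proof (induction ms arbitrary: h k)
  case (Cons m ms)
  have m: "0 < m" using Cons.prems(1) by simp
  obtain K where K: "\<And>k. k \<ge> K \<Longrightarrow> h k = 0"
    using Cons.prems(3) by (auto simp: eventually_at_top_linorder)
  define h' where "h' = (\<lambda>k. h (k + m) - h k)"
  have "bdiffs ms h' k = 0" if "k \<ge> sum_list ms" for k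
    using Cons.prems(2)[of "k + m"] that
      fun_cong[OF bdiffs_shift[of ms "\<lambda>k. h k - h (k - m)" m], of k]
    by (simp add: h'_def)
  moreover have "\<forall>\<^sub>F k in at_top. h' k = 0"
    using K m unfolding eventually_at_top_linorder h'_def by (intro exI[of _ K]) auto
  ultimately have per: "h (k + m) = h k" if "k \<ge> 0" for k
    using Cons.IH[of h' k] Cons.prems(1) that by (simp add: h'_def)
  have "h (k + of_nat n * m) = h k" for n
  proof (induction n)
    case (Suc n)
    have "h (k + of_nat n * m + m) = h (k + of_nat n * m)"
      using Cons.prems(4) m by (intro per) simp
    then show ?case using Suc by (simp add: algebra_simps)
  qed simp
  moreover have "K \<le> k + of_nat (nat \<bar>K\<bar>) * m"
  proof -
    have "\<bar>K\<bar> * 1 \<le> \<bar>K\<bar> * m" using m by (intro mult_left_mono) auto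
    then show ?thesis using Cons.prems(4) by simp
  qed
  ultimately show ?case using K by metis
qed (auto simp: eventually_at_top_linorder)

lemma degree_difference_less:
  fixes p :: "rat poly"
  assumes "degree p \<noteq> 0"
  shows "degree (p - pcompose p [:-1, 1:]) < degree p"
proof -
  let ?q = "pcompose p [:-1, 1:]"
  have deg: "degree ?q = degree p" by (simp add: degree_pcompose)
  have "coeff ?q (degree p) = coeff p (degree p)"
    using lead_coeff_comp[of "[:-1, 1::rat:]" p] deg by simp
  then have "coeff (p - ?q) (degree p) = 0" by simp
  moreover have "degree (p - ?q) \<le> degree p" using deg degree_diff_le[of p "degree p" ?q] by simp
  ultimately show ?thesis
    using assms by (metis degree_0 leading_coeff_0_iff le_neq_implies_less)
qed

lemma bdiffs_poly_zero:
  "\<exists>n. bdiffs (replicate n 1) (\<lambda>k. poly p (of_int k)) = (\<lambda>_. 0)"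
proof (induction "degree p" arbitrary: p rule: less_induct)
  case less
  let ?d = "p - pcompose p [:-1, 1:]"
  have d: "(\<lambda>k. poly p (of_int k) - poly p (of_int (k - 1))) = (\<lambda>k::int. poly ?d (of_int k))"
    by (simp add: poly_pcompose)
  show ?case
  proof (cases "degree p = 0")
    case True
    then obtain c where "p = [:c:]" by (metis degree_eq_zeroE)
    then show ?thesis by (intro exI[of _ 1]) simp
  next
    case False
    then obtain n where "bdiffs (replicate n 1) (\<lambda>k. poly ?d (of_int k)) = (\<lambda>_. 0)"
      using less degree_difference_less by blast
    then have "bdiffs (replicate (Suc n) 1) (\<lambda>k. poly p (of_int k)) = (\<lambda>_. 0)"
      using d by simp
    then show ?thesis by blast
  qed
qed

text \<open>A power of \<open>1 - S\<close> kills the polynomial. Times the given operator it kills the difference of the two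
  functions, which vanishes eventually and hence everywhere on the non-negative integers.\<close>

lemma eq_poly_of_bdiffs_zero:
  assumes ms: "\<forall>m\<in>set ms. 0 < m"
    and f: "\<And>k. k \<ge> sum_list ms \<Longrightarrow> bdiffs ms f k = 0"
    and p: "\<forall>\<^sub>F k in at_top. f k = poly p (of_int k)"
    and "k \<ge> 0"
  shows "f k = poly p (of_int k)"
proof -
  let ?P = "\<lambda>k. poly p (of_int k)"
  obtain n where n: "bdiffs (replicate n 1) ?P = (\<lambda>_. 0)"
    using bdiffs_poly_zero by blast
  have "f k - ?P k = 0"
  proof (rule zero_of_bdiffs_zero[where ms = "ms @ replicate n 1" and h = "\<lambda>k. f k - ?P k"])
    show "\<forall>m\<in>set (ms @ replicate n 1). 0 < m" using ms by auto
    show "\<forall>\<^sub>F k in at_top. f k - ?P k = 0" using p by eventually_elim simp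
    show "bdiffs (ms @ replicate n 1) (\<lambda>k. f k - ?P k) k = 0"
      if "k \<ge> sum_list (ms @ replicate n 1)" for k
    proof -
      have "bdiffs (replicate n 1) (bdiffs ms f) k = 0"
        using that by (intro bdiffs_eq_0[of _ _ "bdiffs ms f"] f) auto
      moreover have "bdiffs (replicate n 1) (bdiffs ms ?P) k = 0"
        unfolding bdiffs_commute[of _ ms] n by (simp add: bdiffs_zero)
      ultimately show ?thesis by (simp add: bdiffs_append bdiffs_diff)
    qed
  qed (fact \<open>k \<ge> 0\<close>)
  then show ?thesis by simp
qed

section \<open>Lattice points in dilated rational polytopes\<close>

text \<open>In terms of generating functions, for \<open>f\<close> with support bounded below: \<open>\<Sum>\<^sub>k f(k) z\<^sup>k\<close> is a
  rational function with denominator \<open>\<Prod>\<^sub>m (1 - z\<^sup>m)\<close>, and \<open>P\<close>, which is closed upwards in all uses, contains the integers that exceed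
  a bound on its degree. For \<open>P K \<longleftrightarrow> 0 \<le> K\<close> the recurrence holds wherever its arguments are
  non-negative.\<close>

definition vanishes :: "(int \<Rightarrow> bool) \<Rightarrow> int list \<Rightarrow> (int \<Rightarrow> rat) \<Rightarrow> bool" where
  "vanishes P ms f \<longleftrightarrow> (\<forall>k. P (k - sum_list ms) \<longrightarrow> bdiffs ms f k = 0)"

text \<open>Multiplying numerator and denominator by further factors does not change the degree.\<close>

lemma vanishes_append:
  assumes "vanishes P ms f" "\<forall>n\<in>set ns. 0 < n" "\<And>k k'. P k \<Longrightarrow> k \<le> k' \<Longrightarrow> P k'"
  shows "vanishes P (ms @ ns) f"
  unfolding vanishes_def bdiffs_append
proof (intro allI impI)
  fix k assume k: "P (k - sum_list (ms @ ns))"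
  show "bdiffs ns (bdiffs ms f) k = 0"
  proof (rule bdiffs_eq_0[OF assms(2)])
    fix k' assume "k' \<ge> k - sum_list ns"
    then have "P (k' - sum_list ms)" using k by (elim assms(3)) simp
    then show "bdiffs ms f k' = 0" using assms(1) by (simp add: vanishes_def)
  qed
qed

lemma vanishes_common:
  assumes "finite A"
    and "\<And>i. i \<in> A \<Longrightarrow> \<exists>ms. (\<forall>m\<in>set ms. 0 < m) \<and> vanishes (P i) ms (f i)"
    and up: "\<And>i k k'. i \<in> A \<Longrightarrow> P i k \<Longrightarrow> k \<le> k' \<Longrightarrow> P i k'"
  shows "\<exists>ms. (\<forall>m\<in>set ms. 0 < m) \<and> (\<forall>i\<in>A. vanishes (P i) ms (f i))"
  using assms
proof (induction A)
  case empty
  show ?case by (intro exI[of _ "[]"]) simp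
next
  case (insert i A)
  have "\<exists>ms. (\<forall>m\<in>set ms. 0 < m) \<and> (\<forall>i\<in>A. vanishes (P i) ms (f i))"
  proof (rule insert.IH)
    show "\<exists>ms. (\<forall>m\<in>set ms. 0 < m) \<and> vanishes (P i') ms (f i')" if "i' \<in> A" for i'
      using insert.prems(1) that by simp
    show "P i' k'" if "i' \<in> A" "P i' k" "k \<le> k'" for i' k k'
      using insert.prems(2)[of i' k k'] that by simp
  qed
  then obtain ms where ms: "\<forall>m\<in>set ms. 0 < m" "\<forall>i\<in>A. vanishes (P i) ms (f i)"
    by blast
  obtain ns where ns: "\<forall>m\<in>set ns. 0 < m" "vanishes (P i) ns (f i)"
    using insert.prems by blast
  have "vanishes (P i) (ns @ ms) (f i)"
    by (rule vanishes_append[OF ns(2) ms(1)]) (use insert.prems(2)[of i] in simp)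
  then have "vanishes (P i) (ms @ ns) (f i)"
    by (simp add: vanishes_def bdiffs_append bdiffs_commute add.commute)
  moreover have "vanishes (P i') (ms @ ns) (f i')" if "i' \<in> A" for i'
    by (rule vanishes_append) (use ms ns that insert.prems(2)[of i'] in simp_all)
  ultimately have "\<forall>i'\<in>insert i A. vanishes (P i') (ms @ ns) (f i')" by simp
  moreover have "\<forall>m\<in>set (ms @ ns). 0 < m" using ms ns by auto
  ultimately show ?case by blast
qed

text \<open>The cone over a rational polytope: the members of \<open>J\<close> are the linear forms that cut it out, and
  \<open>lev\<close> is the height. That the polytope is bounded appears as the last two assumptions.\<close>

locale graded_cone =
  fixes \<Lambda> :: "('i \<Rightarrow> int) set" and J :: "(('i \<Rightarrow> int) \<Rightarrow> int) set" and lev :: "('i \<Rightarrow> int) \<Rightarrow> int"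
  assumes finite_J: "finite J"
    and lattice: "x \<in> \<Lambda> \<Longrightarrow> y \<in> \<Lambda> \<Longrightarrow> (\<lambda>i. c * x i + d * y i) \<in> \<Lambda>"
    and zero_mem: "(\<lambda>_. 0) \<in> \<Lambda>"
    and linear: "a \<in> insert lev J \<Longrightarrow> a (\<lambda>i. c * x i + d * y i) = c * a x + d * a y"
    and finite_level: "finite {x \<in> \<Lambda>. (\<forall>a\<in>J. 0 \<le> a x) \<and> lev x = k}"
    and pointed: "x \<in> \<Lambda> \<Longrightarrow> \<forall>a\<in>J. 0 \<le> a x \<Longrightarrow> lev x \<le> 0 \<Longrightarrow> x = (\<lambda>_. 0)"
begin

text \<open>Half-open faces: the forms in \<open>Z\<close> vanish, and those in \<open>S\<close> mark the faces that are removed.\<close>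

definition face :: "(('i \<Rightarrow> int) \<Rightarrow> int) set \<Rightarrow> (('i \<Rightarrow> int) \<Rightarrow> int) set \<Rightarrow> ('i \<Rightarrow> int) set" where
  "face Z S = {z \<in> \<Lambda>. (\<forall>a\<in>J. 0 \<le> a z) \<and> (\<forall>a\<in>Z. a z = 0) \<and> (\<forall>a\<in>S. 0 < a z)}"

text \<open>The lattice points of the translate of a half-open face by the rational vector \<open>v / N\<close>.\<close>

definition shifted_face where
  "shifted_face N v Z S = {x \<in> \<Lambda>. (\<lambda>i. N * x i - v i) \<in> face Z S}"

definition num_points :: "('i \<Rightarrow> int) set \<Rightarrow> int \<Rightarrow> rat" where
  "num_points X k = of_nat (card {x \<in> X. lev x = k})"

lemma linear_diff: "a \<in> insert lev J \<Longrightarrow> a (\<lambda>i. c * x i - y i) = c * a x - a y"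
  using linear[of a c x "-1" y] by simp

lemma linear_add: "a \<in> insert lev J \<Longrightarrow> a (\<lambda>i. x i + y i) = a x + a y"
  using linear[of a 1 x 1 y] by simp

lemma linear_zero: "a \<in> insert lev J \<Longrightarrow> a (\<lambda>_. 0) = 0"
  using linear[of a 0 "\<lambda>_. 0" 0 "\<lambda>_. 0"] by simp

lemma lattice_add: "x \<in> \<Lambda> \<Longrightarrow> y \<in> \<Lambda> \<Longrightarrow> (\<lambda>i. x i + y i) \<in> \<Lambda>"
  using lattice[of x y 1 1] by simp

lemma lattice_diff: "x \<in> \<Lambda> \<Longrightarrow> y \<in> \<Lambda> \<Longrightarrow> (\<lambda>i. c * x i - y i) \<in> \<Lambda>"
  using lattice[of x y c "-1"] by simp

lemma mem_shifted_face:
  assumes "v \<in> \<Lambda>" "Z \<subseteq> J" "S \<subseteq> J"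
  shows "x \<in> shifted_face N v Z S \<longleftrightarrow> x \<in> \<Lambda> \<and> (\<forall>a\<in>J. a v \<le> N * a x) \<and>
    (\<forall>a\<in>Z. N * a x = a v) \<and> (\<forall>a\<in>S. a v < N * a x)"
proof -
  let ?y = "\<lambda>i. N * x i - v i"
  have "0 \<le> a ?y \<longleftrightarrow> a v \<le> N * a x" "a ?y = 0 \<longleftrightarrow> N * a x = a v" "0 < a ?y \<longleftrightarrow> a v < N * a x"
    if "a \<in> J" for a
    using that by (simp_all add: linear_diff)
  then show ?thesis
    using lattice_diff[of x v N] assms
    unfolding shifted_face_def face_def mem_Collect_eq by blast
qed

lemma finite_shifted_face:
  assumes "v \<in> \<Lambda>" "0 < N"
  shows "finite {x \<in> shifted_face N v Z S. lev x = k}"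
proof -
  let ?h = "\<lambda>x i. N * x i - v i"
  have "?h ` {x \<in> shifted_face N v Z S. lev x = k}
      \<subseteq> {x \<in> \<Lambda>. (\<forall>a\<in>J. 0 \<le> a x) \<and> lev x = N * k - lev v}"
    by (auto simp: shifted_face_def face_def linear_diff)
  then have "finite (?h ` {x \<in> shifted_face N v Z S. lev x = k})"
    using finite_level finite_subset by blast
  moreover have "inj_on ?h UNIV"
  proof (rule inj_onI, rule ext)
    fix x y i assume "?h x = ?h y"
    then have "?h x i = ?h y i" by (rule fun_cong)
    then show "x i = y i" using \<open>0 < N\<close> by simp
  qed
  ultimately show ?thesis
    using finite_imageD inj_on_subset by blast
qed

text \<open>The quotients \<open>num j / den j\<close> are compared by cross multiplication.\<close>

lemma lex_argmin:
  fixes num den :: "'b \<Rightarrow> int" and rk :: "'b \<Rightarrow> nat"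
  assumes "finite T" "T \<noteq> {}" "inj_on rk T" "\<And>j. j \<in> T \<Longrightarrow> 0 < den j"
  shows "\<exists>j\<in>T. \<forall>j'\<in>T. num j * den j' \<le> num j' * den j \<and>
    (rk j' < rk j \<longrightarrow> num j * den j' < num j' * den j)"
proof -
  define t where "t j = (of_int (num j) / of_int (den j) :: rat)" for j
  define T' where "T' = {j \<in> T. \<forall>j'\<in>T. t j \<le> t j'}"
  obtain j0 where "j0 \<in> T" "t j0 = Min (t ` T)"
  proof -
    have "Min (t ` T) \<in> t ` T" using assms(1,2) by simp
    then show ?thesis by (elim imageE) (rule that, assumption, rule sym)
  qed
  then have "j0 \<in> T'" using assms(1) by (auto simp: T'_def)
  define j where "j = arg_min_on rk T'"
  have fin: "finite T'" using assms(1) by (simp add: T'_def)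
  have j: "j \<in> T'" "\<And>j'. j' \<in> T' \<Longrightarrow> rk j \<le> rk j'"
    using arg_min_if_finite[of T' rk] fin \<open>j0 \<in> T'\<close> unfolding j_def
    by (auto simp: not_less[symmetric])
  have t_le: "t i \<le> t i' \<longleftrightarrow> num i * den i' \<le> num i' * den i" if "i \<in> T" "i' \<in> T" for i i'
  proof -
    have "t i \<le> t i' \<longleftrightarrow> (of_int (num i * den i') :: rat) \<le> of_int (num i' * den i)"
      using assms(4)[OF that(1)] assms(4)[OF that(2)] by (simp add: t_def divide_simps)
    then show ?thesis by (simp only: of_int_le_iff)
  qed
  show ?thesis
  proof (intro bexI ballI conjI impI)
    show "j \<in> T" using j by (simp add: T'_def)
    fix j' assume j': "j' \<in> T"
    then show "num j * den j' \<le> num j' * den j"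
      using t_le[OF \<open>j \<in> T\<close> j'] j by (auto simp: T'_def)
    assume "rk j' < rk j"
    then have "j' \<notin> T'" using j(2) by (meson not_less)
    then obtain i where i: "i \<in> T" "t i < t j'" using j' by (auto simp: T'_def)
    then have "t j < t j'" using j(1) by (force simp: T'_def)
    then show "num j * den j' < num j' * den j"
      using t_le[OF j' \<open>j \<in> T\<close>] by (simp add: not_le[symmetric])
  qed
qed


text \<open>The generating function by level of the lattice points in a translate of a half-open face is
  rational. Its degree is at most the level of the translation vector, and less than that if the face
  is closed and not just the origin; it is this gain that makes the recurrence valid from the start.

  Take a point \<open>q \<noteq> 0\<close> of the face. Moving from a lattice point \<open>x\<close> in direction \<open>- q\<close>, one leaves the
  translated face through the facet of some form \<open>j\<close>, after a possibly fractional number \<open>t\<close> of steps. The points for which the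
  full step \<open>- q\<close> is impossible are sorted by \<open>j\<close> and \<open>t\<close>. The piece for \<open>(j, t)\<close> is again a
  translate of a half-open face, of smaller dimension, and the translation vector grows by \<open>t q\<close>. Here
  \<open>t < 1\<close> if the facet belongs to the face, and \<open>t \<le> 1\<close> if it has been removed. All points arise
  from the pieces by adding multiples of \<open>q\<close>, which divides the generating function by
  \<open>1 - z\<^bsup>lev q\<^esup>\<close> and lowers the degree by \<open>lev q\<close>.\<close>

lemma vanishes_num_points:
  assumes "Z \<subseteq> J" "S \<subseteq> J" "v \<in> \<Lambda>" "0 < N"
  shows "\<exists>ms. (\<forall>m\<in>set ms. 0 < m) \<and>
    vanishes (\<lambda>K. lev v < N * K) ms (num_points (shifted_face N v Z S)) \<and>
    (S = {} \<and> (\<exists>q\<in>face Z S. q \<noteq> (\<lambda>_. 0)) \<longrightarrow>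
      vanishes (\<lambda>K. lev v \<le> N * K) ms (num_points (shifted_face N v Z S)))"
  using assms
proof (induction "card (J - Z)" arbitrary: Z S v N rule: less_induct)
  case less
  note ZJ = less.prems(1) and SJ = less.prems(2) and v = less.prems(3) and N = less.prems(4)
  define X where "X = shifted_face N v Z S"
  show ?case
  proof (cases "\<exists>q\<in>face Z S. q \<noteq> (\<lambda>_. 0)")
    case False
    have "num_points X k = 0" if "lev v < N * k" for k
    proof -
      have "lev x \<noteq> k" if "x \<in> X" for x
      proof -
        have "(\<lambda>i. N * x i - v i) = (\<lambda>_. 0)"
          using that False by (auto simp: X_def shifted_face_def)
        then have "N * lev x - lev v = 0"
          using linear_diff[of lev N x v] linear_zero[of lev] by simp
        then show ?thesis using \<open>lev v < N * k\<close> by auto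
      qed
      then have "{x \<in> X. lev x = k} = {}" by blast
      then show ?thesis by (simp only: num_points_def card.empty of_nat_0)
    qed
    then show ?thesis
      using False by (intro exI[of _ "[]"]) (simp add: vanishes_def X_def)
  next
    case True
    then obtain q where q: "q \<in> face Z S" "q \<noteq> (\<lambda>_. 0)" by blast
    have q\<Lambda>: "q \<in> \<Lambda>" and q_nonneg: "\<And>a. a \<in> J \<Longrightarrow> 0 \<le> a q" and qZ: "\<And>a. a \<in> Z \<Longrightarrow> a q = 0"
      and qS: "\<And>a. a \<in> S \<Longrightarrow> 0 < a q"
      using q(1) by (auto simp: face_def)
    define m where "m = lev q"
    have m: "0 < m" using pointed[OF q\<Lambda>] q_nonneg q(2) by (force simp: m_def not_le[symmetric])
    define T where "T = {a \<in> J. 0 < a q}"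
    have finT: "finite T" using finite_J by (simp add: T_def)
    have ST: "S \<subseteq> T" using SJ qS by (auto simp: T_def)
    have Tq: "a q = 0" if "a \<in> J" "a \<notin> T" for a
      using that q_nonneg[of a] by (force simp: T_def)
    have TZ: "a \<notin> Z" if "a \<in> T" for a using that qZ[of a] by (auto simp: T_def)
    \<comment> \<open>Otherwise the cone would contain \<open>- q\<close>, whose level is negative.\<close>
    have "T \<noteq> {}"
    proof
      assume "T = {}"
      then have a0: "a q = 0" if "a \<in> J" for a using Tq that by blast
      let ?q = "\<lambda>i. - 1 * q i - 0"
      have "?q \<in> \<Lambda>" using lattice_diff[OF q\<Lambda> zero_mem] .
      moreover have neg: "a ?q = - a q" if "a \<in> insert lev J" for a
        using linear_diff[OF that, of "- 1" q "\<lambda>_. 0"] linear_zero[OF that] by simp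
      have "\<forall>a\<in>J. 0 \<le> a ?q" using neg a0 by (metis insertCI neg_0_equal_iff_equal order_refl)
      moreover have "lev ?q \<le> 0" using neg[OF insertI1] m unfolding m_def by linarith
      ultimately have "?q = (\<lambda>_. 0)"
        using pointed by blast
      then have "?q i = 0" for i by (rule fun_cong)
      then have "q i = 0" for i by simp
      with q(2) show False by blast
    qed
    \<comment> \<open>Among the facets that are reached simultaneously a removed one is preferred; this keeps the
      pieces inside the translated face.\<close>
    obtain rk0 :: "(('i \<Rightarrow> int) \<Rightarrow> int) \<Rightarrow> nat" and n where rk0: "rk0 ` J = {i. i < n}" "inj_on rk0 J"
      using finite_imp_inj_to_nat_seg[OF finite_J] by blast
    define rk where "rk a = (if a \<in> S then rk0 a else n + rk0 a)" for a
    have rk0_less: "rk0 a < n" if "a \<in> J" for a using rk0(1) that by blast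
    have inj_rk: "inj_on rk T"
      using rk0(2) rk0_less unfolding inj_on_def rk_def T_def
      by (smt (verit) add_diff_cancel_left' mem_Collect_eq not_add_less1)
    have rk_S: "rk a < rk b" if "a \<in> S" "b \<in> T" "b \<notin> S" for a b
      using that rk0_less[of a] SJ by (auto simp: rk_def)
    define num where "num a x = N * a x - a v" for a :: "('i \<Rightarrow> int) \<Rightarrow> int" and x
    define U where "U j = {a \<in> T. rk a < rk j}" for j
    \<comment> \<open>In terms of \<open>t = s / (N * j q)\<close>: \<open>0 < t \<le> 1\<close> for a removed facet, \<open>0 \<le> t < 1\<close> otherwise.\<close>
    define R where "R j = (if j \<in> S then {0<..N * j q} else {0..<N * j q})" for j :: "('i \<Rightarrow> int) \<Rightarrow> int"
    \<comment> \<open>The translation vector \<open>v / N + t q\<close> with denominator \<open>N * j q\<close>. In the new face those facets are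
      removed that precede \<open>j\<close>, since a tie with them would have been resolved in their favour.\<close>
    define piece where "piece j s =
      shifted_face (N * j q) (\<lambda>i. j q * v i + s * q i) (insert j Z) (U j)" for j s
    have memX: "x \<in> X \<longleftrightarrow> x \<in> \<Lambda> \<and> (\<forall>a\<in>J. 0 \<le> num a x) \<and> (\<forall>a\<in>Z. num a x = 0) \<and> (\<forall>a\<in>S. 0 < num a x)" for x
      unfolding X_def mem_shifted_face[OF v ZJ SJ] num_def by simp
    have v': "(\<lambda>i. j q * v i + s * q i) \<in> \<Lambda>" for j s using lattice[OF v q\<Lambda>] .
    have mem_piece: "x \<in> piece j s \<longleftrightarrow> x \<in> \<Lambda> \<and> (\<forall>a\<in>J. s * a q \<le> num a x * j q) \<and>
        num j x = s \<and> (\<forall>a\<in>Z. num a x = 0) \<and> (\<forall>a\<in>U j. s * a q < num a x * j q)"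
      if j: "j \<in> T" for j s x
    proof -
      have jJ: "insert j Z \<subseteq> J" "U j \<subseteq> J" and jq: "0 < j q"
        using j ZJ by (auto simp: T_def U_def)
      have a: "N * j q * a x - a (\<lambda>i. j q * v i + s * q i) = num a x * j q - s * a q" if "a \<in> J" for a
        using that by (simp add: linear num_def algebra_simps)
      have "(\<forall>a\<in>J. a (\<lambda>i. j q * v i + s * q i) \<le> N * j q * a x) \<longleftrightarrow> (\<forall>a\<in>J. s * a q \<le> num a x * j q)"
        using a by (intro ball_cong refl) force
      moreover have "(\<forall>b\<in>U j. b (\<lambda>i. j q * v i + s * q i) < N * j q * b x) \<longleftrightarrow> (\<forall>b\<in>U j. s * b q < num b x * j q)"
        using a jJ(2) by (intro ball_cong refl) force
      moreover have "(\<forall>b\<in>Z. N * j q * b x = b (\<lambda>i. j q * v i + s * q i)) \<longleftrightarrow> (\<forall>b\<in>Z. num b x = 0)"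
      proof (intro ball_cong refl)
        fix b assume b: "b \<in> Z"
        then have "N * j q * b x - b (\<lambda>i. j q * v i + s * q i) = num b x * j q"
          using a[of b] ZJ qZ[OF b] by auto
        then show "N * j q * b x = b (\<lambda>i. j q * v i + s * q i) \<longleftrightarrow> num b x = 0"
          using jq by auto
      qed
      moreover have "N * j q * j x = j (\<lambda>i. j q * v i + s * q i) \<longleftrightarrow> num j x = s"
      proof -
        have "N * j q * j x - j (\<lambda>i. j q * v i + s * q i) = (num j x - s) * j q"
          using a[of j] jJ(1) by (simp add: algebra_simps)
        then show ?thesis using jq by auto
      qed
      ultimately show ?thesis
        unfolding piece_def mem_shifted_face[OF v' jJ] by blast
    qed
    have piece_mem: "x \<in> X \<and> num j x \<in> R j \<and>
        (\<forall>a\<in>T. num j x * a q \<le> num a x * j q \<and> (rk a < rk j \<longrightarrow> num j x * a q < num a x * j q))"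
      if j: "j \<in> T" and s: "s \<in> R j" and x: "x \<in> piece j s" for j s x
    proof -
      have jq: "0 < j q" using j by (auto simp: T_def)
      have s0: "0 \<le> s" using s by (auto simp: R_def split: if_splits)
      note x = x[unfolded mem_piece[OF j]]
      have "0 \<le> num a x" if "a \<in> J" for a
      proof -
        have "0 \<le> s * a q" using s0 q_nonneg[OF that] by simp
        also have "\<dots> \<le> num a x * j q" using x that by blast
        finally show ?thesis using jq by (simp add: zero_le_mult_iff)
      qed
      moreover have "0 < num a x" if "a \<in> S" for a
      proof -
        have "0 < num a x * j q"
        proof (cases "j \<in> S")
          case True
          then have "0 < s * a q" using s qS[OF that] by (simp add: R_def)
          also have "\<dots> \<le> num a x * j q" using x that SJ by blast
          finally show ?thesis .
        next
          case False
          then have "a \<in> U j" using rk_S[OF that j False] that ST by (auto simp: U_def)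
          have "0 \<le> s * a q" using s0 qS[OF that] by simp
          also have "\<dots> < num a x * j q" using x \<open>a \<in> U j\<close> by blast
          finally show ?thesis .
        qed
        then show ?thesis using jq by (simp add: zero_less_mult_iff)
      qed
      ultimately have "x \<in> X" using x by (simp add: memX)
      then show ?thesis using x s by (auto simp: U_def T_def)
    qed
    have mem_pieceI: "x \<in> piece j (num j x)"
      if j: "j \<in> T" and x: "x \<in> X"
        and min: "\<forall>a\<in>T. num j x * a q \<le> num a x * j q \<and> (rk a < rk j \<longrightarrow> num j x * a q < num a x * j q)"
      for j x
    proof -
      have jq: "0 < j q" using j by (auto simp: T_def)
      have "num j x * a q \<le> num a x * j q" if "a \<in> J" for a
        using min Tq[OF that] x that jq by (cases "a \<in> T") (auto simp: memX)
      then show ?thesis using x min by (simp add: mem_piece[OF j] memX U_def)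
    qed
    have disjoint: "j = j'"
      if "j \<in> T" "j' \<in> T" "s \<in> R j" "s' \<in> R j'" "x \<in> piece j s" "x \<in> piece j' s'" for j j' s s' x
    proof (rule ccontr)
      assume "j \<noteq> j'"
      then have "rk j < rk j' \<or> rk j' < rk j" using inj_rk that(1,2) by (metis inj_onD linorder_neqE_nat)
      then show False
        using piece_mem[OF that(1,3,5)] piece_mem[OF that(2,4,6)] that(1,2) by force
    qed
    have num_q: "num a (\<lambda>i. x i + q i) = num a x + N * a q" if "a \<in> J" for a x
      using that by (simp add: num_def linear_add algebra_simps)
    have shiftX: "(\<lambda>i. x i + q i) \<in> X" if "x \<in> X" for x
      using that num_q N q_nonneg qZ qS ZJ SJ lattice_add[of x q] q\<Lambda>
      unfolding memX by (auto simp: subset_iff intro!: add_pos_nonneg less_imp_le)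
    \<comment> \<open>A point lies in a piece if and only if the full step \<open>- q\<close> is impossible from it.\<close>
    have split: "(\<exists>y\<in>X. x = (\<lambda>i. y i + q i)) \<longleftrightarrow> \<not> (\<exists>j\<in>T. \<exists>s\<in>R j. x \<in> piece j s)"
      if x: "x \<in> X" for x
    proof
      assume "\<exists>y\<in>X. x = (\<lambda>i. y i + q i)"
      then obtain y where y: "y \<in> X" "x = (\<lambda>i. y i + q i)" by blast
      show "\<not> (\<exists>j\<in>T. \<exists>s\<in>R j. x \<in> piece j s)"
      proof
        assume "\<exists>j\<in>T. \<exists>s\<in>R j. x \<in> piece j s"
        then obtain j s where j: "j \<in> T" "s \<in> R j" "x \<in> piece j s" by blast
        have "j \<in> J" using j(1) by (simp add: T_def)
        then have "num j x = num j y + N * j q" using num_q y(2) by simp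
        moreover have "num j x \<in> R j" using piece_mem[OF j] by blast
        moreover have "0 \<le> num j y" "j \<in> S \<Longrightarrow> 0 < num j y" using y(1) \<open>j \<in> J\<close> by (auto simp: memX)
        ultimately show False by (auto simp: R_def split: if_splits)
      qed
    next
      assume no_piece: "\<not> (\<exists>j\<in>T. \<exists>s\<in>R j. x \<in> piece j s)"
      obtain j where j: "j \<in> T"
        and min: "\<forall>a\<in>T. num j x * a q \<le> num a x * j q \<and> (rk a < rk j \<longrightarrow> num j x * a q < num a x * j q)"
        using lex_argmin[OF finT \<open>T \<noteq> {}\<close> inj_rk, of "\<lambda>a. a q" "\<lambda>a. num a x"] by (auto simp: T_def)
      have jJ: "j \<in> J" and jq: "0 < j q" using j by (auto simp: T_def)
      have "num j x \<notin> R j" using mem_pieceI[OF j x min] no_piece j by blast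
      moreover have "0 \<le> num j x" "j \<in> S \<Longrightarrow> 0 < num j x" using x jJ by (auto simp: memX)
      ultimately have big: "N * j q \<le> num j x" "j \<in> S \<Longrightarrow> N * j q < num j x"
        by (auto simp: R_def split: if_splits)
      let ?y = "\<lambda>i. 1 * x i - q i"
      have y: "x = (\<lambda>i. ?y i + q i)" by simp
      have num_y: "num a ?y = num a x - N * a q" if "a \<in> J" for a
        using num_q[OF that, of ?y] by simp
      have le: "N * a q \<le> num a x" if "a \<in> J" for a
      proof (cases "a \<in> T")
        case True
        then have "0 \<le> a q" by (simp add: T_def)
        then have "N * j q * a q \<le> num j x * a q" using big(1) by (intro mult_right_mono)
        also have "\<dots> \<le> num a x * j q" using min True by blast
        finally have "(N * a q) * j q \<le> num a x * j q" by (simp add: mult_ac)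
        then show ?thesis using jq by simp
      next
        case False
        then show ?thesis using Tq[OF that False] x that by (simp add: memX)
      qed
      have less: "N * a q < num a x" if "a \<in> S" for a
      proof -
        have aT: "a \<in> T" and aq: "0 < a q" using that ST qS by auto
        have "N * j q * a q < num a x * j q"
        proof (cases "j \<in> S")
          case True
          then have "N * j q * a q < num j x * a q" using big(2) aq by simp
          also have "\<dots> \<le> num a x * j q" using min aT by blast
          finally show ?thesis .
        next
          case False
          have "N * j q * a q \<le> num j x * a q" using big(1) aq by simp
          also have "\<dots> < num a x * j q" using min aT rk_S[OF that j False] by blast
          finally show ?thesis .
        qed
        then have "(N * a q) * j q < num a x * j q" by (simp add: mult_ac)
        then show ?thesis using jq by simp
      qed
      have "num a ?y = 0" if "a \<in> Z" for a
      proof -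
        have "a \<in> J" using that ZJ by blast
        then show ?thesis using num_y[of a] qZ[OF that] x that by (simp add: memX)
      qed
      moreover have "0 \<le> num a ?y" if "a \<in> J" for a using num_y[OF that] le[OF that] by simp
      moreover have "0 < num a ?y" if "a \<in> S" for a
      proof -
        have "a \<in> J" using that SJ by blast
        then show ?thesis using num_y[of a] less[OF that] by simp
      qed
      moreover have "?y \<in> \<Lambda>" using x lattice_diff[OF _ q\<Lambda>, of x 1] unfolding memX by blast
      ultimately have "?y \<in> X" unfolding memX by blast
      then show "\<exists>y\<in>X. x = (\<lambda>i. y i + q i)" using y by (intro bexI[of _ ?y])
    qed
    have rec: "num_points X k - num_points X (k - m) =
        (\<Sum>p\<in>Sigma T R. num_points (case p of (j, s) \<Rightarrow> piece j s) k)" for k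
    proof -
      let ?P = "\<lambda>p. case p of (j, s) \<Rightarrow> piece j s"
      define A where "A = (\<lambda>x i. x i + q i) ` {x \<in> X. lev x = k - m}"
      define B where "B p = {x \<in> ?P p. lev x = k}" for p
      have finSig: "finite (Sigma T R)" using finT by (auto simp: R_def)
      have finB: "finite (B p)" if "p \<in> Sigma T R" for p
        using that N unfolding B_def piece_def
        by (auto intro!: finite_shifted_face v' simp: T_def)
      have PX: "x \<in> X" if "p \<in> Sigma T R" "x \<in> ?P p" for p x
        using that piece_mem by (cases p) auto
      have lev_q: "lev (\<lambda>i. x i + q i) = lev x + m" for x by (simp add: linear_add m_def)
      have A: "A = {x \<in> X. lev x = k \<and> (\<exists>y\<in>X. x = (\<lambda>i. y i + q i))}"
        using shiftX lev_q by (auto simp: A_def image_iff)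
      have "{x \<in> X. lev x = k} = A \<union> (\<Union>p\<in>Sigma T R. B p)"
        using split PX unfolding A B_def by fastforce
      moreover have "A \<inter> (\<Union>p\<in>Sigma T R. B p) = {}"
        using split unfolding A B_def by fastforce
      moreover have "finite A"
        unfolding A_def X_def by (intro finite_imageI finite_shifted_face v N)
      ultimately have "card {x \<in> X. lev x = k} = card A + card (\<Union>p\<in>Sigma T R. B p)"
        using card_Un_disjoint finSig finB by (metis finite_UN_I)
      moreover have "card A = card {x \<in> X. lev x = k - m}"
        unfolding A_def by (intro card_image inj_onI ext) (metis add_right_cancel)
      moreover have "card (\<Union>p\<in>Sigma T R. B p) = (\<Sum>p\<in>Sigma T R. card (B p))"
      proof (intro card_UN_disjoint finSig ballI finB impI)
        fix p p' assume p: "p \<in> Sigma T R" "p' \<in> Sigma T R" "p \<noteq> p'"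
        obtain j s j' s' where js: "p = (j, s)" "p' = (j', s')" by (cases p, cases p')
        have "x \<notin> piece j' s'" if x: "x \<in> piece j s" for x
        proof
          assume x': "x \<in> piece j' s'"
          have "j = j'" using disjoint[OF _ _ _ _ x x'] p js by simp
          moreover have "num j x = s" "num j' x = s'"
            using x x' p js mem_piece[of j x s] mem_piece[of j' x s'] by auto
          ultimately show False using p(3) js by simp
        qed
        then show "B p \<inter> B p' = {}" by (auto simp: B_def js)
      qed
      ultimately show ?thesis by (simp add: num_points_def B_def)
    qed
    let ?P = "\<lambda>p. case p of (j, s) \<Rightarrow> piece j s"
    let ?pos = "\<lambda>p K. case p of (j, s) \<Rightarrow> j q * lev v + s * m < N * j q * K"
    have "\<exists>ms. (\<forall>m\<in>set ms. 0 < m) \<and> (\<forall>p\<in>Sigma T R. vanishes (?pos p) ms (num_points (?P p)))"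
    proof (rule vanishes_common)
      show "finite (Sigma T R)" using finT by (auto simp: R_def)
      fix p assume p: "p \<in> Sigma T R"
      then obtain j s where js: "p = (j, s)" "j \<in> T" "s \<in> R j" by blast
      have jJ: "j \<in> J" and jq: "0 < j q" using js by (auto simp: T_def)
      have "card (J - insert j Z) < card (J - Z)"
        using finite_J jJ TZ[OF js(2)] by (intro psubset_card_mono) auto
      moreover have "insert j Z \<subseteq> J" "U j \<subseteq> J" using jJ ZJ by (auto simp: U_def T_def)
      moreover have "0 < N * j q" using N jq by simp
      moreover have "lev (\<lambda>i. j q * v i + s * q i) = j q * lev v + s * m"
        by (simp add: linear m_def)
      ultimately show "\<exists>ms. (\<forall>m\<in>set ms. 0 < m) \<and> vanishes (?pos p) ms (num_points (?P p))"
        using less.hyps[of "insert j Z" "U j" "\<lambda>i. j q * v i + s * q i" "N * j q"] v'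
        by (auto simp: js piece_def)
      fix K K' assume "?pos p K" "K \<le> K'"
      moreover have "N * j q * K \<le> N * j q * K'" 
        by (rule mult_left_mono[OF \<open>K \<le> K'\<close> less_imp_le[OF \<open>0 < N * j q\<close>]])
      ultimately show "?pos p K'" by (simp add: js)
    qed
    then obtain ms where ms: "\<forall>m\<in>set ms. 0 < m"
      "\<And>p. p \<in> Sigma T R \<Longrightarrow> vanishes (?pos p) ms (num_points (?P p))"
      by blast
    have zero: "bdiffs (m # ms) (num_points X) k = 0"
      if "\<And>j s. j \<in> T \<Longrightarrow> s \<in> R j \<Longrightarrow> j q * lev v + s * m < N * j q * (k - sum_list ms)" for k
    proof -
      have "bdiffs (m # ms) (num_points X) k = (\<Sum>p\<in>Sigma T R. bdiffs ms (num_points (?P p)) k)"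
        by (simp add: rec bdiffs_sum)
      also have "\<dots> = 0"
        using ms(2) that by (intro sum.neutral) (auto simp: vanishes_def)
      finally show ?thesis .
    qed
    \<comment> \<open>The gain \<open>m\<close> from the factor \<open>1 - S\<^sup>m\<close> outweighs the growth \<open>t * m\<close> of the translation vector.\<close>
    have bound: "j q * lev v + s * m < N * j q * (K + m)"
      if "j \<in> T" "s \<in> R j" "lev v < N * K \<or> lev v \<le> N * K \<and> S = {}" for j s K
    proof -
      have jq: "0 < j q" using that(1) by (simp add: T_def)
      have "s * m \<le> N * j q * m" "S = {} \<Longrightarrow> s * m < N * j q * m"
        using that(2) m by (auto simp: R_def split: if_splits)
      moreover have "j q * lev v \<le> j q * (N * K)" "lev v < N * K \<Longrightarrow> j q * lev v < j q * (N * K)"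
        using that(3) jq by auto
      moreover have "N * j q * (K + m) = j q * (N * K) + N * j q * m" by (simp add: algebra_simps)
      ultimately show ?thesis using that(3) by linarith
    qed
    have "vanishes (\<lambda>K. lev v < N * K) (m # ms) (num_points X)"
      "S = {} \<Longrightarrow> vanishes (\<lambda>K. lev v \<le> N * K) (m # ms) (num_points X)"
      unfolding vanishes_def
      by (intro allI impI zero, drule bound, assumption, force, simp add: algebra_simps)+
    moreover have "\<forall>m\<in>set (m # ms). 0 < m" using m ms(1) by simp
    ultimately show ?thesis unfolding X_def[symmetric] by blast
  qed
qed

text \<open>Ehrhart's theorem in recurrence form: the untranslated closed cone has level bound 0, which the gain
  for closed faces improves to a negative degree.\<close>

corollary bdiffs_num_points_cone:
  assumes "x \<in> \<Lambda>" "\<forall>a\<in>J. 0 \<le> a x" "x \<noteq> (\<lambda>_. 0)"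
  shows "\<exists>ms. (\<forall>m\<in>set ms. 0 < m) \<and>
    (\<forall>k \<ge> sum_list ms. bdiffs ms (num_points {x \<in> \<Lambda>. \<forall>a\<in>J. 0 \<le> a x}) k = 0)"
proof -
  have "shifted_face 1 (\<lambda>_. 0) {} {} = {x \<in> \<Lambda>. \<forall>a\<in>J. 0 \<le> a x}"
    by (auto simp: shifted_face_def face_def)
  moreover have "x \<in> face {} {}" using assms by (simp add: face_def)
  ultimately show ?thesis
    using vanishes_num_points[of "{}" "{}" "\<lambda>_. 0" 1] zero_mem linear_zero[of lev] assms(3)
    by (auto simp: vanishes_def)
qed

end

section \<open>Non-negative integer matrices with prescribed margins\<close>

text \<open>Rows and columns are the vertices of a bipartite graph with the edges \<open>E\<close>; the entries are a flow
  along these edges with supplies \<open>r\<close> and demands \<open>c\<close>.\<close>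

definition flows :: "('r \<times> 'c) set \<Rightarrow> ('r \<Rightarrow> int) \<Rightarrow> ('c \<Rightarrow> int) \<Rightarrow> ('r \<times> 'c \<Rightarrow> int) set" where
  "flows E r c = {x. (\<forall>e\<in>E. 0 \<le> x e) \<and> (\<forall>e. e \<notin> E \<longrightarrow> x e = 0) \<and>
    (\<forall>i. (\<Sum>e\<in>{e\<in>E. fst e = i}. x e) = r i) \<and> (\<forall>j. (\<Sum>e\<in>{e\<in>E. snd e = j}. x e) = c j)}"

lemma flowsI:
  assumes "\<And>e. e \<in> E \<Longrightarrow> 0 \<le> x e" "\<And>e. e \<notin> E \<Longrightarrow> x e = 0"
    and "\<And>i. (\<Sum>e\<in>{e\<in>E. fst e = i}. x e) = r i" "\<And>j. (\<Sum>e\<in>{e\<in>E. snd e = j}. x e) = c j"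
  shows "x \<in> flows E r c"
  using assms by (simp add: flows_def)

lemma flowsD:
  assumes "x \<in> flows E r c"
  shows "e \<in> E \<Longrightarrow> 0 \<le> x e" "e \<notin> E \<Longrightarrow> x e = 0"
    and "(\<Sum>e\<in>{e\<in>E. fst e = i}. x e) = r i" "(\<Sum>e\<in>{e\<in>E. snd e = j}. x e) = c j"
  using assms unfolding flows_def by blast+

lemma finite_flows:
  assumes "finite E"
  shows "finite (flows E r c)"
proof -
  let ?M = "Max (insert 0 (r ` fst ` E))"
  have "x e \<in> {0..?M}" if x: "x \<in> flows E r c" and e: "e \<in> E" for x e
  proof -
    have "x e \<le> (\<Sum>e'\<in>{e'\<in>E. fst e' = fst e}. x e')"
      using x e assms by (intro member_le_sum) (auto simp: flows_def)
    also have "\<dots> = r (fst e)" using x by (simp add: flows_def)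
    also have "\<dots> \<le> ?M" using e assms by (intro Max_ge) auto
    finally show ?thesis using x e by (simp add: flows_def)
  qed
  then have "flows E r c \<subseteq> {x. \<forall>e. (e \<in> E \<longrightarrow> x e \<in> {0..?M}) \<and> (e \<notin> E \<longrightarrow> x e = 0)}"
    by (auto simp: flows_def)
  moreover have "finite {x. \<forall>e. (e \<in> E \<longrightarrow> x e \<in> {0..?M}) \<and> (e \<notin> E \<longrightarrow> x e = 0)}"
    using assms by (intro finite_set_of_finite_funs) auto
  ultimately show ?thesis by (rule finite_subset)
qed

lemma sum_upd_add:
  fixes x :: "'a \<Rightarrow> int"
  assumes "finite E" "e \<in> E"
  shows "(\<Sum>e'\<in>{e'\<in>E. P e'}. (x(e := x e + s)) e') = (\<Sum>e'\<in>{e'\<in>E. P e'}. x e') + of_bool (P e) * s"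
proof (cases "P e")
  case True
  let ?y = "x(e := x e + s)"
  have "finite {e'\<in>E. P e'}" "e \<in> {e'\<in>E. P e'}" using assms True by auto
  then have "(\<Sum>e'\<in>{e'\<in>E. P e'}. x e') = x e + (\<Sum>e'\<in>{e'\<in>E. P e'} - {e}. x e')"
    "(\<Sum>e'\<in>{e'\<in>E. P e'}. ?y e') = ?y e + (\<Sum>e'\<in>{e'\<in>E. P e'} - {e}. ?y e')"
    by (simp_all only: sum.remove)
  moreover have "(\<Sum>e'\<in>{e'\<in>E. P e'} - {e}. ?y e') = (\<Sum>e'\<in>{e'\<in>E. P e'} - {e}. x e')"
    by (intro sum.cong) auto
  ultimately show ?thesis using True by simp
next
  case False
  then show ?thesis by (auto intro!: sum.cong)
qed

lemma flows_add_edge: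
  assumes "finite E" "e \<in> E" and x: "x \<in> flows E r c" and "0 \<le> x e + s"
  shows "x(e := x e + s) \<in> flows E (\<lambda>i. r i + of_bool (i = fst e) * s) (\<lambda>j. c j + of_bool (j = snd e) * s)"
proof (rule flowsI)
  fix e' assume "e' \<in> E"
  then show "0 \<le> (x(e := x e + s)) e'" using flowsD(1)[OF x, of e'] assms(4) by auto
next
  fix e' assume "e' \<notin> E"
  then show "(x(e := x e + s)) e' = 0" using flowsD(2)[OF x, of e'] assms(2) by auto
next
  fix i show "(\<Sum>e'\<in>{e'\<in>E. fst e' = i}. (x(e := x e + s)) e') = r i + of_bool (i = fst e) * s"
    using flowsD(3)[OF x, of i] sum_upd_add[OF assms(1,2), of x s "\<lambda>e. fst e = i"] by (simp only: eq_commute)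
next
  fix j show "(\<Sum>e'\<in>{e'\<in>E. snd e' = j}. (x(e := x e + s)) e') = c j + of_bool (j = snd e) * s"
    using flowsD(4)[OF x, of j] sum_upd_add[OF assms(1,2), of x s "\<lambda>e. snd e = j"] by (simp only: eq_commute)
qed

text \<open>Either the entry at \<open>e\<close> is zero, and then \<open>e\<close> can be deleted from the support, or one unit can be
  subtracted from it.\<close>

lemma card_flows_delete_edge:
  assumes "finite E" "e \<in> E"
  shows "card (flows E r c) = card (flows (E - {e}) r c) +
    card (flows E (\<lambda>i. r i - of_bool (i = fst e)) (\<lambda>j. c j - of_bool (j = snd e)))"
proof -
  let ?F = "flows E (\<lambda>i. r i - of_bool (i = fst e)) (\<lambda>j. c j - of_bool (j = snd e))"
  let ?up = "\<lambda>x :: 'a \<times> 'b \<Rightarrow> int. x(e := x e + 1)"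
  have sum_del: "(\<Sum>e'\<in>{e'\<in>E - {e}. P e'}. x e') = (\<Sum>e'\<in>{e'\<in>E. P e'}. x e')"
    if "x e = 0" for P and x :: "'a \<times> 'b \<Rightarrow> int"
  proof (rule sum.mono_neutral_left)
    show "finite {e'\<in>E. P e'}" using assms(1) by simp
    show "\<forall>e'\<in>{e'\<in>E. P e'} - {e'\<in>E - {e}. P e'}. x e' = 0" using that by auto
  qed auto
  have del: "{x \<in> flows E r c. x e = 0} = flows (E - {e}) r c"
  proof (intro set_eqI iffI)
    fix x assume "x \<in> {x \<in> flows E r c. x e = 0}"
    then have x: "x \<in> flows E r c" "x e = 0" by auto
    show "x \<in> flows (E - {e}) r c"
    proof (rule flowsI)
      fix e' assume "e' \<notin> E - {e}"
      then show "x e' = 0" using flowsD(2)[OF x(1), of e'] x(2) by auto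
    qed (use flowsD(1,3,4)[OF x(1)] sum_del[of x, OF x(2)] in simp_all)
  next
    fix x assume x: "x \<in> flows (E - {e}) r c"
    then have x0: "x e = 0" using flowsD(2)[of x "E - {e}" r c e] by simp
    have nonneg: "0 \<le> x e'" if "e' \<in> E" for e'
      using flowsD(1)[OF x, of e'] x0 that by (cases "e' = e") auto
    have "x \<in> flows E r c"
    proof (rule flowsI)
      fix e' assume "e' \<notin> E"
      then show "x e' = 0" using flowsD(2)[OF x, of e'] by simp
    qed (use flowsD(3,4)[OF x] nonneg in \<open>simp_all only: sum_del[of x, OF x0]\<close>)
    then show "x \<in> {x \<in> flows E r c. x e = 0}" using x0 by simp
  qed
  have "bij_betw ?up ?F {x \<in> flows E r c. x e \<noteq> 0}"
  proof (rule bij_betw_byWitness[where f' = "\<lambda>x. x(e := x e + - 1)"])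
    show "?up ` ?F \<subseteq> {x \<in> flows E r c. x e \<noteq> 0}"
    proof
      fix y assume "y \<in> ?up ` ?F"
      then obtain x where x: "x \<in> ?F" "y = ?up x" by blast
      have "0 \<le> x e" using flowsD(1)[OF x(1) assms(2)] .
      then show "y \<in> {x \<in> flows E r c. x e \<noteq> 0}"
        using flows_add_edge[OF assms x(1), of 1] x(2) by simp
    qed
    show "(\<lambda>x. x(e := x e + - 1)) ` {x \<in> flows E r c. x e \<noteq> 0} \<subseteq> ?F"
    proof
      fix y assume "y \<in> (\<lambda>x. x(e := x e + - 1)) ` {x \<in> flows E r c. x e \<noteq> 0}"
      then obtain x where x: "x \<in> flows E r c" "x e \<noteq> 0" "y = x(e := x e + - 1)" by blast
      have "0 \<le> x e + - 1" using flowsD(1)[OF x(1) assms(2)] x(2) by simp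
      then show "y \<in> ?F"
        using flows_add_edge[OF assms x(1), of "- 1"] x(3) by simp
    qed
  qed auto
  then have "card {x \<in> flows E r c. x e \<noteq> 0} = card ?F" by (simp add: bij_betw_same_card)
  moreover have "card (flows E r c) = card {x \<in> flows E r c. x e = 0} + card {x \<in> flows E r c. x e \<noteq> 0}"
  proof -
    have "card ({x \<in> flows E r c. x e = 0} \<union> {x \<in> flows E r c. x e \<noteq> 0}) =
        card {x \<in> flows E r c. x e = 0} + card {x \<in> flows E r c. x e \<noteq> 0}"
      by (rule card_Un_disjoint) (use finite_flows[OF assms(1)] in auto)
    moreover have "{x \<in> flows E r c. x e = 0} \<union> {x \<in> flows E r c. x e \<noteq> 0} = flows E r c" by blast
    ultimately show ?thesis by (simp only:)
  qed
  ultimately show ?thesis by (simp only: del)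
qed

text \<open>Gaussian elimination: one equation is solved for one of its unknowns.\<close>

lemma homogeneous_system_solution:
  fixes M :: "'a \<Rightarrow> 'e \<Rightarrow> rat"
  assumes "finite A" "finite F" "card A < card F"
  shows "\<exists>d. (\<exists>e\<in>F. d e \<noteq> 0) \<and> (\<forall>a\<in>A. (\<Sum>e\<in>F. M a e * d e) = 0)"
  using assms
proof (induction A arbitrary: F M)
  case empty
  then obtain e where "e \<in> F" by fastforce
  then show ?case by (intro exI[of _ "\<lambda>_. 1"]) auto
next
  case (insert a A)
  show ?case
  proof (cases "\<exists>e\<in>F. M a e \<noteq> 0")
    case False
    have "card A < card F" using insert.prems insert.hyps by simp
    then obtain d where "\<exists>e\<in>F. d e \<noteq> 0" "\<forall>a\<in>A. (\<Sum>e\<in>F. M a e * d e) = 0"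
      using insert.IH[OF insert.prems(1)] by blast
    then show ?thesis using False by (intro exI[of _ d]) auto
  next
    case True
    then obtain e0 where e0: "e0 \<in> F" "M a e0 \<noteq> 0" by blast
    define M' where "M' b e = M b e - M b e0 * M a e / M a e0" for b e
    have "card A < card (F - {e0})" "finite (F - {e0})" using insert e0 by auto
    then obtain d where d: "\<exists>e\<in>F - {e0}. d e \<noteq> 0" "\<forall>b\<in>A. (\<Sum>e\<in>F - {e0}. M' b e * d e) = 0"
      using insert.IH[of "F - {e0}" M'] by blast
    define s where "s = (\<Sum>e\<in>F - {e0}. M a e * d e)"
    define d' where "d' = d(e0 := - s / M a e0)"
    have sum: "(\<Sum>e\<in>F. M b e * d' e) = (\<Sum>e\<in>F - {e0}. M b e * d e) - M b e0 * s / M a e0" for b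
    proof -
      have "(\<Sum>e\<in>F. M b e * d' e) = M b e0 * d' e0 + (\<Sum>e\<in>F - {e0}. M b e * d' e)"
        using insert.prems e0 by (simp only: sum.remove)
      also have "(\<Sum>e\<in>F - {e0}. M b e * d' e) = (\<Sum>e\<in>F - {e0}. M b e * d e)"
        by (intro sum.cong) (auto simp: d'_def)
      finally show ?thesis by (simp add: d'_def)
    qed
    have "(\<Sum>e\<in>F. M b e * d' e) = 0" if "b \<in> A" for b
    proof -
      have "(\<Sum>e\<in>F - {e0}. M' b e * d e) = (\<Sum>e\<in>F - {e0}. M b e * d e) - M b e0 * s / M a e0"
        unfolding M'_def s_def by (simp add: left_diff_distrib right_diff_distrib sum_subtractf sum_distrib_left sum_divide_distrib mult_ac)
      then show ?thesis using d(2) that sum by simp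
    qed
    moreover have "(\<Sum>e\<in>F. M a e * d' e) = 0" unfolding sum using e0 by (simp add: s_def)
    moreover have "\<exists>e\<in>F. d' e \<noteq> 0" using d(1) by (auto simp: d'_def)
    ultimately show ?thesis by (intro exI[of _ d']) auto
  qed
qed

text \<open>If every occupied row and column has at least two positions, then there are at least as many
  positions as there are occupied rows and columns together. The equations for the rows and for all
  columns but one imply the remaining one, as both kinds add up to the sum of all entries. So there
  are fewer equations than unknowns.\<close>

lemma zero_margin_matrix:
  fixes F :: "('r \<times> 'c) set"
  assumes "finite F" "F \<noteq> {}"
    and row: "\<And>i. card {e\<in>F. fst e = i} \<noteq> 1" and col: "\<And>j. card {e\<in>F. snd e = j} \<noteq> 1"
  shows "\<exists>d :: 'r \<times> 'c \<Rightarrow> rat. (\<exists>e\<in>F. d e \<noteq> 0) \<and> (\<forall>i. (\<Sum>e\<in>{e\<in>F. fst e = i}. d e) = 0) \<and>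
    (\<forall>j. (\<Sum>e\<in>{e\<in>F. snd e = j}. d e) = 0)"
proof -
  have half: "2 * card (g ` F) \<le> card F" if g: "\<And>i. card {e\<in>F. g e = i} \<noteq> 1" for g :: "'r \<times> 'c \<Rightarrow> 'z"
  proof -
    have "card F = (\<Sum>i\<in>g ` F. card {e\<in>F. g e = i})"
      using assms(1) by (subst card_UN_disjoint[symmetric]) (auto intro!: arg_cong[of _ _ card])
    moreover have "(\<Sum>i\<in>g ` F. 2) \<le> (\<Sum>i\<in>g ` F. card {e\<in>F. g e = i})"
    proof (rule sum_mono)
      fix i assume "i \<in> g ` F"
      then have "{e\<in>F. g e = i} \<noteq> {}" by auto
      then have "card {e\<in>F. g e = i} \<noteq> 0" using assms(1) by simp
      then show "2 \<le> card {e\<in>F. g e = i}" using g[of i] by linarith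
    qed
    ultimately show ?thesis by simp
  qed
  obtain j0 where j0: "j0 \<in> snd ` F" using assms(2) by auto
  define A :: "('r + 'c) set" where "A = Inl ` fst ` F \<union> Inr ` (snd ` F - {j0})"
  define M where "M a e = (case a of Inl i \<Rightarrow> of_bool (fst e = i) | Inr j \<Rightarrow> (of_bool (snd e = j) :: rat))"
    for a :: "'r + 'c" and e
  have "card A \<le> card (fst ` F) + card (snd ` F - {j0})"
    unfolding A_def by (rule order.trans[OF card_Un_le]) (simp add: card_image)
  moreover have "card (snd ` F - {j0}) < card (snd ` F)"
    using assms(1) j0 by (intro psubset_card_mono) auto
  ultimately have "card A < card F" using half[OF row] half[OF col] by linarith
  moreover have "finite A" using assms(1) by (simp add: A_def)
  ultimately obtain d where d: "\<exists>e\<in>F. d e \<noteq> 0" "\<forall>a\<in>A. (\<Sum>e\<in>F. M a e * d e) = 0"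
    using homogeneous_system_solution[of A F M] assms(1) by blast
  have filter: "(\<Sum>e\<in>{e\<in>F. P e}. d e) = (\<Sum>e\<in>F. of_bool (P e) * d e)" for P
    using assms(1) by (auto simp: sum.inter_filter of_bool_def intro!: sum.cong)
  have rows: "(\<Sum>e\<in>{e\<in>F. fst e = i}. d e) = 0" for i
  proof (cases "i \<in> fst ` F")
    case True
    then have "Inl i \<in> A" by (simp add: A_def)
    then show ?thesis using d(2) by (auto simp: M_def filter)
  next
    case False
    then have "{e\<in>F. fst e = i} = {}" by force
    then show ?thesis by (simp only: sum.empty)
  qed
  have cols: "(\<Sum>e\<in>{e\<in>F. snd e = j}. d e) = 0" if "j \<noteq> j0" for j
  proof (cases "j \<in> snd ` F")
    case True
    then have "Inr j \<in> A" using that by (simp add: A_def)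
    then show ?thesis using d(2) by (auto simp: M_def filter)
  next
    case False
    then have "{e\<in>F. snd e = j} = {}" by force
    then show ?thesis by (simp only: sum.empty)
  qed
  have "(\<Sum>e\<in>F. d e) = (\<Sum>i\<in>fst ` F. \<Sum>e\<in>{e\<in>F. fst e = i}. d e)"
    using assms(1) by (intro sum.group[symmetric]) auto
  then have "(\<Sum>e\<in>F. d e) = 0" by (simp add: rows)
  moreover have "(\<Sum>e\<in>F. d e) = (\<Sum>j\<in>snd ` F. \<Sum>e\<in>{e\<in>F. snd e = j}. d e)"
    using assms(1) by (intro sum.group[symmetric]) auto
  moreover have "\<dots> = (\<Sum>e\<in>{e\<in>F. snd e = j0}. d e)"
    using assms(1) j0 cols by (subst sum.remove[of _ j0]) auto
  ultimately have "(\<Sum>e\<in>{e\<in>F. snd e = j}. d e) = 0" for j using cols by (cases "j = j0") auto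
  with d(1) rows show ?thesis by blast
qed

text \<open>Integrality of transportation polytopes. Division by \<open>N\<close> gives a rational matrix with the right
  margins. As the margins are integers, no row or column contains exactly one fractional entry.
  Hence the matrix can be moved along a matrix with zero margins that is supported on the fractional
  entries, until one of these becomes an integer. No entry crosses an integer on the way, so all
  entries stay non-negative.\<close>

lemma flows_of_multiple:
  assumes "finite E" "0 < N" and nonempty: "flows E (\<lambda>i. N * r i) (\<lambda>j. N * c j) \<noteq> {}"
  shows "flows E r c \<noteq> {}"
proof -
  define Q where "Q = {x :: 'a \<times> 'b \<Rightarrow> rat. (\<forall>e\<in>E. 0 \<le> x e) \<and> (\<forall>e. e \<notin> E \<longrightarrow> x e = 0) \<and>
    (\<forall>i. (\<Sum>e\<in>{e\<in>E. fst e = i}. x e) = of_int (r i)) \<and> (\<forall>j. (\<Sum>e\<in>{e\<in>E. snd e = j}. x e) = of_int (c j))}"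
  define fr where "fr x = {e \<in> E. x e \<notin> \<int>}" for x :: "'a \<times> 'b \<Rightarrow> rat"
  have fin_fr: "finite (fr x)" for x using assms(1) by (simp add: fr_def)
  have round: "\<exists>y\<in>Q. fr y = {}" if "x \<in> Q" for x
    using that
  proof (induction "card (fr x)" arbitrary: x rule: less_induct)
    case less
    have x: "\<And>e. e \<in> E \<Longrightarrow> 0 \<le> x e" "\<And>e. e \<notin> E \<Longrightarrow> x e = 0"
      "\<And>i. (\<Sum>e\<in>{e\<in>E. fst e = i}. x e) = of_int (r i)"
      "\<And>j. (\<Sum>e\<in>{e\<in>E. snd e = j}. x e) = of_int (c j)"
      using less.prems unfolding Q_def by blast+
    show ?case
    proof (cases "fr x = {}")
      case True
      then show ?thesis using less.prems by blast
    next
      case False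
      have deg: "card {e\<in>fr x. P e} \<noteq> 1" if "(\<Sum>e\<in>{e\<in>E. P e}. x e) \<in> \<int>" for P
      proof
        assume "card {e\<in>fr x. P e} = 1"
        then obtain e0 where e0: "{e\<in>fr x. P e} = {e0}" by (auto simp: card_1_singleton_iff)
        have mem: "e0 \<in> {e\<in>E. P e}" "x e0 \<notin> \<int>" using e0 by (auto simp: fr_def)
        have "(\<Sum>e\<in>{e\<in>E. P e}. x e) = x e0 + (\<Sum>e\<in>{e\<in>E. P e} - {e0}. x e)"
          using assms(1) mem(1) by (intro sum.remove) auto
        moreover have "(\<Sum>e\<in>{e\<in>E. P e} - {e0}. x e) \<in> \<int>"
        proof (rule Ints_sum)
          fix e assume e: "e \<in> {e\<in>E. P e} - {e0}"
          then have "e \<notin> {e\<in>fr x. P e}" using e0 by blast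
          then show "x e \<in> \<int>" using e by (auto simp: fr_def)
        qed
        ultimately have "x e0 = (\<Sum>e\<in>{e\<in>E. P e}. x e) - (\<Sum>e\<in>{e\<in>E. P e} - {e0}. x e)" by simp
        then have "x e0 \<in> \<int>" using that \<open>(\<Sum>e\<in>{e\<in>E. P e} - {e0}. x e) \<in> \<int>\<close> by (simp only: Ints_diff)
        then show False using mem(2) by blast
      qed
      have row: "card {e\<in>fr x. fst e = i} \<noteq> 1" and col: "card {e\<in>fr x. snd e = j} \<noteq> 1" for i j
        by (rule deg, simp only: x(3,4) Ints_of_int)+
      obtain d :: "'a \<times> 'b \<Rightarrow> rat" where d: "\<exists>e\<in>fr x. d e \<noteq> 0"
        "\<And>i. (\<Sum>e\<in>{e\<in>fr x. fst e = i}. d e) = 0" "\<And>j. (\<Sum>e\<in>{e\<in>fr x. snd e = j}. d e) = 0"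
        using zero_margin_matrix[OF fin_fr False row col] by blast
      define d0 where "d0 e = (if e \<in> fr x then d e else 0)" for e
      have d0_sum: "(\<Sum>e\<in>{e\<in>E. P e}. d0 e) = (\<Sum>e\<in>{e\<in>fr x. P e}. d e)" for P
        using assms(1) by (intro sum.mono_neutral_cong_right) (auto simp: d0_def fr_def)
      define D where "D = {e \<in> fr x. d e \<noteq> 0}"
      have D: "finite D" "D \<noteq> {}" using fin_fr[of x] d(1) by (auto simp: D_def)
      \<comment> \<open>The time at which the entry at \<open>e\<close> reaches the next integer in the direction of \<open>d\<close>.\<close>
      define gap where "gap e = (if 0 < d e then (of_int \<lceil>x e\<rceil> - x e) / d e
        else (x e - of_int \<lfloor>x e\<rfloor>) / (- d e))" for e
      have gap_nonneg: "0 \<le> gap e" if "e \<in> D" for e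
        using that by (auto simp: gap_def D_def intro!: divide_nonneg_nonneg divide_nonneg_neg)
      define t where "t = Min (gap ` D)"
      have t_le: "t \<le> gap e" if "e \<in> D" for e using that D by (simp add: t_def)
      have "t \<in> gap ` D" using D by (simp add: t_def)
      then obtain e1 where e1: "e1 \<in> D" "t = gap e1" by blast
      have t0: "0 \<le> t" using e1 gap_nonneg by simp
      define y where "y e = x e + t * d0 e" for e
      have y_other: "y e = x e" if "e \<notin> D" for e using that by (auto simp: y_def d0_def D_def)
      have y_D: "y e = x e + t * d e" if "e \<in> D" for e using that by (auto simp: y_def d0_def D_def)
      have floor_le: "of_int \<lfloor>x e\<rfloor> \<le> y e" if "e \<in> D" for e
      proof (cases "0 < d e")
        case True
        then have "0 \<le> t * d e" using t0 by simp
        then show ?thesis using y_D[OF that] of_int_floor_le[of "x e"] by linarith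
      next
        case False
        then have "d e < 0" using that by (simp add: D_def)
        then have "t * (- d e) \<le> x e - of_int \<lfloor>x e\<rfloor>"
          using t_le[OF that] by (simp add: gap_def pos_le_divide_eq neg_divide_le_eq field_simps)
        then show ?thesis using y_D[OF that] by simp
      qed
      have y_nonneg: "0 \<le> y e" if "e \<in> E" for e
      proof (cases "e \<in> D")
        case True
        have "(0 :: rat) \<le> of_int \<lfloor>x e\<rfloor>" using x(1)[OF that] by simp
        then show ?thesis using floor_le[OF True] by linarith
      qed (use y_other x(1) that in simp)
      have "y e1 \<in> \<int>"
      proof (cases "0 < d e1")
        case True
        then have "y e1 = of_int \<lceil>x e1\<rceil>" using y_D[OF e1(1)] e1(2) by (simp add: gap_def)
        then show ?thesis by simp
      next
        case False
        then have "d e1 \<noteq> 0" using e1 by (simp add: D_def)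
        then have "y e1 = of_int \<lfloor>x e1\<rfloor>" using False y_D[OF e1(1)] e1(2) by (simp add: gap_def)
        then show ?thesis by simp
      qed
      have "fr y \<subseteq> fr x - {e1}"
      proof
        fix e assume e: "e \<in> fr y"
        then have "e \<noteq> e1" using \<open>y e1 \<in> \<int>\<close> by (auto simp: fr_def)
        moreover have "e \<in> fr x"
        proof (cases "e \<in> D")
          case False
          then show ?thesis using e y_other[OF False] by (simp add: fr_def)
        qed (simp add: D_def)
        ultimately show "e \<in> fr x - {e1}" by blast
      qed
      moreover have "e1 \<in> fr x" using e1 by (simp add: D_def)
      ultimately have "card (fr y) < card (fr x)"
        using fin_fr[of x] by (intro psubset_card_mono) auto
      moreover have "y \<in> Q"
      proof -
        have "(\<Sum>e\<in>{e\<in>E. P e}. y e) = (\<Sum>e\<in>{e\<in>E. P e}. x e) + t * (\<Sum>e\<in>{e\<in>fr x. P e}. d e)" for P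
          unfolding y_def d0_sum[symmetric] by (simp add: sum.distrib sum_distrib_left)
        then have "(\<Sum>e\<in>{e\<in>E. fst e = i}. y e) = of_int (r i)"
            "(\<Sum>e\<in>{e\<in>E. snd e = j}. y e) = of_int (c j)" for i j
          by (simp_all only: x(3,4) d(2,3) mult_zero_right add_0_right)
        moreover have "y e = 0" if "e \<notin> E" for e
          using y_other[of e] x(2)[OF that] that by (auto simp: D_def fr_def)
        ultimately show ?thesis using y_nonneg unfolding Q_def by blast
      qed
      ultimately show ?thesis using less.hyps by blast
    qed
  qed
  obtain z where z: "z \<in> flows E (\<lambda>i. N * r i) (\<lambda>j. N * c j)" using nonempty by blast
  have "(\<lambda>e. of_int (z e) / of_int N) \<in> Q"
  proof -
    have "(\<Sum>e\<in>{e\<in>E. P e}. of_int (z e) / (of_int N :: rat)) = of_int (\<Sum>e\<in>{e\<in>E. P e}. z e) / of_int N" for P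
      by (simp add: sum_divide_distrib)
    then have "(\<Sum>e\<in>{e\<in>E. fst e = i}. of_int (z e) / of_int N) = (of_int (r i) :: rat)"
       "(\<Sum>e\<in>{e\<in>E. snd e = j}. of_int (z e) / of_int N) = (of_int (c j) :: rat)" for i j
      using assms(2) by (simp_all only: flowsD(3,4)[OF z]) simp_all
    then show ?thesis using flowsD(1,2)[OF z] assms(2) unfolding Q_def by simp
  qed
  then obtain y where y: "y \<in> Q" "fr y = {}" using round by blast
  have yQ: "\<And>e. e \<in> E \<Longrightarrow> 0 \<le> y e" "\<And>e. e \<notin> E \<Longrightarrow> y e = 0"
    "\<And>i. (\<Sum>e\<in>{e\<in>E. fst e = i}. y e) = of_int (r i)"
    "\<And>j. (\<Sum>e\<in>{e\<in>E. snd e = j}. y e) = of_int (c j)"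
    using y(1) unfolding Q_def by blast+
  define w where "w e = \<lfloor>y e\<rfloor>" for e
  have w: "of_int (w e) = y e" for e
  proof -
    have "y e \<in> \<int>"
    proof (cases "e \<in> E")
      case True
      then show ?thesis using y(2) unfolding fr_def by blast
    qed (simp add: yQ(2))
    then show ?thesis by (cases rule: Ints_cases) (simp add: w_def)
  qed
  have "w \<in> flows E r c"
  proof (rule flowsI)
    fix e
    show "0 \<le> w e" if "e \<in> E" using yQ(1)[OF that] by (simp add: w_def)
    show "w e = 0" if "e \<notin> E" using yQ(2)[OF that] by (simp add: w_def)
  next
    fix i
    have "(of_int (\<Sum>e\<in>{e\<in>E. fst e = i}. w e) :: rat) = of_int (r i)"
      unfolding of_int_sum w by (rule yQ(3))
    then show "(\<Sum>e\<in>{e\<in>E. fst e = i}. w e) = r i" by (simp only: of_int_eq_iff)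
  next
    fix j
    have "(of_int (\<Sum>e\<in>{e\<in>E. snd e = j}. w e) :: rat) = of_int (c j)"
      unfolding of_int_sum w by (rule yQ(4))
    then show "(\<Sum>e\<in>{e\<in>E. snd e = j}. w e) = c j" by (simp only: of_int_eq_iff)
  qed
  then show ?thesis by blast
qed

text \<open>Dickson's lemma. For a single coordinate, the indices at which the value is not undercut later form
  an infinite set.\<close>

lemma infinite_monotone_subset:
  fixes x :: "nat \<Rightarrow> 'e \<Rightarrow> int"
  assumes "finite E" "infinite K" "\<And>k e. k \<in> K \<Longrightarrow> e \<in> E \<Longrightarrow> 0 \<le> x k e"
  shows "\<exists>K'. K' \<subseteq> K \<and> infinite K' \<and> (\<forall>e\<in>E. \<forall>k\<in>K'. \<forall>k'\<in>K'. k \<le> k' \<longrightarrow> x k e \<le> x k' e)"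
  using assms
proof (induction E)
  case empty
  then show ?case by blast
next
  case (insert e E)
  then obtain K' where K': "K' \<subseteq> K" "infinite K'"
    "\<forall>e\<in>E. \<forall>k\<in>K'. \<forall>k'\<in>K'. k \<le> k' \<longrightarrow> x k e \<le> x k' e"
    by (metis insertCI)
  define L where "L = {k \<in> K'. \<forall>k'\<in>K'. k \<le> k' \<longrightarrow> x k e \<le> x k' e}"
  have "infinite L"
    unfolding infinite_nat_iff_unbounded
  proof
    fix n
    obtain k0 where "k0 \<in> K'" "k0 > n" using K'(2) by (auto simp: infinite_nat_iff_unbounded)
    then obtain k where k: "k \<in> K'" "k > n" "\<And>k'. k' \<in> K' \<Longrightarrow> k' > n \<Longrightarrow> nat (x k e) \<le> nat (x k' e)"
      using ex_has_least_nat[of "\<lambda>k. k \<in> K' \<and> k > n" k0 "\<lambda>k. nat (x k e)"] by blast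
    have "x k e \<le> x k' e" if "k' \<in> K'" "k \<le> k'" for k'
      using k(3)[of k'] k(2) that insert.prems(2)[of k' e] K'(1) by (auto simp: nat_le_eq_zle)
    then show "\<exists>k>n. k \<in> L" using k by (auto simp: L_def)
  qed
  moreover have "L \<subseteq> K" "\<forall>e'\<in>insert e E. \<forall>k\<in>L. \<forall>k'\<in>L. k \<le> k' \<longrightarrow> x k e' \<le> x k' e'"
    using K' by (auto simp: L_def)
  ultimately show ?case by blast
qed

text \<open>If there were matrices for infinitely many \<open>k\<close>, two of them would be comparable entrywise. Their
  difference has a positive multiple of \<open>\<alpha>, \<alpha>'\<close> as margins, and so there would be a matrix with
  margins \<open>\<alpha>, \<alpha>'\<close> itself.\<close>

lemma eventually_empty_flows:
  assumes "finite E" "flows E \<alpha> \<alpha>' = {}"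
  shows "\<forall>\<^sub>F k in at_top. flows E (\<lambda>i. k * \<alpha> i + \<gamma> i) (\<lambda>j. k * \<alpha>' j + \<gamma>' j) = {}"
proof (rule ccontr)
  let ?X = "\<lambda>k :: int. flows E (\<lambda>i. k * \<alpha> i + \<gamma> i) (\<lambda>j. k * \<alpha>' j + \<gamma>' j)"
  assume "\<not> (\<forall>\<^sub>F k in at_top. ?X k = {})"
  then have nonempty: "\<exists>k\<ge>k0. ?X k \<noteq> {}" for k0 :: int
    by (auto simp: eventually_at_top_linorder)
  define K where "K = {n. ?X (int n) \<noteq> {}}"
  have "infinite K"
    unfolding infinite_nat_iff_unbounded
  proof
    fix n
    obtain k where "k \<ge> int n + 1" "?X k \<noteq> {}" using nonempty by blast
    then show "\<exists>k>n. k \<in> K" by (intro exI[of _ "nat k"]) (auto simp: K_def)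
  qed
  have "\<forall>n\<in>K. \<exists>x. x \<in> ?X (int n)" unfolding K_def by blast
  from bchoice[OF this] obtain x where x: "\<And>n. n \<in> K \<Longrightarrow> x n \<in> ?X (int n)" by blast
  have "0 \<le> x n e" if "n \<in> K" "e \<in> E" for n e using flowsD(1)[OF x] that by blast
  then obtain K' where K': "K' \<subseteq> K" "infinite K'"
    "\<forall>e\<in>E. \<forall>k\<in>K'. \<forall>k'\<in>K'. k \<le> k' \<longrightarrow> x k e \<le> x k' e"
    using infinite_monotone_subset[OF assms(1) \<open>infinite K\<close>, of x] by blast
  obtain m where m: "m \<in> K'" using K'(2) by fastforce
  obtain n where n: "n \<in> K'" "m < n" using K'(2) by (auto simp: infinite_nat_iff_unbounded)
  note xm = flowsD[OF x[OF subsetD[OF K'(1) m]]] and xn = flowsD[OF x[OF subsetD[OF K'(1) n(1)]]]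
  have "(\<lambda>e. x n e - x m e) \<in> flows E (\<lambda>i. (int n - int m) * \<alpha> i) (\<lambda>j. (int n - int m) * \<alpha>' j)"
  proof (rule flowsI)
    fix e assume "e \<in> E"
    then show "0 \<le> x n e - x m e" using K'(3) m n by simp
  next
    fix e assume "e \<notin> E"
    then show "x n e - x m e = 0" using xm(2) xn(2) by simp
  next
    fix i show "(\<Sum>e\<in>{e\<in>E. fst e = i}. x n e - x m e) = (int n - int m) * \<alpha> i"
      unfolding sum_subtractf xm(3) xn(3) by (simp add: left_diff_distrib)
  next
    fix j show "(\<Sum>e\<in>{e\<in>E. snd e = j}. x n e - x m e) = (int n - int m) * \<alpha>' j"
      unfolding sum_subtractf xm(4) xn(4) by (simp add: left_diff_distrib)
  qed
  moreover have "0 < int n - int m" using n(2) by simp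
  ultimately show False using flows_of_multiple[OF assms(1), of "int n - int m" \<alpha> \<alpha>'] assms(2) by blast
qed

text \<open>The induction is on the support. Given a matrix \<open>q\<close> with margins \<open>\<alpha>, \<alpha>'\<close>, subtracting its entries
  one unit at a time relates the count at \<open>k\<close> to the count at \<open>k - 1\<close> modulo counts for supports
  with one edge less.\<close>

theorem eventually_poly_flows:
  assumes "finite E"
  shows "eventually_poly (\<lambda>k. of_nat (card (flows E (\<lambda>i. k * \<alpha> i + \<gamma> i) (\<lambda>j. k * \<alpha>' j + \<gamma>' j))))"
  using assms
proof (induction "card E" arbitrary: E \<gamma> \<gamma>' rule: less_induct)
  case less
  define f where "f \<gamma> \<gamma>' k = (of_nat (card (flows E (\<lambda>i. k * \<alpha> i + \<gamma> i) (\<lambda>j. k * \<alpha>' j + \<gamma>' j))) :: rat)"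
    for \<gamma> \<gamma>' k
  have diff: "eventually_poly (\<lambda>k. f \<gamma> \<gamma>' k - f (\<lambda>i. \<gamma> i - r i) (\<lambda>j. \<gamma>' j - c j) k)"
    if "q \<in> flows E r c" for q r c \<gamma> \<gamma>'
    using that
  proof (induction "nat (\<Sum>e\<in>E. q e)" arbitrary: q r c \<gamma> \<gamma>' rule: less_induct)
    case q: less
    note qD = flowsD[OF q.prems]
    show ?case
    proof (cases "\<exists>e\<in>E. q e \<noteq> 0")
      case False
      then have "r i = 0" "c j = 0" for i j
        using qD(3)[of i] qD(4)[of j] by auto
      then show ?thesis by (simp add: eventually_poly_const)
    next
      case True
      then obtain e where e: "e \<in> E" "q e \<noteq> 0" by blast
      define r' c' where "r' i = r i - of_bool (i = fst e)" and "c' j = c j - of_bool (j = snd e)" for i j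
      define \<delta> \<delta>' where "\<delta> i = \<gamma> i - of_bool (i = fst e)" and "\<delta>' j = \<gamma>' j - of_bool (j = snd e)" for i j
      let ?q = "q(e := q e + - 1)"
      have "0 \<le> q e + - 1" using qD(1)[OF e(1)] e(2) by simp
      then have q': "?q \<in> flows E r' c'"
        using flows_add_edge[OF less.prems e(1) q.prems, of "- 1"] by (simp add: r'_def[abs_def] c'_def[abs_def])
      have "(\<Sum>e\<in>E. ?q e) = (\<Sum>e\<in>E. q e) - 1"
        using sum_upd_add[OF less.prems e(1), of q "- 1" "\<lambda>_. True"] by simp
      moreover have "0 \<le> (\<Sum>e\<in>E. ?q e)" using flowsD(1)[OF q'] by (intro sum_nonneg)
      ultimately have "nat (\<Sum>e\<in>E. ?q e) < nat (\<Sum>e\<in>E. q e)" by linarith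
      then have IH: "eventually_poly (\<lambda>k. f \<delta> \<delta>' k - f (\<lambda>i. \<delta> i - r' i) (\<lambda>j. \<delta>' j - c' j) k)"
        using q' by (rule q.hyps)
      have del: "eventually_poly (\<lambda>k. of_nat (card (flows (E - {e}) (\<lambda>i. k * \<alpha> i + \<gamma> i) (\<lambda>j. k * \<alpha>' j + \<gamma>' j))))"
        using less.prems e(1) by (intro less.hyps psubset_card_mono) auto
      have "f \<gamma> \<gamma>' k - f (\<lambda>i. \<gamma> i - r i) (\<lambda>j. \<gamma>' j - c j) k =
          of_nat (card (flows (E - {e}) (\<lambda>i. k * \<alpha> i + \<gamma> i) (\<lambda>j. k * \<alpha>' j + \<gamma>' j))) +
          (f \<delta> \<delta>' k - f (\<lambda>i. \<delta> i - r' i) (\<lambda>j. \<delta>' j - c' j) k)" for k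
        unfolding f_def card_flows_delete_edge[OF less.prems e(1), of "\<lambda>i. k * \<alpha> i + \<gamma> i"]
        by (simp add: \<delta>_def \<delta>'_def r'_def c'_def algebra_simps)
      then show ?thesis using eventually_poly_add[OF del IH] by simp
    qed
  qed
  show ?case
  proof (cases "flows E \<alpha> \<alpha>' = {}")
    case True
    show ?thesis
      using eventually_empty_flows[OF less.prems True, of \<gamma> \<gamma>']
      by (intro eventually_poly_cong[OF eventually_poly_const[of 0]]) (auto elim!: eventually_mono)
  next
    case False
    then obtain q where "q \<in> flows E \<alpha> \<alpha>'" by blast
    then have "eventually_poly (\<lambda>k. f \<gamma> \<gamma>' k - f (\<lambda>i. \<gamma> i - \<alpha> i) (\<lambda>j. \<gamma>' j - \<alpha>' j) k)"
      by (rule diff)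
    moreover have "f (\<lambda>i. \<gamma> i - \<alpha> i) (\<lambda>j. \<gamma>' j - \<alpha>' j) k = f \<gamma> \<gamma>' (k - 1)" for k
      by (simp add: f_def algebra_simps)
    ultimately have "eventually_poly (f \<gamma> \<gamma>')"
      using eventually_poly_of_difference[of "f \<gamma> \<gamma>'"] by simp
    then show ?thesis by (simp add: f_def[abs_def])
  qed
qed

section \<open>Tableaux as Gelfand-Tsetlin patterns\<close>

text \<open>The value at \<open>(j, i)\<close> is the position of walker \<open>j\<close> after time \<open>i\<close>. Values outside the index range
  are fixed, so that families of walks can be counted.\<close>

definition walks :: "nat \<Rightarrow> (nat \<Rightarrow> int) \<Rightarrow> (nat \<Rightarrow> int) \<Rightarrow> (nat \<Rightarrow> int) \<Rightarrow> (nat \<Rightarrow> nat) \<Rightarrow>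
    (nat \<Rightarrow> nat) \<Rightarrow> (nat \<times> nat \<Rightarrow> int) set" where
  "walks l s t \<beta> a b = {n. (\<forall>p. p \<notin> {1..l} \<times> {0..l} \<longrightarrow> n p = 0) \<and>
     (\<forall>j\<in>{1..l}. n (j, 0) = s j \<and> n (j, l) = t j) \<and>
     (\<forall>j\<in>{1..l}. \<forall>i\<in>{1..l}. n (j, i - 1) \<le> n (j, i) \<and>
        (n (j, i - 1) < n (j, i) \<longrightarrow> a j \<le> i \<and> i \<le> b j)) \<and>
     (\<forall>i\<in>{1..l}. (\<Sum>j\<in>{1..l}. n (j, i) - n (j, i - 1)) = \<beta> i)}"

lemma walksI:
  assumes "\<And>p. p \<notin> {1..l} \<times> {0..l} \<Longrightarrow> n p = 0"
    and "\<And>j. j \<in> {1..l} \<Longrightarrow> n (j, 0) = s j" "\<And>j. j \<in> {1..l} \<Longrightarrow> n (j, l) = t j"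
    and "\<And>j i. j \<in> {1..l} \<Longrightarrow> i \<in> {1..l} \<Longrightarrow> n (j, i - 1) \<le> n (j, i)"
    and "\<And>j i. j \<in> {1..l} \<Longrightarrow> i \<in> {1..l} \<Longrightarrow> n (j, i - 1) < n (j, i) \<Longrightarrow> a j \<le> i \<and> i \<le> b j"
    and "\<And>i. i \<in> {1..l} \<Longrightarrow> (\<Sum>j\<in>{1..l}. n (j, i) - n (j, i - 1)) = \<beta> i"
  shows "n \<in> walks l s t \<beta> a b"
  using assms unfolding walks_def by blast

lemma walksD:
  assumes "n \<in> walks l s t \<beta> a b"
  shows "p \<notin> {1..l} \<times> {0..l} \<Longrightarrow> n p = 0"
    and "j \<in> {1..l} \<Longrightarrow> n (j, 0) = s j" "j \<in> {1..l} \<Longrightarrow> n (j, l) = t j"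
    and "j \<in> {1..l} \<Longrightarrow> i \<in> {1..l} \<Longrightarrow> n (j, i - 1) \<le> n (j, i)"
    and "j \<in> {1..l} \<Longrightarrow> i \<in> {1..l} \<Longrightarrow> n (j, i - 1) < n (j, i) \<Longrightarrow> a j \<le> i"
    and "j \<in> {1..l} \<Longrightarrow> i \<in> {1..l} \<Longrightarrow> n (j, i - 1) < n (j, i) \<Longrightarrow> i \<le> b j"
    and "i \<in> {1..l} \<Longrightarrow> (\<Sum>j\<in>{1..l}. n (j, i) - n (j, i - 1)) = \<beta> i"
  using assms unfolding walks_def by blast+

lemma walks_mono:
  assumes n: "n \<in> walks l s t \<beta> a b" and "j \<in> {1..l}" "i \<le> i'" "i' \<le> l"
  shows "n (j, i) \<le> n (j, i')"
  using assms(3,4)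
proof (induction i' rule: dec_induct)
  case (step i')
  then show ?case using walksD(4)[OF n assms(2), of "Suc i'"] by simp
qed simp

text \<open>Gelfand-Tsetlin patterns for flagged tableaux: \<open>g (j, i)\<close> is the last column of row \<open>j\<close> with an entry
  at most \<open>i\<close>, or \<open>\<mu> j\<close> if there is none. The additional condition says that the cells with entry \<open>i\<close>
  form a horizontal strip.\<close>

definition patterns :: "nat \<Rightarrow> (nat \<Rightarrow> int) \<Rightarrow> (nat \<Rightarrow> int) \<Rightarrow> (nat \<Rightarrow> int) \<Rightarrow> (nat \<Rightarrow> nat) \<Rightarrow>
    (nat \<Rightarrow> nat) \<Rightarrow> (nat \<times> nat \<Rightarrow> int) set" where
  "patterns l lam \<mu> \<beta> a b = {g \<in> walks l \<mu> lam \<beta> a b.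
     \<forall>j\<in>{1..<l}. \<forall>i\<in>{1..l}. g (Suc j, i) \<le> g (j, i - 1)}"

lemma patterns_column:
  assumes g: "g \<in> patterns l lam \<mu> \<beta> a b" and "1 \<le> r" "r < j" "j \<le> l" "i \<in> {1..l}"
  shows "g (j, i) \<le> g (r, i - 1)"
proof -
  have w: "g \<in> walks l \<mu> lam \<beta> a b" and inter: "\<And>j i. j \<in> {1..<l} \<Longrightarrow> i \<in> {1..l} \<Longrightarrow> g (Suc j, i) \<le> g (j, i - 1)"
    using g by (auto simp: patterns_def)
  from \<open>r < j\<close> have "Suc r \<le> j" by simp
  then show ?thesis using \<open>j \<le> l\<close>
  proof (induction j rule: dec_induct)
    case base
    then show ?case using inter[of r i] assms by simp
  next
    case (step j)
    have "g (Suc j, i) \<le> g (j, i - 1)" using inter[of j i] step assms by simp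
    also have "\<dots> \<le> g (j, i)" using step assms by (intro walks_mono[OF w]) auto
    also have "\<dots> \<le> g (r, i - 1)" using step by simp
    finally show ?case .
  qed
qed

lemma initial_segment_card:
  fixes D :: "int set"
  assumes "D \<subseteq> {m<..M}" "\<And>c c'. c \<in> D \<Longrightarrow> m < c' \<Longrightarrow> c' \<le> c \<Longrightarrow> c' \<in> D"
  shows "D = {m<..m + int (card D)}"
proof (cases "D = {}")
  case False
  have fin: "finite D" using assms(1) finite_subset by blast
  have "D = {m<..Max D}"
  proof (intro set_eqI iffI)
    fix c assume "c \<in> D"
    then show "c \<in> {m<..Max D}" using assms(1) fin by auto
  next
    fix c assume "c \<in> {m<..Max D}"
    then show "c \<in> D" using assms(2)[of "Max D" c] Max_in[OF fin False] by auto
  qed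
  moreover have "m < Max D" using Max_in[OF fin False] assms(1) by auto
  ultimately have "int (card D) = Max D - m" by (metis card_greaterThanAtMost_int int_nat_eq less_imp_le diff_ge_0_iff_ge)
  then show ?thesis using \<open>D = {m<..Max D}\<close> by simp
qed simp

text \<open>The hypothesis \<open>key\<close> is the correspondence between tableaux and patterns; stated for arbitrary \<open>T\<close>
  and \<open>g\<close>, the count serves both directions of the bijection.\<close>

lemma card_entries:
  assumes key: "\<And>j c i. (j, c) \<in> skew_cells l lam \<mu> \<Longrightarrow> i \<le> l \<Longrightarrow> T (j, c) \<le> i \<longleftrightarrow> c \<le> g (j, i)"
    and bounds: "\<And>j i. j \<in> {1..l} \<Longrightarrow> i \<le> l \<Longrightarrow> \<mu> j \<le> g (j, i) \<and> g (j, i) \<le> lam j"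
    and mono: "\<And>j. j \<in> {1..l} \<Longrightarrow> g (j, i - 1) \<le> g (j, i)"
    and i: "i \<in> {1..l}"
  shows "int (card {x \<in> skew_cells l lam \<mu>. T x = (i :: nat)}) = (\<Sum>j\<in>{1..l}. g (j, i) - g (j, i - 1))"
proof -
  have il: "i \<le> l" "i - 1 \<le> l" using i by auto
  have entry: "x \<in> skew_cells l lam \<mu> \<and> T x = i \<longleftrightarrow> x \<in> (SIGMA j:{1..l}. {g (j, i - 1)<..g (j, i)})" for x
  proof -
    obtain j c where x: "x = (j, c)" by (cases x)
    show ?thesis
    proof (cases "j \<in> {1..l}")
      case True
      have "T (j, c) = i \<longleftrightarrow> T (j, c) \<le> i \<and> \<not> T (j, c) \<le> i - 1" using i by auto
      then have "T (j, c) = i \<longleftrightarrow> g (j, i - 1) < c \<and> c \<le> g (j, i)" if "(j, c) \<in> skew_cells l lam \<mu>"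
        using key[OF that il(1)] key[OF that il(2)] by auto
      moreover have "(j, c) \<in> skew_cells l lam \<mu>" if "g (j, i - 1) < c" "c \<le> g (j, i)"
        using that True bounds[OF True il(1)] bounds[OF True il(2)] by (auto simp: skew_cells_def)
      ultimately show ?thesis using True x by auto
    qed (auto simp: x skew_cells_def)
  qed
  have "{x \<in> skew_cells l lam \<mu>. T x = i} = (SIGMA j:{1..l}. {g (j, i - 1)<..g (j, i)})"
    using entry by blast
  moreover have "card (SIGMA j:{1..l}. {g (j, i - 1)<..g (j, i)}) = (\<Sum>j\<in>{1..l}. nat (g (j, i) - g (j, i - 1)))"
    by simp
  ultimately show ?thesis using mono by simp
qed

text \<open>From a tableau to its pattern one counts the entries at most \<open>i\<close> in each row; from a pattern to its
  tableau, the entry in column \<open>c\<close> is the first time at which the walker of the row has reached \<open>c\<close>.\<close>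

lemma kostka_eq_card_patterns:
  assumes shape: "is_skew_shape l lam \<mu>"
  shows "flagged_skew_kostka l lam \<mu> \<beta> a b = card (patterns l lam \<mu> \<beta> a b)"
proof (cases "\<forall>i\<in>{1..l}. 0 \<le> \<beta> i")
  case False
  then obtain i where i: "i \<in> {1..l}" "\<beta> i < 0" by force
  have "g \<notin> patterns l lam \<mu> \<beta> a b" for g
  proof
    assume "g \<in> patterns l lam \<mu> \<beta> a b"
    then have g: "g \<in> walks l \<mu> lam \<beta> a b" by (simp add: patterns_def)
    have "0 \<le> (\<Sum>j\<in>{1..l}. g (j, i) - g (j, i - 1))"
      using walksD(4)[OF g _ i(1)] by (intro sum_nonneg) simp
    then show False using walksD(7)[OF g i(1)] i(2) by simp
  qed
  then have "patterns l lam \<mu> \<beta> a b = {}" by blast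
  then show ?thesis using False unfolding flagged_skew_kostka_def by (simp only: if_False card.empty simp_thms)
next
  case True
  let ?C = "skew_cells l lam \<mu>"
  define TS where "TS = {T \<in> flagged_ssyt l lam \<mu> a b.
    (\<forall>i\<in>{1..l}. int (card {x \<in> ?C. T x = i}) = \<beta> i) \<and> T ` ?C \<subseteq> {1..l}}"
  define row where "row T j i = {c \<in> {\<mu> j<..lam j}. T (j, c) \<le> i}" for T :: "nat \<times> int \<Rightarrow> nat" and j i
  define F where "F T = (\<lambda>(j, i). if j \<in> {1..l} \<and> i \<le> l then \<mu> j + int (card (row T j i)) else 0)" for T
  define G where "G g = (\<lambda>(j, c). if (j, c) \<in> ?C then (LEAST i. c \<le> g (j, i)) else undefined)"
    for g :: "nat \<times> nat \<Rightarrow> int"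
  have C: "(j, c) \<in> ?C \<longleftrightarrow> j \<in> {1..l} \<and> \<mu> j < c \<and> c \<le> lam j" for j c
    by (simp add: skew_cells_def)
  have shape_le: "\<mu> j \<le> lam j" if "j \<in> {1..l}" for j using shape that by (simp add: is_skew_shape_def)
  have anti: "lam (Suc j) \<le> lam j" "\<mu> (Suc j) \<le> \<mu> j" if "j \<in> {1..<l}" for j
    using shape that unfolding is_skew_shape_def is_partition_def monotone_on_def by simp_all
  note TSD = TS_def flagged_ssyt_def
  have pos: "0 < T x" "T x \<le> l" if "T \<in> TS" "x \<in> ?C" for T x
    using that by (auto simp: TSD)
  have flag: "a j \<le> T (j, c)" "T (j, c) \<le> b j" if "T \<in> TS" "(j, c) \<in> ?C" for T j c
    using that by (auto simp: TSD)
  have weakly: "T (j, c) \<le> T (j, c')" if "T \<in> TS" "(j, c) \<in> ?C" "(j, c') \<in> ?C" "c \<le> c'" for T j c c'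
    using that unfolding TSD by blast
  have strictly: "T (i, c) < T (j, c)" if "T \<in> TS" "(i, c) \<in> ?C" "(j, c) \<in> ?C" "i < j" for T i j c
    using that unfolding TSD by blast
  have F_eq: "F T (j, i) = \<mu> j + int (card (row T j i))" if "j \<in> {1..l}" "i \<le> l" for T j i
    using that by (simp add: F_def)
  have row_eq: "row T j i = {\<mu> j<..F T (j, i)}" if T: "T \<in> TS" and j: "j \<in> {1..l}" and i: "i \<le> l" for T j i
    unfolding F_eq[OF j i]
  proof (rule initial_segment_card)
    show "row T j i \<subseteq> {\<mu> j<..lam j}" by (auto simp: row_def)
    fix c c' assume c: "c \<in> row T j i" "\<mu> j < c'" "c' \<le> c"
    then have "T (j, c') \<le> T (j, c)" using j by (intro weakly[OF T]) (auto simp: C row_def)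
    then show "c' \<in> row T j i" using c by (auto simp: row_def)
  qed
  have F_key: "T (j, c) \<le> i \<longleftrightarrow> c \<le> F T (j, i)" if "T \<in> TS" "(j, c) \<in> ?C" "i \<le> l" for T j c i
  proof -
    have "T (j, c) \<le> i \<longleftrightarrow> c \<in> row T j i" using that(2) by (auto simp: row_def C)
    then show ?thesis using row_eq[OF that(1) _ that(3), of j] that(2) by (simp add: C)
  qed
  have fin_row: "finite (row T j i)" for T j i
    unfolding row_def by (rule finite_subset[of _ "{\<mu> j<..lam j}"]) auto
  have F_bounds: "\<mu> j \<le> F T (j, i) \<and> F T (j, i) \<le> lam j" if "j \<in> {1..l}" "i \<le> l" for T j i
  proof -
    have "card (row T j i) \<le> card {\<mu> j<..lam j}" by (intro card_mono) (auto simp: row_def)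
    then show ?thesis using shape_le[OF that(1)] by (simp add: F_eq[OF that])
  qed
  have F_mono: "F T (j, i) \<le> F T (j, i')" if "j \<in> {1..l}" "i \<le> i'" "i' \<le> l" for T j i i'
  proof -
    have "card (row T j i) \<le> card (row T j i')" using that fin_row by (intro card_mono) (auto simp: row_def)
    then show ?thesis using that by (simp add: F_eq)
  qed
  have F_mem: "F T \<in> patterns l lam \<mu> \<beta> a b" if T: "T \<in> TS" for T
  proof -
    have "F T \<in> walks l \<mu> lam \<beta> a b"
    proof (rule walksI)
      fix p :: "nat \<times> nat" assume "p \<notin> {1..l} \<times> {0..l}"
      then show "F T p = 0" by (cases p) (auto simp: F_def)
    next
      fix j assume j: "j \<in> {1..l}"
      have "row T j 0 = {}" using pos(1)[OF T] j by (force simp: row_def C)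
      then show "F T (j, 0) = \<mu> j" using j by (simp add: F_eq)
      have "row T j l = {\<mu> j<..lam j}" using pos(2)[OF T] j by (force simp: row_def C)
      then show "F T (j, l) = lam j" using j shape_le[OF j] by (simp add: F_eq)
      fix i assume i: "i \<in> {1..l}"
      then show "F T (j, i - 1) \<le> F T (j, i)" using j by (intro F_mono) auto
      assume less: "F T (j, i - 1) < F T (j, i)"
      let ?c = "F T (j, i)"
      have il: "i \<le> l" "i - 1 \<le> l" using i by auto
      have c: "(j, ?c) \<in> ?C" using less F_bounds[OF j il(1), of T] F_bounds[OF j il(2), of T] j by (auto simp: C)
      have "T (j, ?c) \<le> i" "\<not> T (j, ?c) \<le> i - 1"
        using F_key[OF T c il(1)] F_key[OF T c il(2)] less by auto
      then have "T (j, ?c) = i" by simp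
      then show "a j \<le> i \<and> i \<le> b j" using flag[OF T c] by simp
    next
      fix i assume i: "i \<in> {1..l}"
      have "int (card {x \<in> ?C. T x = i}) = (\<Sum>j\<in>{1..l}. F T (j, i) - F T (j, i - 1))"
        using F_key[OF T] F_bounds F_mono i by (intro card_entries) auto
      then show "(\<Sum>j\<in>{1..l}. F T (j, i) - F T (j, i - 1)) = \<beta> i" using T i by (simp add: TS_def)
    qed
    moreover have "F T (Suc j, i) \<le> F T (j, i - 1)" if j: "j \<in> {1..<l}" and i: "i \<in> {1..l}" for j i
    proof (cases "F T (Suc j, i) \<le> \<mu> j")
      case True
      then show ?thesis using F_bounds[of j "i - 1" T] j i by force
    next
      case False
      let ?c = "F T (Suc j, i)"
      have "?c \<le> lam (Suc j)" using F_bounds[of "Suc j" i T] j i by simp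
      then have c: "(Suc j, ?c) \<in> ?C" "(j, ?c) \<in> ?C" using False anti[OF j] j by (auto simp: C)
      have "T (Suc j, ?c) \<le> i" using F_key[OF T c(1), of i] i by simp
      then have "T (j, ?c) \<le> i - 1" using strictly[OF T c(2,1)] by simp
      moreover have "i - 1 \<le> l" using i by auto
      ultimately show ?thesis using F_key[OF T c(2)] by blast
    qed
    ultimately show ?thesis by (simp add: patterns_def)
  qed
  have G_props: "1 \<le> G g (j, c) \<and> G g (j, c) \<le> l \<and> a j \<le> G g (j, c) \<and> G g (j, c) \<le> b j \<and>
      (\<forall>i\<le>l. G g (j, c) \<le> i \<longleftrightarrow> c \<le> g (j, i))"
    if g: "g \<in> patterns l lam \<mu> \<beta> a b" and c: "(j, c) \<in> ?C" for g j c
  proof -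
    have w: "g \<in> walks l \<mu> lam \<beta> a b" using g by (simp add: patterns_def)
    have j: "j \<in> {1..l}" using c by (simp add: C)
    let ?i = "G g (j, c)"
    have i_def: "?i = (LEAST i. c \<le> g (j, i))" using c by (simp add: G_def)
    have "c \<le> g (j, l)" using c walksD(3)[OF w j] by (simp add: C)
    then have le: "c \<le> g (j, ?i)" unfolding i_def by (rule LeastI[of "\<lambda>i. c \<le> g (j, i)"])
    have least: "?i \<le> i" if "c \<le> g (j, i)" for i
      unfolding i_def using that by (rule Least_le[of "\<lambda>i. c \<le> g (j, i)"])
    have il: "?i \<le> l" using \<open>c \<le> g (j, l)\<close> by (rule least)
    have "?i \<noteq> 0"
    proof
      assume "?i = 0"
      then show False using le walksD(2)[OF w j] c by (simp add: C)
    qed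
    then have i: "?i \<in> {1..l}" using il by simp
    have "\<not> c \<le> g (j, ?i - 1)" using least[of "?i - 1"] \<open>?i \<noteq> 0\<close> by auto
    then have "g (j, ?i - 1) < g (j, ?i)" using le by simp
    then have "a j \<le> ?i" "?i \<le> b j" using walksD(5,6)[OF w j i] by blast+
    moreover have "?i \<le> i \<longleftrightarrow> c \<le> g (j, i)" if "i \<le> l" for i
      using least[of i] walks_mono[OF w j _ that, of ?i] le by force
    ultimately show ?thesis using i by simp
  qed
  have G_mem: "G g \<in> TS" if g: "g \<in> patterns l lam \<mu> \<beta> a b" for g
  proof -
    have w: "g \<in> walks l \<mu> lam \<beta> a b" using g by (simp add: patterns_def)
    have 1: "G g \<in> extensional ?C" by (auto simp: G_def extensional_def)
    have 2: "\<forall>(j, c)\<in>?C. 0 < G g (j, c) \<and> G g (j, c) \<in> {a j..b j}"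
      using G_props[OF g] by fastforce
    have 3: "G g (j, c) \<le> G g (j, c')" if "(j, c) \<in> ?C" "(j, c') \<in> ?C" "c \<le> c'" for j c c'
      using G_props[OF g that(1)] G_props[OF g that(2)] that(3) by (meson order.trans order_refl)
    have 4: "G g (i, c) < G g (j, c)" if ij: "(i, c) \<in> ?C" "(j, c) \<in> ?C" "i < j" for i j c
    proof -
      let ?k = "G g (j, c)"
      have k: "?k \<in> {1..l}" using G_props[OF g ij(2)] by simp
      have "c \<le> g (j, ?k)" using G_props[OF g ij(2)] by blast
      also have "\<dots> \<le> g (i, ?k - 1)" using ij k by (intro patterns_column[OF g]) (auto simp: C)
      finally have "c \<le> g (i, ?k - 1)" .
      moreover have "?k - 1 \<le> l" using k by auto
      ultimately have "G g (i, c) \<le> ?k - 1" using G_props[OF g ij(1)] by blast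
      then show ?thesis using k by auto
    qed
    have 5: "int (card {x \<in> ?C. G g x = i}) = \<beta> i" if i: "i \<in> {1..l}" for i
    proof -
      have "int (card {x \<in> ?C. G g x = i}) = (\<Sum>j\<in>{1..l}. g (j, i) - g (j, i - 1))"
      proof (rule card_entries[OF _ _ _ i])
        fix j k assume j: "j \<in> {1..l}" and k: "k \<le> l"
        show "\<mu> j \<le> g (j, k) \<and> g (j, k) \<le> lam j"
          using walks_mono[OF w j, of 0 k] walks_mono[OF w j, of k l] walksD(2,3)[OF w j] k by simp
      qed (use G_props[OF g] walksD(4)[OF w _ i] in simp_all)
      then show ?thesis using walksD(7)[OF w i] by simp
    qed
    have 6: "G g ` ?C \<subseteq> {1..l}" using G_props[OF g] by fastforce
    show ?thesis unfolding TS_def flagged_ssyt_def using 1 2 3 4 5 6 by blast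
  qed
  have GF: "G (F T) = T" if T: "T \<in> TS" for T
  proof (rule ext)
    fix x :: "nat \<times> int"
    obtain j c where x: "x = (j, c)" by (cases x)
    show "G (F T) x = T x"
    proof (cases "x \<in> ?C")
      case True
      have "(LEAST i. c \<le> F T (j, i)) = T (j, c)"
      proof (rule Least_equality)
        show "c \<le> F T (j, T (j, c))" using F_key[OF T] pos(2)[OF T] True x by blast
        fix i assume "c \<le> F T (j, i)"
        then show "T (j, c) \<le> i"
          using F_key[OF T, of j c i] pos(2)[OF T, of "(j, c)"] True x by (cases "i \<le> l") auto
      qed
      then show ?thesis using True x by (simp add: G_def)
    next
      case False
      then show ?thesis using T x by (simp add: G_def TSD extensional_def)
    qed
  qed
  have FG: "F (G g) = g" if g: "g \<in> patterns l lam \<mu> \<beta> a b" for g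
  proof (rule ext)
    fix p :: "nat \<times> nat"
    obtain j i where p: "p = (j, i)" by (cases p)
    have w: "g \<in> walks l \<mu> lam \<beta> a b" using g by (simp add: patterns_def)
    show "F (G g) p = g p"
    proof (cases "j \<in> {1..l} \<and> i \<le> l")
      case True
      have b: "\<mu> j \<le> g (j, i)" "g (j, i) \<le> lam j"
        using walks_mono[OF w, of j 0 i] walks_mono[OF w, of j i l] walksD(2,3)[OF w, of j] True by simp_all
      have "row (G g) j i = {\<mu> j<..g (j, i)}"
        using G_props[OF g, of j] True b by (force simp: row_def C)
      then show ?thesis using True b by (simp add: F_eq p)
    next
      case False
      then show ?thesis using walksD(1)[OF w, of p] by (auto simp: F_def p)
    qed
  qed
  have "bij_betw F TS (patterns l lam \<mu> \<beta> a b)"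
    using F_mem G_mem GF FG by (intro bij_betw_byWitness[where f' = G]) auto
  then have "card TS = card (patterns l lam \<mu> \<beta> a b)" by (rule bij_betw_same_card)
  then show ?thesis using shape True by (simp add: flagged_skew_kostka_def TS_def)
qed

text \<open>The matrix of the step lengths determines the walks. If the walks are independent, the flags only
  restrict the support of this matrix, the end points prescribe the row sums and the weight the
  column sums.\<close>

lemma walks_bij_flows:
  "\<exists>f. bij_betw f (walks l s t \<beta> a b)
    (flows {(j, i). j \<in> {1..l} \<and> i \<in> {1..l} \<and> a j \<le> i \<and> i \<le> b j}
      (\<lambda>j. if j \<in> {1..l} then t j - s j else 0) (\<lambda>i. if i \<in> {1..l} then \<beta> i else 0))"
proof -
  define E where "E = {(j, i). j \<in> {1..l} \<and> i \<in> {1..l} \<and> a j \<le> i \<and> i \<le> b j}"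
  define r where "r j = (if j \<in> {1..l} then t j - s j else 0)" for j
  define c where "c i = (if i \<in> {1..l} then \<beta> i else 0)" for i
  define step where "step n = (\<lambda>(j, i). if (j, i) \<in> E then n (j, i) - n (j, i - 1) else 0)"
    for n :: "nat \<times> nat \<Rightarrow> int"
  define path where "path x = (\<lambda>(j, i). if j \<in> {1..l} \<and> i \<le> l then s j + (\<Sum>i'\<in>{1..i}. x (j, i')) else 0)"
    for x :: "nat \<times> nat \<Rightarrow> int"
  have E: "(j, i) \<in> E \<longleftrightarrow> j \<in> {1..l} \<and> i \<in> {1..l} \<and> a j \<le> i \<and> i \<le> b j" for j i
    by (simp add: E_def)
  have row_sum: "(\<Sum>e\<in>{e\<in>E. fst e = j}. x e) = (if j \<in> {1..l} then \<Sum>i\<in>{1..l}. x (j, i) else 0)"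
    if "\<And>e. e \<notin> E \<Longrightarrow> x e = 0" for x :: "nat \<times> nat \<Rightarrow> int" and j
  proof (cases "j \<in> {1..l}")
    case True
    have "(\<Sum>e\<in>{e\<in>E. fst e = j}. x e) = (\<Sum>e\<in>Pair j ` {1..l}. x e)"
      using that by (intro sum.mono_neutral_left) (auto simp: E_def)
    also have "\<dots> = (\<Sum>i\<in>{1..l}. x (j, i))" by (subst sum.reindex) (auto simp: inj_on_def)
    finally show ?thesis using True by simp
  next
    case False
    then have "{e\<in>E. fst e = j} = {}" by (auto simp: E_def)
    then show ?thesis using False by (simp only: sum.empty if_False)
  qed
  have col_sum: "(\<Sum>e\<in>{e\<in>E. snd e = i}. x e) = (if i \<in> {1..l} then \<Sum>j\<in>{1..l}. x (j, i) else 0)"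
    if "\<And>e. e \<notin> E \<Longrightarrow> x e = 0" for x :: "nat \<times> nat \<Rightarrow> int" and i
  proof (cases "i \<in> {1..l}")
    case True
    have "(\<Sum>e\<in>{e\<in>E. snd e = i}. x e) = (\<Sum>e\<in>(\<lambda>j. (j, i)) ` {1..l}. x e)"
      using that by (intro sum.mono_neutral_left) (auto simp: E_def)
    also have "\<dots> = (\<Sum>j\<in>{1..l}. x (j, i))" by (subst sum.reindex) (auto simp: inj_on_def)
    finally show ?thesis using True by simp
  next
    case False
    then have "{e\<in>E. snd e = i} = {}" by (auto simp: E_def)
    then show ?thesis using False by (simp only: sum.empty if_False)
  qed
  have step_eq: "step n (j, i) = n (j, i) - n (j, i - 1)"
    if n: "n \<in> walks l s t \<beta> a b" and ji: "j \<in> {1..l}" "i \<in> {1..l}" for n j i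
  proof (cases "(j, i) \<in> E")
    case False
    then have "\<not> n (j, i - 1) < n (j, i)" using walksD(5,6)[OF n ji] ji by (auto simp: E_def)
    then show ?thesis using False walksD(4)[OF n ji] by (simp add: step_def)
  qed (simp add: step_def)
  have telescope: "(\<Sum>i'\<in>{1..i}. n (j, i') - n (j, i' - 1)) = n (j, i) - n (j, 0)"
    for n :: "nat \<times> nat \<Rightarrow> int" and j i
    by (induction i) auto
  have step_mem: "step n \<in> flows E r c" if n: "n \<in> walks l s t \<beta> a b" for n
  proof (rule flowsI)
    fix e assume "e \<in> E"
    then show "0 \<le> step n e" using walksD(4)[OF n] by (cases e) (auto simp: step_def E_def)
  next
    fix e assume "e \<notin> E"
    then show "step n e = 0" by (cases e) (auto simp: step_def)
  next
    have out: "step n e = 0" if "e \<notin> E" for e using that by (cases e) (auto simp: step_def)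
    fix j
    have "(\<Sum>i\<in>{1..l}. step n (j, i)) = t j - s j" if j: "j \<in> {1..l}"
    proof -
      have "(\<Sum>i\<in>{1..l}. step n (j, i)) = (\<Sum>i\<in>{1..l}. n (j, i) - n (j, i - 1))"
        using step_eq[OF n j] by (intro sum.cong) auto
      then show ?thesis using telescope[of n j l] walksD(2,3)[OF n j] by simp
    qed
    then show "(\<Sum>e\<in>{e\<in>E. fst e = j}. step n e) = r j" using row_sum[of "step n" j, OF out] by (simp add: r_def)
    have "(\<Sum>i\<in>{1..l}. step n (i, j)) = \<beta> j" if j: "j \<in> {1..l}"
    proof -
      have "(\<Sum>i\<in>{1..l}. step n (i, j)) = (\<Sum>i\<in>{1..l}. n (i, j) - n (i, j - 1))"
        using step_eq[OF n _ j] by (intro sum.cong) auto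
      then show ?thesis using walksD(7)[OF n j] by simp
    qed
    then show "(\<Sum>e\<in>{e\<in>E. snd e = j}. step n e) = c j" using col_sum[of "step n" j, OF out] by (simp add: c_def)
  qed
  have path_eq: "path x (j, i) = s j + (\<Sum>i'\<in>{1..i}. x (j, i'))" if "j \<in> {1..l}" "i \<le> l" for x j i
    using that by (simp add: path_def)
  have path_step: "path x (j, i) - path x (j, i - 1) = x (j, i)" if "j \<in> {1..l}" "i \<in> {1..l}" for x j i
  proof -
    obtain k where "i = Suc k" using \<open>i \<in> {1..l}\<close> by (cases i) auto
    then show ?thesis using that by (simp add: path_eq)
  qed
  have path_mem: "path x \<in> walks l s t \<beta> a b" if x: "x \<in> flows E r c" for x
  proof (rule walksI)
    fix p :: "nat \<times> nat" assume "p \<notin> {1..l} \<times> {0..l}"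
    then show "path x p = 0" by (cases p) (auto simp: path_def)
  next
    fix j assume j: "j \<in> {1..l}"
    show "path x (j, 0) = s j" using j by (simp add: path_eq)
    have "(\<Sum>i\<in>{1..l}. x (j, i)) = t j - s j"
      using flowsD(3)[OF x, of j] row_sum[of x j, OF flowsD(2)[OF x]] j by (simp add: r_def)
    then show "path x (j, l) = t j" using j by (simp add: path_eq)
    fix i assume i: "i \<in> {1..l}"
    have "0 \<le> x (j, i)" using flowsD(1,2)[OF x, of "(j, i)"] by (cases "(j, i) \<in> E") auto
    then show "path x (j, i - 1) \<le> path x (j, i)" using path_step[OF j i, of x] by linarith
    assume "path x (j, i - 1) < path x (j, i)"
    then have "x (j, i) \<noteq> 0" using path_step[OF j i, of x] by linarith
    then have "(j, i) \<in> E" using flowsD(2)[OF x] by blast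
    then show "a j \<le> i \<and> i \<le> b j" by (simp add: E_def)
  next
    fix i assume i: "i \<in> {1..l}"
    have "(\<Sum>j\<in>{1..l}. path x (j, i) - path x (j, i - 1)) = (\<Sum>j\<in>{1..l}. x (j, i))"
      using path_step[OF _ i] by (intro sum.cong) auto
    also have "\<dots> = \<beta> i"
      using flowsD(4)[OF x, of i] col_sum[of x i, OF flowsD(2)[OF x]] i by (simp add: c_def)
    finally show "(\<Sum>j\<in>{1..l}. path x (j, i) - path x (j, i - 1)) = \<beta> i" .
  qed
  have "bij_betw step (walks l s t \<beta> a b) (flows E r c)"
  proof (rule bij_betw_byWitness[where f' = path])
    show "\<forall>n\<in>walks l s t \<beta> a b. path (step n) = n"
    proof (intro ballI ext)
      fix n and p :: "nat \<times> nat" assume n: "n \<in> walks l s t \<beta> a b"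
      obtain j i where p: "p = (j, i)" by (cases p)
      show "path (step n) p = n p"
      proof (cases "j \<in> {1..l} \<and> i \<le> l")
        case True
        then have "(\<Sum>i'\<in>{1..i}. step n (j, i')) = (\<Sum>i'\<in>{1..i}. n (j, i') - n (j, i' - 1))"
          using step_eq[OF n] by (intro sum.cong) auto
        then show ?thesis using True walksD(2)[OF n, of j] telescope[of n j i] by (simp add: p path_eq)
      next
        case False
        then show ?thesis using walksD(1)[OF n, of p] by (auto simp: p path_def)
      qed
    qed
    show "\<forall>x\<in>flows E r c. step (path x) = x"
    proof (intro ballI ext)
      fix x and e :: "nat \<times> nat" assume x: "x \<in> flows E r c"
      obtain j i where e: "e = (j, i)" by (cases e)
      show "step (path x) e = x e"
        using path_step[of j i x] flowsD(2)[OF x, of e] by (auto simp: e step_def E_def)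
    qed
  qed (use step_mem path_mem in auto)
  then show ?thesis unfolding E_def r_def[abs_def] c_def[abs_def] by blast
qed

lemma finite_walks: "finite (walks l s t \<beta> a b)"
proof -
  let ?E = "{(j, i). j \<in> {1..l} \<and> i \<in> {1..l} \<and> a j \<le> i \<and> i \<le> b j}"
  have "finite ?E" by (rule finite_subset[of _ "{1..l} \<times> {1..l}"]) auto
  then show ?thesis using walks_bij_flows[of l s t \<beta> a b] bij_betw_finite finite_flows by blast
qed

section \<open>The reflection argument\<close>

lemma strictly_increasing_permutation_is_id:
  assumes p: "p permutes {1..l :: nat}" and incr: "\<And>j. j \<in> {1..<l} \<Longrightarrow> p j < p (Suc j)"
  shows "p = id"
proof -
  have ge: "j \<le> p j" if "j \<in> {1..l}" for j
    using that
  proof (induction j)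
    case (Suc j)
    show ?case
    proof (cases "j = 0")
      case True
      then show ?thesis using permutes_in_image[OF p, of "Suc j"] Suc.prems by auto
    next
      case False
      then show ?thesis using incr[of j] Suc by force
    qed
  qed simp
  have "(\<Sum>j\<in>{1..l}. j) = (\<Sum>j\<in>{1..l}. p j)"
    using sum.permute[OF p, of "\<lambda>j. j"] by (simp add: comp_def)
  then have "j = p j" if "j \<in> {1..l}" for j
    using sum_mono_inv[of "\<lambda>j. j" "{1..l}" p j] ge that by simp
  then have "p j = j" for j using permutes_not_in[OF p, of j] by metis
  then show ?thesis by (simp add: fun_eq_iff)
qed

lemma sum_sign_reversing_involution:
  fixes f :: "'a \<Rightarrow> int"
  assumes "\<And>x. x \<in> B \<Longrightarrow> \<phi> x \<in> B" "\<And>x. x \<in> B \<Longrightarrow> \<phi> (\<phi> x) = x" "\<And>x. x \<in> B \<Longrightarrow> f (\<phi> x) = - f x"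
  shows "sum f B = 0"
proof -
  have "sum f B = sum (\<lambda>x. - f x) B"
    by (rule sum.reindex_bij_witness[of B \<phi> \<phi>]) (use assms in auto)
  then show ?thesis by (simp add: sum_negf)
qed

text \<open>Abstracts from the shifted end points \<open>\<mu>\<^sub>j - j\<close> and \<open>\<lambda>\<^sub>j - j\<close>.\<close>

locale walk_endpoints =
  fixes l :: nat and s t \<beta> :: "nat \<Rightarrow> int" and a b :: "nat \<Rightarrow> nat"
  assumes start_decreasing: "j \<in> {1..<l} \<Longrightarrow> s (Suc j) < s j"
    and end_decreasing: "1 \<le> j \<Longrightarrow> j < j' \<Longrightarrow> j' \<le> l \<Longrightarrow> t j' < t j"
    and a_mono: "j \<in> {1..<l} \<Longrightarrow> a j \<le> a (Suc j)"
    and b_mono: "1 \<le> j \<Longrightarrow> j \<le> j' \<Longrightarrow> j' \<le> l \<Longrightarrow> b j \<le> b j'"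
begin

text \<open>The upper flag belongs to the end point and therefore moves with it, the lower flag stays with the
  starting point.\<close>

definition permuted_walks :: "(nat \<Rightarrow> nat) \<Rightarrow> (nat \<times> nat \<Rightarrow> int) set" where
  "permuted_walks p = walks l s (t \<circ> p) \<beta> a (b \<circ> p)"

text \<open>Walker \<open>j + 1\<close>, which starts to the left of walker \<open>j\<close>, reaches or passes at time \<open>i\<close> the position that
  walker \<open>j\<close> had just before.\<close>

definition collision :: "(nat \<times> nat \<Rightarrow> int) \<Rightarrow> nat \<Rightarrow> nat \<Rightarrow> bool" where
  "collision n j i \<longleftrightarrow> j \<in> {1..<l} \<and> i \<in> {1..l} \<and> n (j, i - 1) \<le> n (Suc j, i)"

definition first_time :: "(nat \<times> nat \<Rightarrow> int) \<Rightarrow> nat" where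
  "first_time n = (LEAST i. \<exists>j. collision n j i)"

text \<open>At the first time with a collision, the exchange of the positions of \<open>j\<close> and \<open>j + 1\<close> may create
  collisions in rows above \<open>j\<close>, but not below. Choosing the last row makes the choice the same
  after the exchange.\<close>

definition last_row :: "(nat \<times> nat \<Rightarrow> int) \<Rightarrow> nat" where
  "last_row n = (GREATEST j. collision n j (first_time n))"

definition swap_tails :: "nat \<Rightarrow> nat \<Rightarrow> (nat \<times> nat \<Rightarrow> int) \<Rightarrow> nat \<times> nat \<Rightarrow> int" where
  "swap_tails j i n = (\<lambda>(j', i'). if i \<le> i' then n (transpose j (Suc j) j', i') else n (j', i'))"

definition reflect :: "(nat \<Rightarrow> nat) \<times> (nat \<times> nat \<Rightarrow> int) \<Rightarrow> (nat \<Rightarrow> nat) \<times> (nat \<times> nat \<Rightarrow> int)" where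
  "reflect = (\<lambda>(p, n). let i = first_time n; j = last_row n in
     (p \<circ> transpose j (Suc j), swap_tails j i n))"

lemma first_collision:
  assumes "collision n j0 i0"
  shows "collision n (last_row n) (first_time n)"
    and "\<And>j i. i < first_time n \<Longrightarrow> \<not> collision n j i"
    and "\<And>j. last_row n < j \<Longrightarrow> \<not> collision n j (first_time n)"
proof -
  have ex: "\<exists>j. collision n j (first_time n)"
    unfolding first_time_def by (rule LeastI_ex) (use assms in blast)
  show "\<not> collision n j i" if "i < first_time n" for j i
    using not_less_Least[OF that[unfolded first_time_def]] by blast
  have bound: "j \<le> l" if "collision n j (first_time n)" for j
    using that by (auto simp: collision_def)
  show "collision n (last_row n) (first_time n)"
    unfolding last_row_def by (rule GreatestI_ex_nat[OF ex, of l]) (rule bound)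
  show "\<not> collision n j (first_time n)" if "last_row n < j" for j
  proof
    assume "collision n j (first_time n)"
    then have "j \<le> last_row n"
      unfolding last_row_def by (rule Greatest_le_nat[of _ _ l]) (rule bound)
    with that show False by simp
  qed
qed

lemma first_collision_unique:
  assumes "collision n j i" "\<And>j' i'. i' < i \<Longrightarrow> \<not> collision n j' i'" "\<And>j'. j < j' \<Longrightarrow> \<not> collision n j' i"
  shows "first_time n = i" "last_row n = j"
proof -
  show i: "first_time n = i"
    unfolding first_time_def
  proof (rule Least_equality)
    show "\<exists>j. collision n j i" using assms(1) by blast
    show "i \<le> y" if "\<exists>j. collision n j y" for y using assms(2) that by (meson not_less)
  qed
  show "last_row n = j"
    unfolding last_row_def i
  proof (rule Greatest_equality)
    show "collision n j i" by fact
    show "y \<le> j" if "collision n y i" for y using assms(3) that by (meson not_less)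
  qed
qed

text \<open>The critical point is that walker \<open>j + 1\<close>, continuing on the way of walker \<open>j\<close>, must respect the
  upper flag of the end point \<open>p j\<close> at time \<open>i\<close>. If walker \<open>j\<close> had to stop before time \<open>i\<close>, then
  \<open>p j < p (Suc j)\<close> because \<open>b\<close> increases, so its final position would be to the right of the end
  point of walker \<open>j + 1\<close>, which contradicts the collision.\<close>

lemma swap_tails_mem:
  assumes p: "p permutes {1..l}" and n: "n \<in> permuted_walks p" and col: "collision n j i"
    and first: "\<And>j' i'. i' < i \<Longrightarrow> \<not> collision n j' i'"
  shows "swap_tails j i n \<in> permuted_walks (p \<circ> transpose j (Suc j))"
proof -
  let ?\<tau> = "transpose j (Suc j)"
  note D = walksD[OF n[unfolded permuted_walks_def]]
  have j: "j \<in> {1..<l}" and i: "i \<in> {1..l}" and hit: "n (j, i - 1) \<le> n (Suc j, i)"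
    using col by (auto simp: collision_def)
  have jl: "j \<in> {1..l}" "Suc j \<in> {1..l}" using j by auto
  have \<tau>_mem: "?\<tau> j' \<in> {1..l} \<longleftrightarrow> j' \<in> {1..l}" for j' using jl by (auto simp: transpose_def)
  have \<tau>_perm: "?\<tau> permutes {1..l}" using jl by (rule permutes_swap_id)
  \<comment> \<open>The order of the two walkers is preserved until the first collision.\<close>
  have before: "n (Suc j, i - 1) < n (j, i - 1)"
  proof (cases "i = 1")
    case True
    then show ?thesis using D(2)[OF jl(1)] D(2)[OF jl(2)] start_decreasing[OF j] by simp
  next
    case False
    then have i': "i - 1 \<in> {1..l}" "i - 1 < i" using i by auto
    then have "n (Suc j, i - 1) < n (j, i - 1 - 1)" using first[OF i'(2), of j] j by (simp add: collision_def)
    then show ?thesis using D(4)[OF jl(1) i'(1)] by simp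
  qed
  then have moves: "n (Suc j, i - 1) < n (Suc j, i)" using hit by simp
  have aS: "a (Suc j) \<le> i" and bS: "i \<le> b (p (Suc j))" using D(5,6)[OF jl(2) i moves] by simp_all
  have aj: "a j \<le> a (Suc j)" using a_mono[OF j] .
  have bj: "i \<le> b (p j)"
  proof (rule ccontr)
    assume "\<not> i \<le> b (p j)"
    then have lt: "b (p j) < i" by simp
    have pm: "p j \<in> {1..l}" "p (Suc j) \<in> {1..l}" using permutes_in_image[OF p] jl by blast+
    have "p j < p (Suc j)"
    proof (rule ccontr)
      assume "\<not> p j < p (Suc j)"
      then have "b (p (Suc j)) \<le> b (p j)" using pm by (intro b_mono) auto
      then show False using lt bS by simp
    qed
    then have "t (p (Suc j)) < t (p j)" using pm by (intro end_decreasing) auto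
    have const: "n (j, k) = n (j, i - 1)" if "i - 1 \<le> k" "k \<le> l" for k
      using that
    proof (induction k rule: dec_induct)
      case (step k)
      have k: "Suc k \<in> {1..l}" using step by simp
      have "\<not> n (j, k) < n (j, Suc k)"
        using D(6)[OF jl(1) k] lt step by auto
      then show ?case using D(4)[OF jl(1) k] step by simp
    qed simp
    have "n (j, l) = n (j, i - 1)" using i by (intro const) auto
    then have "t (p j) = n (j, i - 1)" using D(3)[OF jl(1)] by simp
    also have "\<dots> \<le> n (Suc j, i)" by (rule hit)
    also have "\<dots> \<le> n (Suc j, l)" using walks_mono[OF n[unfolded permuted_walks_def] jl(2), of i l] i by simp
    also have "\<dots> = t (p (Suc j))" using D(3)[OF jl(2)] by simp
    finally show False using \<open>t (p (Suc j)) < t (p j)\<close> by simp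
  qed
  let ?n = "swap_tails j i n"
  have n_eq: "?n (j', i') = (if i \<le> i' then n (?\<tau> j', i') else n (j', i'))" for j' i'
    by (simp add: swap_tails_def)
  have step: "?n (j', i' - 1) \<le> ?n (j', i') \<and> (?n (j', i' - 1) < ?n (j', i') \<longrightarrow> a j' \<le> i' \<and> i' \<le> b (p (?\<tau> j')))"
    if j': "j' \<in> {1..l}" and i': "i' \<in> {1..l}" for j' i'
  proof -
    have pred: "i \<le> i' - 1 \<longleftrightarrow> i < i'" using i' by auto
    have base: "n (r, i' - 1) \<le> n (r, i') \<and> (n (r, i' - 1) < n (r, i') \<longrightarrow> a r \<le> i' \<and> i' \<le> b (p r))"
      if "r \<in> {1..l}" for r
      using D(4,5,6)[OF that i'] by simp
    consider "j' = j" "?\<tau> j' = Suc j" | "j' = Suc j" "?\<tau> j' = j" | "j' \<noteq> j" "j' \<noteq> Suc j" "?\<tau> j' = j'"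
      by (cases "j' = j \<or> j' = Suc j") auto
    note casesj = this
    show ?thesis
    proof (cases i' i rule: linorder_cases)
      case less
      then have "?n (j', i' - 1) = n (j', i' - 1)" "?n (j', i') = n (j', i')" using pred by (simp_all add: n_eq)
      moreover have "i' \<le> b (p (?\<tau> j'))" if "i' \<le> b (p j')"
        using that less bS bj by (cases rule: casesj) simp_all
      ultimately show ?thesis using base[OF j'] by simp
    next
      case equal
      then have vals: "?n (j', i' - 1) = n (j', i - 1)" "?n (j', i') = n (?\<tau> j', i)" using pred by (simp_all add: n_eq)
      have "n (j', i - 1) \<le> n (?\<tau> j', i) \<and> (n (j', i - 1) < n (?\<tau> j', i) \<longrightarrow> a j' \<le> i \<and> i \<le> b (p (?\<tau> j')))"
      proof (cases rule: casesj)
        case 1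
        then show ?thesis using hit aS aj bS by simp
      next
        case 2
        then show ?thesis using before D(4)[OF jl(1) i] aS bj by simp
      next
        case 3
        then show ?thesis using base[OF j'] equal by simp
      qed
      then show ?thesis using vals equal by simp
    next
      case greater
      then have "?n (j', i' - 1) = n (?\<tau> j', i' - 1)" "?n (j', i') = n (?\<tau> j', i')" using pred by (simp_all add: n_eq)
      moreover have "a j' \<le> i'" if "a (?\<tau> j') \<le> i'"
        using that greater aS aj by (cases rule: casesj) simp_all
      moreover have "?\<tau> j' \<in> {1..l}" using j' \<tau>_mem[of j'] by blast
      ultimately show ?thesis using base[of "?\<tau> j'"] by simp
    qed
  qed
  show ?thesis
    unfolding permuted_walks_def
  proof (rule walksI)
    fix q :: "nat \<times> nat" assume q: "q \<notin> {1..l} \<times> {0..l}"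
    obtain j' i' where q': "q = (j', i')" by (cases q)
    then have "(?\<tau> j', i') \<notin> {1..l} \<times> {0..l}" using q \<tau>_mem[of j'] by blast
    then show "?n q = 0" using q D(1)[of q] D(1) by (simp add: q' n_eq)
  next
    fix j' assume j': "j' \<in> {1..l}"
    show "?n (j', 0) = s j'" using i D(2)[OF j'] by (simp add: n_eq)
    show "?n (j', l) = (t \<circ> (p \<circ> ?\<tau>)) j'" using i D(3)[of "?\<tau> j'"] j' \<tau>_mem[of j'] by (simp add: n_eq)
    fix i' assume i': "i' \<in> {1..l}"
    show "?n (j', i' - 1) \<le> ?n (j', i')" using step[OF j' i'] by blast
    show "a j' \<le> i' \<and> i' \<le> (b \<circ> (p \<circ> ?\<tau>)) j'" if "?n (j', i' - 1) < ?n (j', i')"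
      using step[OF j' i'] that by simp
  next
    fix i' assume i': "i' \<in> {1..l}"
    have col_sum: "(\<Sum>j'\<in>{1..l}. ?n (j', k)) = (\<Sum>j'\<in>{1..l}. n (j', k))" for k
    proof (cases "i \<le> k")
      case True
      then show ?thesis
        using sum.permute[OF \<tau>_perm, of "\<lambda>j'. n (j', k)"] by (simp add: n_eq comp_def)
    qed (simp add: n_eq)
    show "(\<Sum>j'\<in>{1..l}. ?n (j', i') - ?n (j', i' - 1)) = \<beta> i'"
      using D(7)[OF i'] unfolding sum_subtractf col_sum .
  qed
qed

lemma swap_tails_collision:
  assumes col: "collision n j i" and step: "n (j, i - 1) \<le> n (j, i)"
    and first: "\<And>j' i'. i' < i \<Longrightarrow> \<not> collision n j' i'" and last: "\<And>j'. j < j' \<Longrightarrow> \<not> collision n j' i"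
  shows "first_time (swap_tails j i n) = i" "last_row (swap_tails j i n) = j"
proof -
  let ?n = "swap_tails j i n"
  have i: "\<not> i \<le> i - 1" using col by (auto simp: collision_def)
  have "collision ?n j i" using col step i by (simp add: collision_def swap_tails_def)
  moreover have "\<not> collision ?n j' i'" if "i' < i" for j' i'
    using first[OF that, of j'] that by (auto simp: collision_def swap_tails_def)
  moreover have "\<not> collision ?n j' i" if "j < j'" for j'
    using last[OF that] that i by (simp add: collision_def swap_tails_def transpose_def)
  ultimately show "first_time ?n = i" "last_row ?n = j"
    using first_collision_unique[of ?n j i] by blast+
qed

lemma swap_tails_twice: "swap_tails j i (swap_tails j i n) = n"
  by (rule ext) (auto simp: swap_tails_def)

text \<open>Without collisions the walkers keep their order up to the end.\<close>

lemma no_collision_imp_id: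
  assumes p: "p permutes {1..l}" and n: "n \<in> permuted_walks p" and no: "\<And>j i. \<not> collision n j i"
  shows "p = id"
proof (rule strictly_increasing_permutation_is_id[OF p])
  fix j assume j: "j \<in> {1..<l}"
  then have jl: "j \<in> {1..l}" "Suc j \<in> {1..l}" and l: "l \<in> {1..l}" by auto
  note D = walksD[OF n[unfolded permuted_walks_def]]
  have "n (Suc j, l) < n (j, l - 1)" using no[of j l] j l by (simp add: collision_def)
  then have "n (Suc j, l) < n (j, l)" using D(4)[OF jl(1) l] by simp
  then have lt: "t (p (Suc j)) < t (p j)" using D(3) jl by simp
  have pm: "p j \<in> {1..l}" "p (Suc j) \<in> {1..l}" using permutes_in_image[OF p] jl by blast+
  show "p j < p (Suc j)"
  proof (rule ccontr)
    assume "\<not> p j < p (Suc j)"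
    then consider "p j = p (Suc j)" | "p (Suc j) < p j" by linarith
    then show False
    proof cases
      case 2
      then have "t (p j) < t (p (Suc j))" using pm by (intro end_decreasing) auto
      then show False using lt by simp
    qed (use lt in simp)
  qed
qed

lemma finite_permuted_walks: "finite (permuted_walks p)"
  unfolding permuted_walks_def by (rule finite_walks)

text \<open>The lemma of Lindstroem, Gessel and Viennot for this situation; the right hand side is a coefficient
  of a determinant of flagged Jacobi-Trudi type.\<close>

theorem card_noncolliding_walks:
  "int (card {n \<in> walks l s t \<beta> a b. \<forall>j i. \<not> collision n j i}) =
    (\<Sum>p | p permutes {1..l}. sign p * int (card (permuted_walks p)))"
proof -
  define U where "U = Sigma {p. p permutes {1..l}} permuted_walks"
  define B where "B = {(p, n) \<in> U. \<exists>j i. collision n j i}"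
  define N where "N = {n \<in> walks l s t \<beta> a b. \<forall>j i. \<not> collision n j i}"
  have finU: "finite U" unfolding U_def by (intro finite_SigmaI finite_permutations finite_permuted_walks) simp
  have B0: "(\<Sum>(p, n)\<in>B. sign p) = 0"
  proof (rule sum_sign_reversing_involution[where \<phi> = reflect])
    fix x assume "x \<in> B"
    then obtain p n where x: "x = (p, n)" and p: "p permutes {1..l}" and n: "n \<in> permuted_walks p"
      and ex: "\<exists>j i. collision n j i"
      by (auto simp: B_def U_def)
    define i where "i = first_time n"
    define j where "j = last_row n"
    obtain j0 i0 where "collision n j0 i0" using ex by blast
    note fc = first_collision[OF this, folded i_def j_def]
    have jl: "j \<in> {1..l}" "Suc j \<in> {1..l}" "i \<in> {1..l}" using fc(1) by (auto simp: collision_def)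
    have mono: "n (j, i - 1) \<le> n (j, i)"
      using walksD(4)[OF n[unfolded permuted_walks_def] jl(1,3)] .
    have refl: "reflect x = (p \<circ> transpose j (Suc j), swap_tails j i n)"
      by (simp add: x reflect_def i_def j_def Let_def)
    note again = swap_tails_collision[OF fc(1) mono fc(2,3)]
    have \<tau>: "transpose j (Suc j) permutes {1..l}" using jl(1,2) by (rule permutes_swap_id)
    have "collision (swap_tails j i n) j i"
    proof -
      have "\<not> i \<le> i - 1" using jl(3) by auto
      then show ?thesis using fc(1) mono by (simp add: collision_def swap_tails_def)
    qed
    then show "reflect x \<in> B"
      using swap_tails_mem[OF p n fc(1,2)] permutes_compose[OF \<tau> p]
      unfolding refl B_def U_def by blast
    show "reflect (reflect x) = x"
      unfolding refl by (simp add: reflect_def again swap_tails_twice x comp_assoc)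
    have "sign (p \<circ> transpose j (Suc j)) = - sign p"
      using permutation_permutes p \<tau> by (subst sign_compose) (auto simp: sign_swap_id)
    then show "(case reflect x of (p, n) \<Rightarrow> sign p) = - (case x of (p, n) \<Rightarrow> sign p)"
      unfolding refl by (simp add: x)
  qed
  have UB: "U - B = {id} \<times> N"
  proof -
    have "(p, n) \<in> U - B \<longleftrightarrow> p = id \<and> n \<in> N" for p n
    proof
      assume "(p, n) \<in> U - B"
      then have pn: "p permutes {1..l}" "n \<in> permuted_walks p" "\<And>j i. \<not> collision n j i"
        by (auto simp: U_def B_def)
      have "p = id" by (rule no_collision_imp_id[OF pn])
      then show "p = id \<and> n \<in> N" using pn by (simp add: N_def permuted_walks_def)
    next
      assume "p = id \<and> n \<in> N"
      then show "(p, n) \<in> U - B" by (auto simp: U_def B_def N_def permuted_walks_def permutes_id)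
    qed
    then show ?thesis by auto
  qed
  have split: "(\<Sum>(p, n)\<in>U. sign p) = (\<Sum>(p, n)\<in>U - B. sign p) + (\<Sum>(p, n)\<in>B. sign p)"
    using finU by (intro sum.subset_diff) (auto simp: B_def)
  have "(\<Sum>(p, n)\<in>{id :: nat \<Rightarrow> nat} \<times> N. sign p) = int (card N)"
    by (simp add: sum.cartesian_product[symmetric])
  then have "int (card N) = (\<Sum>(p, n)\<in>U. sign p)"
    using split unfolding UB B0 by (simp only: add_0_right)
  also have "\<dots> = (\<Sum>p | p permutes {1..l}. \<Sum>n\<in>permuted_walks p. sign p)"
    unfolding U_def by (intro sum.Sigma[symmetric]) (auto simp: finite_permutations finite_permuted_walks)
  also have "\<dots> = (\<Sum>p | p permutes {1..l}. sign p * int (card (permuted_walks p)))"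
    by (simp add: mult.commute)
  finally show ?thesis by (simp add: N_def)
qed

end

section \<open>Polynomiality for large dilation factors\<close>

text \<open>Subtracting the row index turns the weak inequalities of interlacing into the strict ones that
  exclude a collision.\<close>

lemma card_patterns_eq_noncolliding:
  assumes "walk_endpoints l (\<lambda>j. \<mu> j - int j) (\<lambda>j. lam j - int j) a b"
  shows "card (patterns l lam \<mu> \<beta> a b) =
    card {n \<in> walks l (\<lambda>j. \<mu> j - int j) (\<lambda>j. lam j - int j) \<beta> a b.
      \<forall>j i. \<not> walk_endpoints.collision l n j i}"
proof -
  interpret walk_endpoints l "\<lambda>j. \<mu> j - int j" "\<lambda>j. lam j - int j" \<beta> a b by fact
  define shift where "shift c g = (\<lambda>(j, i). if (j, i) \<in> {1..l} \<times> {0..l} then g (j, i) + c * int j else 0)"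
    for c :: int and g :: "nat \<times> nat \<Rightarrow> int"
  have shift_eq: "shift c g (j, i) = g (j, i) + c * int j" if "j \<in> {1..l}" "i \<le> l" for c g j i
    using that by (simp add: shift_def)
  have shift_walks: "shift c g \<in> walks l (\<lambda>j. s j + c * int j) (\<lambda>j. t j + c * int j) \<beta> a b"
    if g: "g \<in> walks l s t \<beta> a b" for c g s t
  proof (rule walksI)
    fix p assume "p \<notin> {1..l} \<times> {0..l}"
    then show "shift c g p = 0" by (cases p) (auto simp: shift_def)
  next
    fix j assume j: "j \<in> {1..l}"
    show "shift c g (j, 0) = s j + c * int j" using walksD(2)[OF g j] j by (simp add: shift_eq)
    show "shift c g (j, l) = t j + c * int j" using walksD(3)[OF g j] j by (simp add: shift_eq)
    fix i assume i: "i \<in> {1..l}"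
    then have il: "i \<le> l" "i - 1 \<le> l" by auto
    show "shift c g (j, i - 1) \<le> shift c g (j, i)"
      unfolding shift_eq[OF j il(1)] shift_eq[OF j il(2)] using walksD(4)[OF g j i] by simp
    show "a j \<le> i \<and> i \<le> b j" if "shift c g (j, i - 1) < shift c g (j, i)"
      using that walksD(5,6)[OF g j i] unfolding shift_eq[OF j il(1)] shift_eq[OF j il(2)] by simp
  next
    fix i assume i: "i \<in> {1..l}"
    then have il: "i \<le> l" "i - 1 \<le> l" by auto
    have "(\<Sum>j\<in>{1..l}. shift c g (j, i) - shift c g (j, i - 1)) = (\<Sum>j\<in>{1..l}. g (j, i) - g (j, i - 1))"
    proof (intro sum.cong refl)
      fix j assume j: "j \<in> {1..l}"
      show "shift c g (j, i) - shift c g (j, i - 1) = g (j, i) - g (j, i - 1)"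
        unfolding shift_eq[OF j il(1)] shift_eq[OF j il(2)] by simp
    qed
    then show "(\<Sum>j\<in>{1..l}. shift c g (j, i) - shift c g (j, i - 1)) = \<beta> i" using walksD(7)[OF g i] by simp
  qed
  have inv: "shift c (shift d g) = g" if "g \<in> walks l s t \<beta> a b" "c + d = 0" for c d g s t
  proof
    fix p :: "nat \<times> nat"
    obtain j i where p: "p = (j, i)" by (cases p)
    have c: "c = - d" using that(2) by simp
    show "shift c (shift d g) p = g p"
    proof (cases "p \<in> {1..l} \<times> {0..l}")
      case True
      then show ?thesis by (simp add: p shift_def c)
    next
      case False
      then have "g p = 0" by (rule walksD(1)[OF that(1)])
      moreover have "(j, i) \<notin> {1..l} \<times> {0..l}" using False unfolding p .
      ultimately show ?thesis by (simp add: p shift_def del: mem_Sigma_iff)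
    qed
  qed
  have interlace: "shift (- 1) g (Suc j, i) < shift (- 1) g (j, i - 1) \<longleftrightarrow> g (Suc j, i) \<le> g (j, i - 1)"
    if "j \<in> {1..<l}" "i \<in> {1..l}" for g j i
  proof -
    have j: "j \<in> {1..l}" "Suc j \<in> {1..l}" and il: "i \<le> l" "i - 1 \<le> l" using that by auto
    show ?thesis unfolding shift_eq[OF j(1) il(2)] shift_eq[OF j(2) il(1)] by auto
  qed
  let ?W = "walks l \<mu> lam \<beta> a b"
  let ?W' = "walks l (\<lambda>j. \<mu> j - int j) (\<lambda>j. lam j - int j) \<beta> a b"
  have mem: "shift (- 1) g \<in> ?W'" if "g \<in> ?W" for g using shift_walks[OF that, of "- 1"] by simp
  have mem': "shift 1 n \<in> ?W" if "n \<in> ?W'" for n using shift_walks[OF that, of 1] by simp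
  have "bij_betw (shift (- 1)) (patterns l lam \<mu> \<beta> a b) {n \<in> ?W'. \<forall>j i. \<not> collision n j i}"
  proof (rule bij_betw_byWitness[where f' = "shift 1"])
    show "\<forall>g\<in>patterns l lam \<mu> \<beta> a b. shift 1 (shift (- 1) g) = g"
    proof
      fix g assume "g \<in> patterns l lam \<mu> \<beta> a b"
      then have "g \<in> ?W" by (simp add: patterns_def)
      then show "shift 1 (shift (- 1) g) = g" by (rule inv) simp
    qed
    show "\<forall>n\<in>{n \<in> ?W'. \<forall>j i. \<not> collision n j i}. shift (- 1) (shift 1 n) = n"
    proof
      fix n assume "n \<in> {n \<in> ?W'. \<forall>j i. \<not> collision n j i}"
      then have "n \<in> ?W'" by blast
      then show "shift (- 1) (shift 1 n) = n" by (rule inv) simp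
    qed
    show "shift (- 1) ` patterns l lam \<mu> \<beta> a b \<subseteq> {n \<in> ?W'. \<forall>j i. \<not> collision n j i}"
    proof
      fix n assume "n \<in> shift (- 1) ` patterns l lam \<mu> \<beta> a b"
      then obtain g where g: "n = shift (- 1) g" "g \<in> patterns l lam \<mu> \<beta> a b" by blast
      have "\<not> collision n j i" for j i
        using interlace[of j i g] g by (auto simp: collision_def patterns_def)
      then show "n \<in> {n \<in> ?W'. \<forall>j i. \<not> collision n j i}" using g mem by (simp add: patterns_def)
    qed
    show "shift 1 ` {n \<in> ?W'. \<forall>j i. \<not> collision n j i} \<subseteq> patterns l lam \<mu> \<beta> a b"
    proof
      fix g assume "g \<in> shift 1 ` {n \<in> ?W'. \<forall>j i. \<not> collision n j i}"
      then obtain n where n: "g = shift 1 n" "n \<in> ?W'" "\<And>j i. \<not> collision n j i" by blast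
      have "n = shift (- 1) g" using n(1) inv[OF n(2), where c = "- 1" and d = 1] by simp
      then have "g (Suc j, i) \<le> g (j, i - 1)" if "j \<in> {1..<l}" "i \<in> {1..l}" for j i
        using n(3)[of j i] interlace[OF that, of g] that by (simp add: collision_def)
      then show "g \<in> patterns l lam \<mu> \<beta> a b" using n mem' by (simp add: patterns_def)
    qed
  qed
  then show ?thesis by (rule bij_betw_same_card)
qed

lemma kostka_determinantal_sum:
  assumes shape: "is_skew_shape l lam \<mu>" and "is_flag l a" "is_flag l b"
  shows "int (flagged_skew_kostka l lam \<mu> \<beta> a b) =
    (\<Sum>p | p permutes {1..l}. sign p * int (card
      (flows {(j, i). j \<in> {1..l} \<and> i \<in> {1..l} \<and> a j \<le> i \<and> i \<le> b (p j)}
        (\<lambda>j. if j \<in> {1..l} then lam (p j) - int (p j) - (\<mu> j - int j) else 0)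
        (\<lambda>i. if i \<in> {1..l} then \<beta> i else 0))))"
proof -
  have part: "lam j' \<le> lam j" "\<mu> j' \<le> \<mu> j" if "1 \<le> j" "j \<le> j'" "j' \<le> l" for j j'
    using shape that unfolding is_skew_shape_def is_partition_def monotone_on_def by simp_all
  have flag: "a j \<le> a j'" "b j \<le> b j'" if "1 \<le> j" "j \<le> j'" "j' \<le> l" for j j'
    using assms(2,3) that unfolding is_flag_def monotone_on_def by simp_all
  interpret walk_endpoints l "\<lambda>j. \<mu> j - int j" "\<lambda>j. lam j - int j" \<beta> a b
  proof
    show "\<mu> (Suc j) - int (Suc j) < \<mu> j - int j" if "j \<in> {1..<l}" for j using part(2)[of j "Suc j"] that by simp
    show "lam j' - int j' < lam j - int j" if "1 \<le> j" "j < j'" "j' \<le> l" for j j' using part(1)[of j j'] that by simp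
    show "a j \<le> a (Suc j)" if "j \<in> {1..<l}" for j using flag(1)[of j "Suc j"] that by simp
    show "b j \<le> b j'" if "1 \<le> j" "j \<le> j'" "j' \<le> l" for j j' using flag(2) that by blast
  qed
  have "card (permuted_walks p) = card (flows {(j, i). j \<in> {1..l} \<and> i \<in> {1..l} \<and> a j \<le> i \<and> i \<le> b (p j)}
        (\<lambda>j. if j \<in> {1..l} then lam (p j) - int (p j) - (\<mu> j - int j) else 0)
        (\<lambda>i. if i \<in> {1..l} then \<beta> i else 0))" for p
    using walks_bij_flows[of l "\<lambda>j. \<mu> j - int j" "(\<lambda>j. lam j - int j) \<circ> p" \<beta> a "b \<circ> p"]
    unfolding permuted_walks_def comp_def by (auto dest: bij_betw_same_card)
  then show ?thesis
    using kostka_eq_card_patterns[OF shape, of \<beta> a b] card_patterns_eq_noncolliding[of l \<mu> lam a b \<beta>]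
      card_noncolliding_walks walk_endpoints_axioms by simp
qed

text \<open>Whether the dilated and shifted pair is a skew shape depends on finitely many affine inequalities
  in \<open>k\<close>, so the answer is the same for all large \<open>k\<close>.\<close>

definition decided :: "(int \<Rightarrow> bool) \<Rightarrow> bool" where
  "decided P \<longleftrightarrow> (\<forall>\<^sub>F k in at_top. P k) \<or> (\<forall>\<^sub>F k in at_top. \<not> P k)"

lemma decided_linear: "decided (\<lambda>k. k * c + d \<le> k * c' + d')"
proof -
  consider "c < c'" | "c' < c" | "c = c'" by linarith
  then show ?thesis
  proof cases
    case 1
    have "k * c + d \<le> k * c' + d'" if "k \<ge> \<bar>d - d'\<bar>" for k
    proof -
      have "k * 1 \<le> k * (c' - c)" using 1 that by (intro mult_left_mono) auto
      then show ?thesis using that by (simp add: algebra_simps)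
    qed
    then show ?thesis unfolding decided_def eventually_at_top_linorder by blast
  next
    case 2
    have "\<not> k * c + d \<le> k * c' + d'" if "k \<ge> \<bar>d - d'\<bar> + 1" for k
    proof -
      have "k * 1 \<le> k * (c - c')" using 2 that by (intro mult_left_mono) auto
      then show ?thesis using that by (simp add: algebra_simps)
    qed
    then show ?thesis unfolding decided_def eventually_at_top_linorder by blast
  qed (auto simp: decided_def)
qed

lemma decided_conj:
  assumes "decided P" "decided Q"
  shows "decided (\<lambda>k. P k \<and> Q k)"
proof -
  consider "\<forall>\<^sub>F k in at_top. P k" "\<forall>\<^sub>F k in at_top. Q k"
    | "\<forall>\<^sub>F k in at_top. \<not> P k" | "\<forall>\<^sub>F k in at_top. \<not> Q k"
    using assms unfolding decided_def by blast
  then show ?thesis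
  proof cases
    case 1
    then show ?thesis unfolding decided_def by (intro disjI1 eventually_conj)
  next
    case 2
    then have "\<forall>\<^sub>F k in at_top. \<not> (P k \<and> Q k)" by (rule eventually_mono) blast
    then show ?thesis unfolding decided_def by blast
  next
    case 3
    then have "\<forall>\<^sub>F k in at_top. \<not> (P k \<and> Q k)" by (rule eventually_mono) blast
    then show ?thesis unfolding decided_def by blast
  qed
qed

lemma decided_ball:
  assumes "finite A" "\<And>x. x \<in> A \<Longrightarrow> decided (P x)"
  shows "decided (\<lambda>k. \<forall>x\<in>A. P x k)"
  using assms
proof (induction A)
  case empty
  then show ?case by (simp add: decided_def)
next
  case (insert x A)
  then have "decided (\<lambda>k. P x k \<and> (\<forall>x\<in>A. P x k))" by (intro decided_conj) auto
  then show ?case by simp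
qed

lemma decided_imp:
  assumes "decided P"
  shows "decided (\<lambda>k. c \<longrightarrow> P k)"
proof (cases c)
  case True
  then show ?thesis using assms by (simp only: simp_thms)
next
  case False
  then show ?thesis unfolding decided_def by simp
qed

lemma decided_partition: "decided (\<lambda>k. is_partition l (\<lambda>j. k * f j + g j))"
proof -
  have "decided (\<lambda>k. j \<le> j' \<longrightarrow> k * f j' + g j' \<le> k * f j + g j)" for j j' :: nat
    by (rule decided_imp[OF decided_linear])
  then have "decided (\<lambda>k. \<forall>j\<in>{1..l}. \<forall>j'\<in>{1..l}. j \<le> j' \<longrightarrow> k * f j' + g j' \<le> k * f j + g j)"
    by (rule decided_ball[OF finite_atLeastAtMost decided_ball[OF finite_atLeastAtMost]])
  moreover have "decided (\<lambda>k. 0 \<le> k * f j + g j)" for j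
    using decided_linear[of 0 0 "f j" "g j"] by simp
  then have "decided (\<lambda>k. \<forall>j\<in>{1..l}. 0 \<le> k * f j + g j)"
    by (rule decided_ball[OF finite_atLeastAtMost])
  ultimately show ?thesis
    unfolding is_partition_def monotone_on_def by (rule decided_conj)
qed

text \<open>For large \<open>k\<close> either the shape is never skew and the coefficient is zero, or it always is, and the
  coefficient is the sum, with signs, of counts of matrices with margins affine in \<open>k\<close>.\<close>

theorem eventually_poly_kostka:
  assumes "is_flag l a" "is_flag l b"
  shows "eventually_poly (\<lambda>k. of_nat (flagged_skew_kostka l (\<lambda>j. k * lam j + \<nu> j) (\<lambda>j. k * \<mu> j + \<rho> j)
    (\<lambda>j. k * \<beta> j + \<eta> j) a b))"
proof -
  let ?K = "\<lambda>k. flagged_skew_kostka l (\<lambda>j. k * lam j + \<nu> j) (\<lambda>j. k * \<mu> j + \<rho> j) (\<lambda>j. k * \<beta> j + \<eta> j) a b"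
  let ?S = "\<lambda>k. is_skew_shape l (\<lambda>j. k * lam j + \<nu> j) (\<lambda>j. k * \<mu> j + \<rho> j)"
  have "decided ?S"
    unfolding is_skew_shape_def
    by (rule decided_conj[OF decided_partition decided_conj[OF decided_partition
          decided_ball[OF finite_atLeastAtMost decided_linear]]])
  then consider "\<forall>\<^sub>F k in at_top. ?S k" | "\<forall>\<^sub>F k in at_top. \<not> ?S k" by (auto simp: decided_def)
  then show ?thesis
  proof cases
    case 2
    then have "\<forall>\<^sub>F k in at_top. (of_nat (?K k) :: rat) = 0"
      by eventually_elim (simp add: flagged_skew_kostka_def)
    then show ?thesis by (rule eventually_poly_cong[OF eventually_poly_const])
  next
    case 1
    define E where "E p = {(j, i). j \<in> {1..l} \<and> i \<in> {1..l} \<and> a j \<le> i \<and> i \<le> b (p j)}" for p :: "nat \<Rightarrow> nat"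
    define \<alpha> where "\<alpha> p j = (if j \<in> {1..l} then lam (p j) - \<mu> j else 0)" for p :: "nat \<Rightarrow> nat" and j
    define \<gamma> where "\<gamma> p j = (if j \<in> {1..l} then \<nu> (p j) - int (p j) - (\<rho> j - int j) else 0)"
      for p :: "nat \<Rightarrow> nat" and j
    define \<beta>' where "\<beta>' i = (if i \<in> {1..l} then \<beta> i else 0)" for i
    define \<eta>' where "\<eta>' i = (if i \<in> {1..l} then \<eta> i else 0)" for i
    let ?f = "\<lambda>p k. card (flows (E p) (\<lambda>j. k * \<alpha> p j + \<gamma> p j) (\<lambda>i. k * \<beta>' i + \<eta>' i))"
    have "finite (E p)" for p
      unfolding E_def by (rule finite_subset[of _ "{1..l} \<times> {1..l}"]) auto
    then have poly: "eventually_poly (\<lambda>k. \<Sum>p | p permutes {1..l}. of_int (sign p) * of_nat (?f p k))"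
      by (intro eventually_poly_sum eventually_poly_cmult eventually_poly_flows finite_permutations) simp_all
    have "of_nat (?K k) = (\<Sum>p | p permutes {1..l}. of_int (sign p) * of_nat (?f p k) :: rat)" if "?S k" for k
    proof -
      have rows: "(\<lambda>j. if j \<in> {1..l} then k * lam (p j) + \<nu> (p j) - int (p j) - (k * \<mu> j + \<rho> j - int j) else 0) =
          (\<lambda>j. k * \<alpha> p j + \<gamma> p j)" for p :: "nat \<Rightarrow> nat"
        by (rule ext) (simp add: \<alpha>_def \<gamma>_def algebra_simps)
      have cols: "(\<lambda>i. if i \<in> {1..l} then k * \<beta> i + \<eta> i else 0) = (\<lambda>i. k * \<beta>' i + \<eta>' i)"
        by (rule ext) (simp add: \<beta>'_def \<eta>'_def)
      have "int (?K k) = (\<Sum>p | p permutes {1..l}. sign p * int (?f p k))"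
        using kostka_determinantal_sum[OF that assms, of "\<lambda>j. k * \<beta> j + \<eta> j"]
        unfolding rows cols E_def[symmetric] .
      then have "(of_int (int (?K k)) :: rat) = of_int (\<Sum>p | p permutes {1..l}. sign p * int (?f p k))"
        by (rule arg_cong)
      then show ?thesis by simp
    qed
    then show ?thesis
      by (intro eventually_poly_cong[OF poly] eventually_mono[OF 1])
  qed
qed

section \<open>The cone of patterns\<close>

text \<open>The coordinate \<open>(0, 0)\<close> is outside the index range of the walks and holds the dilation factor. The
  equations of a pattern become homogeneous in this way; each of them is represented by two opposite
  forms.\<close>

definition pattern_forms :: "nat \<Rightarrow> (nat \<Rightarrow> int) \<Rightarrow> (nat \<Rightarrow> int) \<Rightarrow> (nat \<Rightarrow> int) \<Rightarrow> (nat \<Rightarrow> nat) \<Rightarrow>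
    (nat \<Rightarrow> nat) \<Rightarrow> ((nat \<times> nat \<Rightarrow> int) \<Rightarrow> int) set" where
  "pattern_forms l lam \<mu> \<beta> a b =
     {\<lambda>x. x (0, 0)} \<union>
     (\<lambda>(j, i) x. x (j, i) - x (j, i - 1)) ` ({1..l} \<times> {1..l}) \<union>
     (\<lambda>(j, i) x. x (j, i - 1) - x (j, i)) ` {(j, i) \<in> {1..l} \<times> {1..l}. \<not> (a j \<le> i \<and> i \<le> b j)} \<union>
     (\<lambda>(j, i) x. x (j, i - 1) - x (Suc j, i)) ` ({1..<l} \<times> {1..l}) \<union>
     (\<lambda>(c, j) x. c * (x (j, 0) - x (0, 0) * \<mu> j)) ` ({1, -1} \<times> {1..l}) \<union>
     (\<lambda>(c, j) x. c * (x (j, l) - x (0, 0) * lam j)) ` ({1, -1} \<times> {1..l}) \<union>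
     (\<lambda>(c, i) x. c * ((\<Sum>j\<in>{1..l}. x (j, i) - x (j, i - 1)) - x (0, 0) * \<beta> i)) ` ({1, -1} \<times> {1..l})"

definition pattern_lattice :: "nat \<Rightarrow> (nat \<times> nat \<Rightarrow> int) set" where
  "pattern_lattice l = {x. \<forall>p. p \<notin> insert (0, 0) ({1..l} \<times> {0..l}) \<longrightarrow> x p = 0}"

lemma pattern_forms_nonneg_iff:
  assumes x: "x \<in> pattern_lattice l"
  shows "(\<forall>\<phi>\<in>pattern_forms l lam \<mu> \<beta> a b. 0 \<le> \<phi> x) \<longleftrightarrow>
    0 \<le> x (0, 0) \<and> x((0, 0) := 0) \<in>
      patterns l (\<lambda>j. x (0, 0) * lam j) (\<lambda>j. x (0, 0) * \<mu> j) (\<lambda>j. x (0, 0) * \<beta> j) a b"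
proof -
  let ?g = "x((0, 0) := 0)"
  have image: "(\<forall>\<phi>\<in>(\<lambda>(c, j). h c j) ` A. 0 \<le> \<phi> x) \<longleftrightarrow> (\<forall>c j. (c, j) \<in> A \<longrightarrow> 0 \<le> h c j x)"
    for h :: "'c \<Rightarrow> 'd \<Rightarrow> (nat \<times> nat \<Rightarrow> int) \<Rightarrow> int" and A
    by fastforce
  have plus_minus: "(\<forall>c j. (c, j) \<in> {1, -1} \<times> A \<longrightarrow> 0 \<le> c * y j) \<longleftrightarrow> (\<forall>j\<in>A. y j = 0)"
    for y :: "nat \<Rightarrow> int" and A
  proof
    assume nonneg: "\<forall>c j. (c, j) \<in> {1, -1} \<times> A \<longrightarrow> 0 \<le> c * y j"
    show "\<forall>j\<in>A. y j = 0"
    proof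
      fix j assume "j \<in> A"
      then have "0 \<le> 1 * y j" "0 \<le> - 1 * y j" using nonneg by blast+
      then show "y j = 0" by simp
    qed
  qed auto
  have steps: "(\<forall>j i. (j, i) \<in> {1..l} \<times> {1..l} \<longrightarrow> 0 \<le> x (j, i) - x (j, i - 1)) \<longleftrightarrow>
      (\<forall>j\<in>{1..l}. \<forall>i\<in>{1..l}. x (j, i - 1) \<le> x (j, i))"
    "(\<forall>j i. (j, i) \<in> {(j, i) \<in> {1..l} \<times> {1..l}. \<not> (a j \<le> i \<and> i \<le> b j)} \<longrightarrow> 0 \<le> x (j, i - 1) - x (j, i)) \<longleftrightarrow>
      (\<forall>j\<in>{1..l}. \<forall>i\<in>{1..l}. \<not> (a j \<le> i \<and> i \<le> b j) \<longrightarrow> x (j, i) \<le> x (j, i - 1))"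
    "(\<forall>j i. (j, i) \<in> {1..<l} \<times> {1..l} \<longrightarrow> 0 \<le> x (j, i - 1) - x (Suc j, i)) \<longleftrightarrow>
      (\<forall>j\<in>{1..<l}. \<forall>i\<in>{1..l}. x (Suc j, i) \<le> x (j, i - 1))"
    unfolding diff_ge_0_iff_ge by blast+
  have "(\<forall>\<phi>\<in>pattern_forms l lam \<mu> \<beta> a b. 0 \<le> \<phi> x) \<longleftrightarrow> 0 \<le> x (0, 0) \<and>
    (\<forall>j\<in>{1..l}. \<forall>i\<in>{1..l}. x (j, i - 1) \<le> x (j, i)) \<and>
    (\<forall>j\<in>{1..l}. \<forall>i\<in>{1..l}. \<not> (a j \<le> i \<and> i \<le> b j) \<longrightarrow> x (j, i) \<le> x (j, i - 1)) \<and>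
    (\<forall>j\<in>{1..<l}. \<forall>i\<in>{1..l}. x (Suc j, i) \<le> x (j, i - 1)) \<and>
    (\<forall>j\<in>{1..l}. x (j, 0) - x (0, 0) * \<mu> j = 0) \<and> (\<forall>j\<in>{1..l}. x (j, l) - x (0, 0) * lam j = 0) \<and>
    (\<forall>i\<in>{1..l}. (\<Sum>j\<in>{1..l}. x (j, i) - x (j, i - 1)) - x (0, 0) * \<beta> i = 0)"
    unfolding pattern_forms_def ball_Un image plus_minus steps
    by (simp only: ball_simps simp_thms conj_assoc)
  also have "\<dots> \<longleftrightarrow> 0 \<le> x (0, 0) \<and>
      ?g \<in> patterns l (\<lambda>j. x (0, 0) * lam j) (\<lambda>j. x (0, 0) * \<mu> j) (\<lambda>j. x (0, 0) * \<beta> j) a b"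
    (is "_ \<and> ?conds \<longleftrightarrow> _ \<and> ?g \<in> ?P")
  proof -
    have g: "?g (j, i) = x (j, i)" if "j \<in> {1..l}" for j i using that by auto
    have g': "?g (Suc j, i) = x (Suc j, i)" for j i by simp
    have sums: "(\<Sum>j\<in>{1..l}. ?g (j, i) - ?g (j, i')) = (\<Sum>j\<in>{1..l}. x (j, i) - x (j, i'))" for i i'
      by (intro sum.cong refl) (simp only: g)
    have "?g \<in> ?P" if c: ?conds
    proof -
      have "?g \<in> walks l (\<lambda>j. x (0, 0) * \<mu> j) (\<lambda>j. x (0, 0) * lam j) (\<lambda>j. x (0, 0) * \<beta> j) a b"
      proof (rule walksI)
        fix p assume "p \<notin> {1..l} \<times> {0..l}"
        then have "p = (0, 0) \<or> p \<notin> insert (0, 0) ({1..l} \<times> {0..l})" by blast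
        moreover have "x q = 0" if "q \<notin> insert (0, 0) ({1..l} \<times> {0..l})" for q
          using x that unfolding pattern_lattice_def by blast
        ultimately show "?g p = 0" by (metis fun_upd_apply)
      next
        fix j assume j: "j \<in> {1..l}"
        have "x (j, 0) - x (0, 0) * \<mu> j = 0" "x (j, l) - x (0, 0) * lam j = 0" using c j by blast+
        then show "?g (j, 0) = x (0, 0) * \<mu> j" "?g (j, l) = x (0, 0) * lam j"
          unfolding g[OF j] by simp_all
        fix i assume i: "i \<in> {1..l}"
        show "?g (j, i - 1) \<le> ?g (j, i)" unfolding g[OF j] using c j i by blast
        show "a j \<le> i \<and> i \<le> b j" if "?g (j, i - 1) < ?g (j, i)"
        proof (rule ccontr)
          assume "\<not> (a j \<le> i \<and> i \<le> b j)"
          then have "x (j, i) \<le> x (j, i - 1)" using c j i by blast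
          then show False using that unfolding g[OF j] by simp
        qed
      next
        fix i assume "i \<in> {1..l}"
        then have "(\<Sum>j\<in>{1..l}. x (j, i) - x (j, i - 1)) - x (0, 0) * \<beta> i = 0" using c by blast
        then show "(\<Sum>j\<in>{1..l}. ?g (j, i) - ?g (j, i - 1)) = x (0, 0) * \<beta> i"
          unfolding sums by simp
      qed
      moreover have "?g (Suc j, i) \<le> ?g (j, i - 1)" if "j \<in> {1..<l}" "i \<in> {1..l}" for j i
      proof -
        have j: "j \<in> {1..l}" using that by simp
        show ?thesis unfolding g[OF j] g' using c that by blast
      qed
      ultimately show ?thesis unfolding patterns_def by blast
    qed
    moreover have ?conds if "?g \<in> ?P"
    proof -
      have w: "?g \<in> walks l (\<lambda>j. x (0, 0) * \<mu> j) (\<lambda>j. x (0, 0) * lam j) (\<lambda>j. x (0, 0) * \<beta> j) a b"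
        and inter: "\<And>j i. j \<in> {1..<l} \<Longrightarrow> i \<in> {1..l} \<Longrightarrow> ?g (Suc j, i) \<le> ?g (j, i - 1)"
        using that unfolding patterns_def by blast+
      note D = walksD[OF w]
      show ?conds
      proof (intro conjI ballI impI)
        fix j i assume j: "j \<in> {1..l}" and i: "i \<in> {1..l}"
        show "x (j, i - 1) \<le> x (j, i)" using D(4)[OF j i] unfolding g[OF j] .
        assume "\<not> (a j \<le> i \<and> i \<le> b j)"
        then show "x (j, i) \<le> x (j, i - 1)" using D(5,6)[OF j i] unfolding g[OF j] by force
      next
        fix j i assume j: "j \<in> {1..<l}" and i: "i \<in> {1..l}"
        then have j': "j \<in> {1..l}" by simp
        show "x (Suc j, i) \<le> x (j, i - 1)" using inter[OF j i] unfolding g[OF j'] g' .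
      next
        fix j assume j: "j \<in> {1..l}"
        show "x (j, 0) - x (0, 0) * \<mu> j = 0" "x (j, l) - x (0, 0) * lam j = 0"
          using D(2)[OF j] D(3)[OF j] unfolding g[OF j] by simp_all
      next
        fix i assume i: "i \<in> {1..l}"
        show "(\<Sum>j\<in>{1..l}. x (j, i) - x (j, i - 1)) - x (0, 0) * \<beta> i = 0"
          using D(7)[OF i] unfolding sums by simp
      qed
    qed
    ultimately show ?thesis by blast
  qed
  finally show ?thesis .
qed

lemma pattern_cone_level_bij:
  assumes "0 \<le> k"
  shows "bij_betw (\<lambda>x. x((0, 0) := 0))
    {x \<in> {x \<in> pattern_lattice l. \<forall>\<phi>\<in>pattern_forms l lam \<mu> \<beta> a b. 0 \<le> \<phi> x}. x (0, 0) = k}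
    (patterns l (\<lambda>j. k * lam j) (\<lambda>j. k * \<mu> j) (\<lambda>j. k * \<beta> j) a b)"
proof (rule bij_betw_byWitness[where f' = "\<lambda>g. g((0, 0) := k)"])
  have zero: "g (0, 0) = 0" if "g \<in> patterns l lam \<mu> \<beta> a b" for g lam \<mu> \<beta>
    using that walksD(1)[of g l \<mu> lam \<beta> a b "(0, 0)"] by (simp add: patterns_def)
  show "\<forall>g\<in>patterns l (\<lambda>j. k * lam j) (\<lambda>j. k * \<mu> j) (\<lambda>j. k * \<beta> j) a b.
      (g((0, 0) := k))((0, 0) := 0) = g"
    using zero by (auto simp: fun_eq_iff)
  show "(\<lambda>g. g((0, 0) := k)) ` patterns l (\<lambda>j. k * lam j) (\<lambda>j. k * \<mu> j) (\<lambda>j. k * \<beta> j) a b \<subseteq>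
    {x \<in> {x \<in> pattern_lattice l. \<forall>\<phi>\<in>pattern_forms l lam \<mu> \<beta> a b. 0 \<le> \<phi> x}. x (0, 0) = k}"
  proof
    fix x assume "x \<in> (\<lambda>g. g((0, 0) := k)) ` patterns l (\<lambda>j. k * lam j) (\<lambda>j. k * \<mu> j) (\<lambda>j. k * \<beta> j) a b"
    then obtain g where g: "g \<in> patterns l (\<lambda>j. k * lam j) (\<lambda>j. k * \<mu> j) (\<lambda>j. k * \<beta> j) a b"
      and x: "x = g((0, 0) := k)" by blast
    have "x \<in> pattern_lattice l"
      unfolding pattern_lattice_def mem_Collect_eq
    proof (intro allI impI)
      fix p :: "nat \<times> nat" assume p: "p \<notin> insert (0, 0) ({1..l} \<times> {0..l})"
      have "g \<in> walks l (\<lambda>j. k * \<mu> j) (\<lambda>j. k * lam j) (\<lambda>j. k * \<beta> j) a b" using g by (simp add: patterns_def)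
      then have "g p = 0" using p by (intro walksD(1)[of g]) auto
      then show "x p = 0" using p x by simp
    qed
    moreover have "x((0, 0) := 0) = g" using zero[OF g] by (auto simp: x fun_eq_iff)
    ultimately show "x \<in> {x \<in> {x \<in> pattern_lattice l. \<forall>\<phi>\<in>pattern_forms l lam \<mu> \<beta> a b. 0 \<le> \<phi> x}. x (0, 0) = k}"
      using g assms pattern_forms_nonneg_iff[of x l lam \<mu> \<beta> a b] by (simp add: x)
  qed
  show "(\<lambda>x. x((0, 0) := 0)) `
    {x \<in> {x \<in> pattern_lattice l. \<forall>\<phi>\<in>pattern_forms l lam \<mu> \<beta> a b. 0 \<le> \<phi> x}. x (0, 0) = k}
    \<subseteq> patterns l (\<lambda>j. k * lam j) (\<lambda>j. k * \<mu> j) (\<lambda>j. k * \<beta> j) a b"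
    by (intro image_subsetI) (auto simp: pattern_forms_nonneg_iff)
qed auto

lemma graded_cone_patterns:
  "graded_cone (pattern_lattice l) (pattern_forms l lam \<mu> \<beta> a b) (\<lambda>x. x (0, 0))"
proof
  have fin: "finite {(j, i) \<in> {1..l} \<times> {1..l}. \<not> (a j \<le> i \<and> i \<le> b j)}"
    by (rule finite_subset[of _ "{1..l} \<times> {1..l}"]) auto
  show "finite (pattern_forms l lam \<mu> \<beta> a b)"
    unfolding pattern_forms_def by (intro finite_UnI finite_imageI finite_cartesian_product fin) auto
  show "(\<lambda>i. c * x i + d * y i) \<in> pattern_lattice l"
    if "x \<in> pattern_lattice l" "y \<in> pattern_lattice l" for x y c d
    using that by (simp add: pattern_lattice_def)
  show "(\<lambda>_. 0) \<in> pattern_lattice l" by (simp add: pattern_lattice_def)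
  show "\<phi> (\<lambda>i. c * x i + d * y i) = c * \<phi> x + d * \<phi> y"
    if "\<phi> \<in> insert (\<lambda>x. x (0, 0)) (pattern_forms l lam \<mu> \<beta> a b)" for \<phi> c x d y
    using that unfolding pattern_forms_def
    by (auto simp: algebra_simps sum.distrib sum_subtractf sum_negf sum_distrib_left)
  show "finite {x \<in> pattern_lattice l. (\<forall>\<phi>\<in>pattern_forms l lam \<mu> \<beta> a b. 0 \<le> \<phi> x) \<and> x (0, 0) = k}" for k
  proof (cases "0 \<le> k")
    case True
    have "finite (patterns l (\<lambda>j. k * lam j) (\<lambda>j. k * \<mu> j) (\<lambda>j. k * \<beta> j) a b)"
      using finite_walks by (simp add: patterns_def)
    then show ?thesis using bij_betw_finite[OF pattern_cone_level_bij[OF True]] by simp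
  next
    case False
    then have "{x \<in> pattern_lattice l. (\<forall>\<phi>\<in>pattern_forms l lam \<mu> \<beta> a b. 0 \<le> \<phi> x) \<and> x (0, 0) = k} = {}"
      using pattern_forms_nonneg_iff by blast
    then show ?thesis by (simp only: finite.emptyI)
  qed
  show "x = (\<lambda>_. 0)" if x: "x \<in> pattern_lattice l" "\<forall>\<phi>\<in>pattern_forms l lam \<mu> \<beta> a b. 0 \<le> \<phi> x" "x (0, 0) \<le> 0" for x
  proof -
    have x0: "x (0, 0) = 0" and "x((0, 0) := 0) \<in> patterns l (\<lambda>j. x (0, 0) * lam j) (\<lambda>j. x (0, 0) * \<mu> j) (\<lambda>j. x (0, 0) * \<beta> j) a b"
      using x pattern_forms_nonneg_iff[OF x(1), of lam \<mu> \<beta> a b] by auto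
    then have w: "x \<in> walks l (\<lambda>_. 0) (\<lambda>_. 0) (\<lambda>_. 0) a b"
      by (simp add: patterns_def fun_upd_idem)
    have "x (j, i) = 0" for j i
    proof (cases "j \<in> {1..l} \<and> i \<le> l")
      case True
      then show ?thesis
        using walks_mono[OF w, of j 0 i] walks_mono[OF w, of j i l] walksD(2,3)[OF w, of j] by force
    next
      case False
      then show ?thesis using walksD(1)[OF w, of "(j, i)"] by auto
    qed
    then show ?thesis by auto
  qed
qed

section \<open>Polynomiality for all dilation factors\<close>

theorem corollary36:
  fixes l :: nat
    and lam \<mu> \<nu> \<rho> \<beta> \<eta> :: "nat \<Rightarrow> int"
    and a b :: "nat \<Rightarrow> nat"
  assumes "is_skew_shape l lam \<mu>"
    and "is_flag l a" and "is_flag l b"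
  shows "(\<exists>(p :: rat poly) (k0 :: int). \<forall>k \<ge> k0.
            of_nat (flagged_skew_kostka l (\<lambda>j. k * lam j + \<nu> j) (\<lambda>j. k * \<mu> j + \<rho> j)
              (\<lambda>j. k * \<beta> j + \<eta> j) a b) = poly p (of_int k)) \<and>
         (\<exists>q :: rat poly. \<forall>k :: int. 0 \<le> k \<longrightarrow>
            (k = 0 \<longrightarrow> (\<exists>m \<ge> 1. flagged_skew_kostka l (\<lambda>j. m * lam j) (\<lambda>j. m * \<mu> j)
              (\<lambda>j. m * \<beta> j) a b \<noteq> 0)) \<longrightarrow>
            of_nat (flagged_skew_kostka l (\<lambda>j. k * lam j) (\<lambda>j. k * \<mu> j)
              (\<lambda>j. k * \<beta> j) a b) = poly q (of_int k))"
proof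
  show "\<exists>(p :: rat poly) (k0 :: int). \<forall>k \<ge> k0.
      of_nat (flagged_skew_kostka l (\<lambda>j. k * lam j + \<nu> j) (\<lambda>j. k * \<mu> j + \<rho> j)
        (\<lambda>j. k * \<beta> j + \<eta> j) a b) = poly p (of_int k)"
    using eventually_poly_kostka[OF assms(2,3)]
    unfolding eventually_poly_def eventually_at_top_linorder .
next
  let ?K = "\<lambda>k. flagged_skew_kostka l (\<lambda>j. k * lam j) (\<lambda>j. k * \<mu> j) (\<lambda>j. k * \<beta> j) a b"
  interpret graded_cone "pattern_lattice l" "pattern_forms l lam \<mu> \<beta> a b" "\<lambda>x. x (0, 0)"
    by (rule graded_cone_patterns)
  let ?X = "{x \<in> pattern_lattice l. \<forall>\<phi>\<in>pattern_forms l lam \<mu> \<beta> a b. 0 \<le> \<phi> x}"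
  have shape: "is_skew_shape l (\<lambda>j. k * lam j) (\<lambda>j. k * \<mu> j)" if "0 \<le> k" for k
    using assms(1) that unfolding is_skew_shape_def is_partition_def monotone_on_def
    by (auto intro: mult_left_mono)
  have K: "num_points ?X k = of_nat (?K k)" if "0 \<le> k" for k
    unfolding num_points_def kostka_eq_card_patterns[OF shape[OF that]]
    using bij_betw_same_card[OF pattern_cone_level_bij[OF that]] by simp
  show "\<exists>q :: rat poly. \<forall>k :: int. 0 \<le> k \<longrightarrow> (k = 0 \<longrightarrow> (\<exists>m \<ge> 1. ?K m \<noteq> 0)) \<longrightarrow>
      of_nat (?K k) = poly q (of_int k)"
  proof (cases "\<exists>m\<ge>1. ?K m \<noteq> 0")
    case False
    then have "of_nat (?K k) = poly (0 :: rat poly) (of_int k)"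
      if "0 \<le> k" "k = 0 \<longrightarrow> (\<exists>m \<ge> 1. ?K m \<noteq> 0)" for k
      using that by (cases "k = 0") auto
    then show ?thesis by blast
  next
    case True
    then obtain m where m: "1 \<le> m" "?K m \<noteq> 0" by blast
    then have "patterns l (\<lambda>j. m * lam j) (\<lambda>j. m * \<mu> j) (\<lambda>j. m * \<beta> j) a b \<noteq> {}"
      using kostka_eq_card_patterns[OF shape, of m "\<lambda>j. m * \<beta> j" a b] by auto
    then have "{x \<in> ?X. x (0, 0) = m} \<noteq> {}"
      using pattern_cone_level_bij[of m l lam \<mu> \<beta> a b] m(1) by (auto simp: bij_betw_def)
    then obtain x where x: "x \<in> ?X" "x (0, 0) = m" by blast
    then have "x \<noteq> (\<lambda>_. 0)" using m(1) by auto
    then obtain ms where ms: "\<forall>m\<in>set ms. 0 < m" "\<And>k. k \<ge> sum_list ms \<Longrightarrow> bdiffs ms (num_points ?X) k = 0"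
      using bdiffs_num_points_cone[of x] x(1) by blast
    obtain q :: "rat poly" where "\<forall>\<^sub>F k in at_top. of_nat (?K k) = poly q (of_int k)"
      using eventually_poly_kostka[OF assms(2,3), of lam "\<lambda>_. 0" \<mu> "\<lambda>_. 0" \<beta> "\<lambda>_. 0"]
      by (auto simp: eventually_poly_def)
    then have "\<forall>\<^sub>F k in at_top. num_points ?X k = poly q (of_int k)"
      using eventually_ge_at_top[of 0] by eventually_elim (simp add: K)
    then have "num_points ?X k = poly q (of_int k)" if "0 \<le> k" for k
      using that by (intro eq_poly_of_bdiffs_zero[OF ms(1) ms(2)])
    then show ?thesis using K by auto
  qed
qed

end
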